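(* Let $N\ge 1$, $m\geq 2$, let $T_1,\dots,T_m:\mathbb{R}^N\to\mathbb{R}^N$ be non-singular linear maps with $\|T_i\|<\tfrac12$ for all $1\le i\le m$, and let $p_1,\dots,p_m>0$ with $\sum_{i=1}^m p_i=1$. For $\omega=(\omega_1,\dots,\omega_m)\in\mathbb{R}^{Nm}$ let $S_i(x)=T_i(x)+\omega_i$ $(i=1,\dots,m)$, let $E^\omega$ be the self-affine set, i.e. the unique non-empty compact set with $E^\omega=\bigcup_{i=1}^m S_i(E^\omega)$, let $\mu$ be the Bernoulli measure on $I_\infty=\{1,\dots,m\}^{\mathbb{N}}$ with probabilities $p_1,\dots,p_m$, and let $\mu^\omega$ be the projection of $\mu$ onto $E^\omega$, that is, the self-affine measure satisfying $\mu^\omega(A)=\sum_{i=1}^m p_i\,\mu^\omega(S_i^{-1}(A))$. Then, for $Nm$-dimensional Lebesgue almost all $(\omega_1,\dots,\omega_m)\in\mathbb{R}^{Nm}$, the measure $\mu^\omega$ is exact dimensional, with $$\lim_{r\to0}\frac{\log\mu^\omega(B(x,r))}{\log r}=D^1(\mu^\omega)=\min\{d_1,N\}$$ for $\mu^\omega$-almost all $x$ (in particular the limit exists).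
   Context: $\|\cdot\|$ is the operator norm for the Euclidean norm. $B(x,r)$ is the closed ball with centre $x$ and radius $r$. Code space: $I_k=\{1,\dots,m\}^k$, $I=\bigcup_{k\ge0}I_k$, $I_\infty=\{1,\dots,m\}^{\mathbb{N}}$; for $\mathbf{i}\in I$, $|\mathbf{i}|$ is its length and $C_{\mathbf{i}}\subset I_\infty$ is the cylinder of all infinite sequences beginning with $\mathbf{i}$. The Bernoulli measure $\mu$ is the Borel probability measure on $I_\infty$ with $\mu(C_{\mathbf{i}})=p_{i_1}\cdots p_{i_k}$ for $\mathbf{i}=(i_1,\dots,i_k)$. For $\mathbf{i}=(i_1,\dots,i_k)\in I$ write $T_{\mathbf{i}}=T_{i_1}\cdots T_{i_k}$. Projection: for $\mathbf{i}=(i_1,i_2,\dots)\in I_\infty$ let $x^\omega(\mathbf{i})=\omega_{i_1}+T_{i_1}\omega_{i_2}+T_{i_1}T_{i_2}\omega_{i_3}+\cdots$, and $\mu^\omega(A)=\mu\{\mathbf{i}:x^\omega(\mathbf{i})\in A\}$. Singular value function: for a non-singular linear contraction $T$ with singular values $1>\alpha_1\ge\cdots\ge\alpha_N>0$ and $0<s\le N$, $\phi^s(T)=\alpha_1\cdots\alpha_{l-1}\alpha_l^{\,s-l+1}$ where $l$ is the integer with $l-1<s\le l$; $\phi^0(T)=1$; and $\phi^s(T)=(\alpha_1\cdots\alpha_N)^{s/N}$ for $s\ge N$. For $s\ge0$ let $$P(s,1)=\lim_{k\to\infty}\frac1k\sum_{|\mathbf{i}|=k}\mu(C_{\mathbf{i}})\log\big(\phi^s(T_{\mathbf{i}})^{-1}\mu(C_{\mathbf{i}})\big).$$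 This limit exists, $P(\cdot,1)$ is continuous and strictly increasing in $s$, and $d_1>0$ is the unique number with $P(d_1,1)=0$. A Borel probability measure $\nu$ on $\mathbb{R}^N$ is exact dimensional (of dimension $s$) if $\lim_{r\to0}\log\nu(B(x,r))/\log r$ exists and equals $s$ for $\nu$-almost all $x$. The information dimension $D^1(\nu)$ is $\lim_{r\to0}\frac{\sum_{C}\nu(C)\log\nu(C)}{\log r}$ when this limit exists (the claim includes its existence), the sum being over the $r$-mesh cubes $[j_1r,(j_1+1)r)\times\cdots\times[j_Nr,(j_N+1)r)$, $j_1,\dots,j_N\in\mathbb{Z}$, with $\nu(C)>0$. *)

theory Defs
  imports "HOL-Probability.Probability"
begin

section \<open>Singular values and the singular value function\<close>

text \<open>The singular values of \<open>f\<close> are the nonnegative square roots of the eigenvalues of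
  \<open>f\<^sup>* f\<close>, listed in decreasing order and repeated according to multiplicity.  As \<open>f\<^sup>* f\<close> is
  self-adjoint, the multiplicity of an eigenvalue is the dimension of its eigenspace.\<close>

definition right_singular_space :: "('a::euclidean_space \<Rightarrow> 'a) \<Rightarrow> real \<Rightarrow> 'a set" where
  "right_singular_space f \<sigma> = {x. adjoint f (f x) = \<sigma>\<^sup>2 *\<^sub>R x}"

definition singular_value_mset :: "('a::euclidean_space \<Rightarrow> 'a) \<Rightarrow> real multiset" where
  "singular_value_mset f =
     (\<Sum>\<sigma> | 0 \<le> \<sigma> \<and> (\<exists>x\<in>right_singular_space f \<sigma>. x \<noteq> 0).
        replicate_mset (dim (right_singular_space f \<sigma>)) \<sigma>)"

text \<open>Indexed from 1, as in \<open>\<alpha>\<^sub>1 \<ge> \<dots> \<ge> \<alpha>\<^sub>N\<close>.\<close>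

definition singular_value :: "('a::euclidean_space \<Rightarrow> 'a) \<Rightarrow> nat \<Rightarrow> real" where
  "singular_value f j = rev (sorted_list_of_multiset (singular_value_mset f)) ! (j - 1)"

text \<open>For \<open>s > 0\<close>, the integer \<open>l\<close> with \<open>l - 1 < s \<le> l\<close> is the ceiling of \<open>s\<close>.  The two nonzero
  branches agree at \<open>s = N\<close>.  Only \<open>s \<ge> 0\<close> is meaningful.\<close>

definition singular_value_fun :: "real \<Rightarrow> ('a::euclidean_space \<Rightarrow> 'a) \<Rightarrow> real" where
  "singular_value_fun s f =
     (if s = 0 then 1
      else if s \<le> real DIM('a) then
        (let l = nat \<lceil>s\<rceil>
         in (\<Prod>j\<in>{1..l - 1}. singular_value f j) * singular_value f l powr (s - real l + 1))
      else (\<Prod>j\<in>{1..DIM('a)}. singular_value f j) powr (s / real DIM('a)))"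

section \<open>Code space\<close>

text \<open>The alphabet is a finite type \<open>'m\<close>; finite words are lists, infinite words are functions
  on \<open>nat\<close>.\<close>

definition cylinder :: "'m list \<Rightarrow> (nat \<Rightarrow> 'm) set" where
  "cylinder w = {u. map u [0..<length w] = w}"

definition bernoulli_measure :: "('m::finite \<Rightarrow> real) \<Rightarrow> (nat \<Rightarrow> 'm) measure" where
  "bernoulli_measure p = (\<Pi>\<^sub>M _\<in>UNIV. point_measure UNIV (\<lambda>i. ennreal (p i)))"

fun word_map :: "('m \<Rightarrow> 'a \<Rightarrow> 'a) \<Rightarrow> 'm list \<Rightarrow> 'a \<Rightarrow> 'a" where
  "word_map T [] = id"
| "word_map T (i # w) = T i \<circ> word_map T w"

section \<open>The function \<open>P(\<cdot>, 1)\<close> and the number \<open>d\<^sub>1\<close>\<close>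

definition pressure_one ::
    "('m::finite \<Rightarrow> 'a::euclidean_space \<Rightarrow> 'a) \<Rightarrow> ('m \<Rightarrow> real) \<Rightarrow> real \<Rightarrow> real" where
  "pressure_one T p s =
     lim (\<lambda>k. 1 / real k *
       (\<Sum>w | length w = k.
          measure (bernoulli_measure p) (cylinder w) *
          ln (inverse (singular_value_fun s (word_map T w)) *
              measure (bernoulli_measure p) (cylinder w))))"

text \<open>\<open>P(\<cdot>, 1)\<close> is a function on \<open>s \<ge> 0\<close>, negative at \<open>s = 0\<close>; so the zero is positive.\<close>

definition d_one ::
    "('m::finite \<Rightarrow> 'a::euclidean_space \<Rightarrow> 'a) \<Rightarrow> ('m \<Rightarrow> real) \<Rightarrow> real" where
  "d_one T p = (THE s. 0 \<le> s \<and> pressure_one T p s = 0)"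

section \<open>Self-affine sets and measures\<close>

definition affine_map ::
    "('m \<Rightarrow> 'a \<Rightarrow> 'a::euclidean_space) \<Rightarrow> ('a ^ 'm::finite) \<Rightarrow> 'm \<Rightarrow> 'a \<Rightarrow> 'a" where
  "affine_map T \<omega> i x = T i x + \<omega> $ i"

definition self_affine_set ::
    "('m \<Rightarrow> 'a \<Rightarrow> 'a::euclidean_space) \<Rightarrow> ('a ^ 'm::finite) \<Rightarrow> 'a set" where
  "self_affine_set T \<omega> =
     (THE E. E \<noteq> {} \<and> compact E \<and> E = (\<Union>i. affine_map T \<omega> i ` E))"

definition code_proj ::
    "('m \<Rightarrow> 'a \<Rightarrow> 'a::euclidean_space) \<Rightarrow> ('a ^ 'm::finite) \<Rightarrow> (nat \<Rightarrow> 'm) \<Rightarrow> 'a" where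
  "code_proj T \<omega> u = (\<Sum>k. word_map T (map u [0..<k]) (\<omega> $ u k))"

definition self_affine_measure ::
    "('m \<Rightarrow> 'a \<Rightarrow> 'a::euclidean_space) \<Rightarrow> ('m \<Rightarrow> real) \<Rightarrow> ('a ^ 'm::finite) \<Rightarrow> 'a measure" where
  "self_affine_measure T p \<omega> = distr (bernoulli_measure p) borel (code_proj T \<omega>)"

section \<open>Dimensions of measures\<close>

text \<open>Since \<open>ln 0 = 0\<close>, the quotient below is 0 when the ball is null; almost every \<open>x\<close> lies in the
  support of \<open>\<nu>\<close>, where this does not happen.\<close>

definition exact_dimensional :: "'a::euclidean_space measure \<Rightarrow> real \<Rightarrow> bool" where
  "exact_dimensional \<nu> s \<longleftrightarrow>
     (AE x in \<nu>. ((\<lambda>r. ln (measure \<nu> (cball x r)) / ln r) \<longlongrightarrow> s) (at_right 0))"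

definition mesh_cubes :: "real \<Rightarrow> (real ^ 'n) set set" where
  "mesh_cubes r =
     range (\<lambda>j :: int ^ 'n.
       {x. \<forall>k. of_int (j $ k) * r \<le> x $ k \<and> x $ k < (of_int (j $ k) + 1) * r})"

text \<open>The sum has finitely many terms when \<open>\<nu>\<close> has bounded support, as self-affine measures do.\<close>

definition has_information_dimension :: "(real ^ 'n) measure \<Rightarrow> real \<Rightarrow> bool" where
  "has_information_dimension \<nu> s \<longleftrightarrow>
     ((\<lambda>r. (\<Sum>\<^sub>\<infinity>C\<in>{C \<in> mesh_cubes r. measure \<nu> C > 0}. measure \<nu> C * ln (measure \<nu> C)) / ln r)
        \<longlongrightarrow> s) (at_right 0)"

section \<open>The notions are well defined\<close>

lemma cylinder_altdef: "cylinder w = {u. \<forall>k<length w. u k = w ! k}"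
  unfolding cylinder_def by (simp add: list_eq_iff_nth_eq[of "map _ _"])

lemma product_prob_space_point_measure:
  fixes p :: "'m::finite \<Rightarrow> real"
  assumes "\<And>i. 0 < p i" "sum p UNIV = 1"
  shows "sequence_space (point_measure UNIV (\<lambda>i. ennreal (p i)))"
proof -
  interpret prob_space "point_measure UNIV (\<lambda>i. ennreal (p i))"
    using assms by (intro prob_space_point_measure) (simp_all add: sum_ennreal less_imp_le)
  show ?thesis
    by unfold_locales
qed

lemma space_bernoulli_measure [simp]: "space (bernoulli_measure p) = UNIV"
  by (simp add: bernoulli_measure_def space_PiM space_point_measure)

lemma prob_space_bernoulli_measure:
  fixes p :: "'m::finite \<Rightarrow> real"
  assumes "\<And>i. 0 < p i" "sum p UNIV = 1"
  shows "prob_space (bernoulli_measure p)"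
proof -
  interpret sequence_space "point_measure UNIV (\<lambda>i. ennreal (p i))"
    using assms by (rule product_prob_space_point_measure)
  show ?thesis
    unfolding bernoulli_measure_def by unfold_locales
qed

lemma sets_cylinder [measurable, simp]: "cylinder w \<in> sets (bernoulli_measure p)"
proof -
  have "cylinder w = {u \<in> space (bernoulli_measure p). \<forall>k\<in>{..<length w}. u k = w ! k}"
    by (auto simp: cylinder_altdef)
  also have "\<dots> \<in> sets (bernoulli_measure p)"
    unfolding bernoulli_measure_def
    by (intro sets.sets_Collect_finite_All' sets.sets_Collect_finite_All sets_Collect_single')
       (auto simp: space_point_measure sets_point_measure)
  finally show ?thesis .
qed

lemma bernoulli_measure_cylinder:
  fixes p :: "'m::finite \<Rightarrow> real"
  assumes "\<And>i. 0 < p i" "sum p UNIV = 1"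
  shows "measure (bernoulli_measure p) (cylinder w) = prod_list (map p w)"
proof -
  let ?M = "point_measure UNIV (\<lambda>i. ennreal (p i))"
  interpret sequence_space ?M
    using assms by (rule product_prob_space_point_measure)
  have eq: "cylinder w = prod_emb UNIV (\<lambda>_. ?M) {..<length w} (\<Pi>\<^sub>E k\<in>{..<length w}. {w ! k})"
    by (rule set_eqI)
       (simp add: cylinder_altdef prod_emb_def space_point_measure PiE_iff Ball_def)
  have "measure (bernoulli_measure p) (cylinder w) = (\<Prod>k<length w. measure ?M {w ! k})"
    unfolding bernoulli_measure_def eq
    by (rule measure_PiM_emb[where X = "\<lambda>k. {w ! k}"]) (simp_all add: sets_point_measure)
  also have "\<dots> = (\<Prod>k<length w. p (w ! k))"
    using assms(1) by (intro prod.cong refl)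
      (simp add: measure_def emeasure_point_measure_finite less_imp_le)
  also have "\<dots> = prod_list (map p w)"
    unfolding prod.list_conv_set_nth atLeast0LessThan length_map
    by (rule prod.cong) simp_all
  finally show ?thesis .
qed

lemma sets_self_affine_measure [simp]: "sets (self_affine_measure T p \<omega>) = sets borel"
  by (simp add: self_affine_measure_def)

locale contracting_maps =
  fixes T :: "'m::finite \<Rightarrow> 'a::euclidean_space \<Rightarrow> 'a" and \<omega> :: "'a ^ 'm"
  assumes lin: "\<And>i. linear (T i)" and onorm_lt: "\<And>i. onorm (T i) < 1/2"
begin

lemma bl: "bounded_linear (T i)"
  using lin linear_conv_bounded_linear by blast

lemma norm_T_le: "norm (T i x) \<le> 1/2 * norm x"
  using onorm[OF bl, of i x] mult_right_mono[OF less_imp_le[OF onorm_lt[of i]], of "norm x"] by simp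

lemma norm_word_map_le: "norm (word_map T w x) \<le> (1/2) ^ length w * norm x"
proof (induction w)
  case (Cons i w)
  have "norm (word_map T (i # w) x) \<le> 1/2 * norm (word_map T w x)"
    using norm_T_le by simp
  with Cons show ?case by simp
qed simp

definition W :: real where "W = (\<Sum>i\<in>UNIV. norm (\<omega> $ i))"

lemma norm_translate_le: "norm (\<omega> $ i) \<le> W"
  unfolding W_def by (rule member_le_sum) auto

lemma norm_term_le: "norm (word_map T (map u [0..<k]) (\<omega> $ u k)) \<le> (1/2) ^ k * W"
  by (rule order_trans[OF norm_word_map_le]) (simp add: norm_translate_le divide_right_mono)

lemma summable_code_proj: "summable (\<lambda>k. word_map T (map u [0..<k]) (\<omega> $ u k))"
  by (rule summable_comparison_test'[OF summable_mult2[OF summable_geometric] norm_term_le]) simp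

lemma norm_code_proj_le: "norm (code_proj T \<omega> u) \<le> 2 * W"
proof -
  have s: "(\<lambda>k. (1/2) ^ k * W) sums (2 * W)"
    using sums_mult2[OF geometric_sums[of "1/2::real"], of W] by simp
  have "norm (code_proj T \<omega> u) \<le> (\<Sum>k. (1/2) ^ k * W)"
    unfolding code_proj_def by (rule norm_suminf_le[OF norm_term_le sums_summable[OF s]])
  with s show ?thesis by (simp add: sums_unique[symmetric])
qed

lemma code_proj_shift:
  "code_proj T \<omega> u = affine_map T \<omega> (u 0) (code_proj T \<omega> (\<lambda>k. u (Suc k)))"
proof -
  have m: "map u [0..<Suc k] = u 0 # map (\<lambda>k. u (Suc k)) [0..<k]" for k
    by (simp add: map_upt_Suc del: upt_Suc)
  have "code_proj T \<omega> u =
      (\<Sum>k. word_map T (map u [0..<Suc k]) (\<omega> $ u (Suc k))) + \<omega> $ u 0"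
    unfolding code_proj_def using suminf_split_head[OF summable_code_proj[of u]] by simp
  also have "(\<Sum>k. word_map T (map u [0..<Suc k]) (\<omega> $ u (Suc k))) =
      T (u 0) (code_proj T \<omega> (\<lambda>k. u (Suc k)))"
    unfolding m code_proj_def
    by (simp add: bounded_linear.suminf[OF bl summable_code_proj])
  finally show ?thesis by (simp add: affine_map_def)
qed

lemma dist_affine_map_le: "dist (affine_map T \<omega> i x) (affine_map T \<omega> i y) \<le> 1/2 * dist x y"
  using norm_T_le[of i "x - y"] by (simp add: affine_map_def dist_norm linear_diff[OF lin])

lemma dist_code_proj_le:
  "v \<in> cylinder (map u [0..<k]) \<Longrightarrow>
    dist (code_proj T \<omega> u) (code_proj T \<omega> v) \<le> (1/2) ^ k * (4 * W)"
proof (induction k arbitrary: u v)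
  case 0
  show ?case
    using norm_triangle_ineq4[of "code_proj T \<omega> u" "code_proj T \<omega> v"]
      norm_code_proj_le[of u] norm_code_proj_le[of v] by (simp add: dist_norm)
next
  case (Suc k)
  have eq: "v l = u l" if "l < Suc k" for l
    using Suc.prems that by (auto simp: cylinder_altdef simp del: upt_Suc)
  have "(\<lambda>l. v (Suc l)) \<in> cylinder (map (\<lambda>l. u (Suc l)) [0..<k])"
    by (auto simp: cylinder_altdef eq)
  note IH = Suc.IH[OF this]
  have "dist (code_proj T \<omega> u) (code_proj T \<omega> v) =
      dist (affine_map T \<omega> (u 0) (code_proj T \<omega> (\<lambda>l. u (Suc l))))
        (affine_map T \<omega> (u 0) (code_proj T \<omega> (\<lambda>l. v (Suc l))))"
    using code_proj_shift[of u] code_proj_shift[of v] eq[of 0] by simp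
  also have "\<dots> \<le> 1/2 * ((1/2) ^ k * (4 * W))"
    by (rule order_trans[OF dist_affine_map_le], rule mult_left_mono[OF IH]) simp
  finally show ?case by simp
qed

lemma code_proj_vimage_open:
  assumes "open U"
  shows "code_proj T \<omega> -` U = \<Union> {cylinder w | w. cylinder w \<subseteq> code_proj T \<omega> -` U}"
proof (intro equalityI subsetI)
  fix u assume "u \<in> code_proj T \<omega> -` U"
  then obtain e where e: "e > 0" "\<And>y. dist (code_proj T \<omega> u) y < e \<Longrightarrow> y \<in> U"
    using assms unfolding open_dist by (metis dist_commute vimageE)
  have "(\<lambda>k. (1/2::real) ^ k * (4 * W)) \<longlonglongrightarrow> 0"
    by (intro tendsto_mult_left_zero LIMSEQ_power_zero) simp
  from order_tendstoD(2)[OF this e(1)] obtain k where k: "(1/2::real) ^ k * (4 * W) < e"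
    by (auto simp: eventually_sequentially)
  have "cylinder (map u [0..<k]) \<subseteq> code_proj T \<omega> -` U"
    using dist_code_proj_le[of _ u k] k by (fastforce intro: e(2))
  moreover have "u \<in> cylinder (map u [0..<k])"
    by (simp add: cylinder_def)
  ultimately show "u \<in> \<Union> {cylinder w | w. cylinder w \<subseteq> code_proj T \<omega> -` U}"
    by blast
qed auto

lemma measurable_code_proj: "code_proj T \<omega> \<in> bernoulli_measure p \<rightarrow>\<^sub>M borel"
proof (rule borel_measurableI)
  fix U :: "'a set" assume "open U"
  have "countable {cylinder w :: (nat \<Rightarrow> 'm) set | w. cylinder w \<subseteq> code_proj T \<omega> -` U}"
    by (rule countable_subset[of _ "range cylinder"]) auto
  then have "\<Union> {cylinder w | w. cylinder w \<subseteq> code_proj T \<omega> -` U} \<in> sets (bernoulli_measure p)"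
    by (intro sets.countable_Union) auto
  then show "code_proj T \<omega> -` U \<inter> space (bernoulli_measure p) \<in> sets (bernoulli_measure p)"
    using code_proj_vimage_open[OF \<open>open U\<close>] by simp
qed

lemma compact_range_code_proj: "compact (range (code_proj T \<omega>))"
proof -
  let ?X = "product_topology (\<lambda>_::nat. discrete_topology (UNIV::'m set)) UNIV"
  have cyl: "openin ?X (cylinder w)" for w
  proof -
    have "cylinder w = PiE UNIV (\<lambda>k. if k < length w then {w ! k} else UNIV)"
      by (auto simp: cylinder_altdef PiE_iff split: if_splits)
    moreover have "finite {k. (if k < length w then {w ! k} else UNIV) \<noteq> (UNIV :: 'm set)}"
      by (rule finite_subset[of _ "{..<length w}"]) auto
    ultimately show ?thesis by (simp add: openin_PiE_gen)
  qed
  have "continuous_map ?X euclidean (code_proj T \<omega>)"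
  proof (unfold continuous_map_def, intro conjI allI impI)
    fix U :: "'a set" assume "openin euclidean U"
    then have "{x \<in> topspace ?X. code_proj T \<omega> x \<in> U} =
        \<Union> {cylinder w | w. cylinder w \<subseteq> code_proj T \<omega> -` U}"
      using code_proj_vimage_open[of U] by (auto simp: vimage_def)
    then show "openin ?X {x \<in> topspace ?X. code_proj T \<omega> x \<in> U}"
      using cyl by (auto intro!: openin_Union)
  qed auto
  moreover have "compactin ?X UNIV"
  proof -
    have "compact_space ?X"
      by (simp add: compact_space_product_topology compact_space_discrete_topology)
    then show ?thesis by (simp add: compact_space_def)
  qed
  ultimately have "compactin euclidean (code_proj T \<omega> ` UNIV)"
    by (rule image_compactin[rotated])
  then show ?thesis by simp
qed

lemma range_code_proj_invariant:
  "range (code_proj T \<omega>) = (\<Union>i. affine_map T \<omega> i ` range (code_proj T \<omega>))"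
proof (intro equalityI subsetI)
  fix x assume "x \<in> (\<Union>i. affine_map T \<omega> i ` range (code_proj T \<omega>))"
  then obtain i u where "x = affine_map T \<omega> i (code_proj T \<omega> u)" by auto
  also have "\<dots> = code_proj T \<omega> (case_nat i u)"
    by (subst (2) code_proj_shift) simp
  finally show "x \<in> range (code_proj T \<omega>)" by simp
next
  fix x assume "x \<in> range (code_proj T \<omega>)"
  then obtain u where "x = code_proj T \<omega> u" by auto
  also have "\<dots> = affine_map T \<omega> (u 0) (code_proj T \<omega> (\<lambda>k. u (Suc k)))"
    by (rule code_proj_shift)
  finally show "x \<in> (\<Union>i. affine_map T \<omega> i ` range (code_proj T \<omega>))"
    by blast
qed

lemma dist_code_proj_word:
  "dist (code_proj T \<omega> u) (word_map (affine_map T \<omega>) (map u [0..<k]) y)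
     \<le> (1/2) ^ k * (2 * W + norm y)"
proof (induction k arbitrary: u)
  case 0
  show ?case
    using norm_triangle_ineq4[of "code_proj T \<omega> u" y] norm_code_proj_le[of u]
    by (simp add: dist_norm)
next
  case (Suc k)
  have m: "map u [0..<Suc k] = u 0 # map (\<lambda>k. u (Suc k)) [0..<k]"
    by (simp add: map_upt_Suc del: upt_Suc)
  show ?case
    unfolding m using Suc[of "\<lambda>k. u (Suc k)"]
      dist_affine_map_le[of "u 0" "code_proj T \<omega> (\<lambda>l. u (Suc l))"
        "word_map (affine_map T \<omega>) (map (\<lambda>k. u (Suc k)) [0..<k]) y"]
    by (subst code_proj_shift) simp
qed

lemma invariant_compact_unique:
  assumes E: "E \<noteq> {}" "compact E" "E = (\<Union>i. affine_map T \<omega> i ` E)"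
  shows "E = range (code_proj T \<omega>)"
proof (intro equalityI subsetI)
  obtain B where B: "B \<ge> 0" "\<And>y. y \<in> E \<Longrightarrow> norm y \<le> B"
    using compact_imp_bounded[OF E(2)] by (meson bounded_pos less_imp_le)
  have lim: "(\<lambda>k. (1/2::real) ^ k * (2 * W + B)) \<longlonglongrightarrow> 0"
    by (intro tendsto_mult_left_zero LIMSEQ_power_zero) simp
  have close: "dist (code_proj T \<omega> u) (word_map (affine_map T \<omega>) (map u [0..<k]) y)
      \<le> (1/2) ^ k * (2 * W + B)" if "y \<in> E" for u k y
    by (rule order_trans[OF dist_code_proj_word], rule mult_left_mono) (use B that in auto)
  {
    fix x assume "x \<in> range (code_proj T \<omega>)"
    then obtain u where x: "x = code_proj T \<omega> u" by auto
    obtain y where y: "y \<in> E" using E(1) by auto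
    have sub: "affine_map T \<omega> i z \<in> E" if "z \<in> E" for i z
      using E(3) that by blast
    have inE: "word_map (affine_map T \<omega>) w y \<in> E" for w
      by (induction w) (auto simp: y sub)
    have "(\<lambda>k. word_map (affine_map T \<omega>) (map u [0..<k]) y) \<longlonglongrightarrow> x"
    proof (rule metric_tendsto_imp_tendsto[OF lim], rule always_eventually, rule allI)
      fix k
      show "dist (word_map (affine_map T \<omega>) (map u [0..<k]) y) x
          \<le> dist ((1/2::real) ^ k * (2 * W + B)) 0"
        using order_trans[OF close[OF y, of u k] abs_ge_self]
        by (simp add: x dist_commute del: power_divide)
    qed
    then show "x \<in> E"
      by (rule closed_sequentially[OF compact_imp_closed[OF E(2)] inE])
  }
  fix x assume x: "x \<in> E"
  have "\<forall>z. \<exists>i y. z \<in> E \<longrightarrow> y \<in> E \<and> z = affine_map T \<omega> i y"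
    using E(3) by blast
  then obtain I Y where IY: "\<And>z. z \<in> E \<Longrightarrow> Y z \<in> E \<and> z = affine_map T \<omega> (I z) (Y z)"
    by metis
  define u where "u k = I ((Y ^^ k) x)" for k
  have YE: "(Y ^^ k) x \<in> E" for k
    by (induction k) (auto simp: x IY)
  have word_snoc: "word_map F (w @ [i]) z = word_map F w (F i z)" for F :: "'m \<Rightarrow> 'a \<Rightarrow> 'a" and w i z
    by (induction w) auto
  have rep: "x = word_map (affine_map T \<omega>) (map u [0..<k]) ((Y ^^ k) x)" for k
  proof (induction k)
    case (Suc k)
    have "(Y ^^ k) x = affine_map T \<omega> (u k) ((Y ^^ Suc k) x)"
      using IY[OF YE[of k]] by (simp add: u_def)
    then have "word_map (affine_map T \<omega>) (map u [0..<Suc k]) ((Y ^^ Suc k) x) =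
        word_map (affine_map T \<omega>) (map u [0..<k]) ((Y ^^ k) x)"
      by (simp only: upt_Suc_append[OF le0] map_append list.map word_snoc)
    with Suc show ?case by (rule trans[OF _ sym])
  qed simp
  have "dist (code_proj T \<omega> u) x \<le> (1/2) ^ k * (2 * W + B)" for k
    using close[OF YE[of k], of u k] unfolding rep[of k, symmetric] .
  then have "dist (code_proj T \<omega> u) x \<le> 0"
    using LIMSEQ_le_const[OF lim] by blast
  then show "x \<in> range (code_proj T \<omega>)" by (auto intro: range_eqI[of _ _ u])
qed

theorem self_affine_set_ex1:
  "\<exists>!E. E \<noteq> {} \<and> compact E \<and> E = (\<Union>i. affine_map T \<omega> i ` E)"
proof (rule ex1I[of _ "range (code_proj T \<omega>)"], intro conjI)
  show "range (code_proj T \<omega>) = (\<Union>i. affine_map T \<omega> i ` range (code_proj T \<omega>))"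
    by (rule range_code_proj_invariant)
  show "E = range (code_proj T \<omega>)" if "E \<noteq> {} \<and> compact E \<and> E = (\<Union>i. affine_map T \<omega> i ` E)" for E
    using that by (elim conjE) (rule invariant_compact_unique)
qed (simp_all add: compact_range_code_proj)

theorem range_code_proj: "range (code_proj T \<omega>) = self_affine_set T \<omega>"
  unfolding self_affine_set_def
  by (rule the1_equality[OF self_affine_set_ex1, symmetric], intro conjI)
     (blast, rule compact_range_code_proj, rule range_code_proj_invariant)

theorem prob_space_self_affine_measure:
  assumes "\<And>i. 0 < p i" "sum p UNIV = 1"
  shows "prob_space (self_affine_measure T p \<omega>)"
  unfolding self_affine_measure_def
  by (rule prob_space.prob_space_distr[OF prob_space_bernoulli_measure[OF assms] measurable_code_proj])

theorem self_affine_measure_invariant: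
  assumes p: "\<And>i. 0 < p i" "sum p UNIV = 1" and A: "A \<in> sets borel"
  shows "measure (self_affine_measure T p \<omega>) A =
    (\<Sum>i\<in>UNIV. p i * measure (self_affine_measure T p \<omega>) (affine_map T \<omega> i -` A))"
proof -
  let ?M = "point_measure UNIV (\<lambda>i. ennreal (p i))"
  interpret sequence_space ?M
    using p by (rule product_prob_space_point_measure)
  have B: "bernoulli_measure p = S" by (simp add: bernoulli_measure_def)
  interpret SA: prob_space "self_affine_measure T p \<omega>"
    using p by (rule prob_space_self_affine_measure)
  note [measurable] = measurable_code_proj[of p, unfolded B] A
  have cont: "continuous_on UNIV (affine_map T \<omega> i)" for i
    unfolding affine_map_def
    by (intro continuous_intros linear_continuous_on bl)
  have Ai: "affine_map T \<omega> i -` A \<in> sets borel" for i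
    using measurable_sets[OF borel_measurable_continuous_onI[OF cont] A] by simp
  let ?V = "code_proj T \<omega> -` A"
  have V [measurable]: "?V \<in> sets S"
    using measurable_sets[OF measurable_code_proj[of p] A] by (simp flip: B)
  have em: "emeasure (self_affine_measure T p \<omega>) D = emeasure S (code_proj T \<omega> -` D)"
    if "D \<in> sets borel" for D
    unfolding self_affine_measure_def using emeasure_distr[OF measurable_code_proj that] by (simp flip: B)
  have "emeasure (self_affine_measure T p \<omega>) A =
      emeasure (distr (?M \<Otimes>\<^sub>M S) S (\<lambda>(s, u). case_nat s u)) ?V"
    using em[OF A] by (simp add: PiM_iter)
  also have "\<dots> = emeasure (?M \<Otimes>\<^sub>M S)
      ((\<lambda>(s, u). case_nat s u) -` ?V \<inter> space (?M \<Otimes>\<^sub>M S))"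
    by (rule emeasure_distr) measurable
  also have "\<dots> = (\<integral>\<^sup>+s. emeasure S
      (Pair s -` ((\<lambda>(s, u). case_nat s u) -` ?V \<inter> space (?M \<Otimes>\<^sub>M S))) \<partial>?M)"
    by (rule P.emeasure_pair_measure_alt) measurable
  also have "\<dots> = (\<integral>\<^sup>+s. emeasure (self_affine_measure T p \<omega>) (affine_map T \<omega> s -` A) \<partial>?M)"
  proof (rule nn_integral_cong)
    fix s
    have "code_proj T \<omega> (case_nat s u) = affine_map T \<omega> s (code_proj T \<omega> u)" for u
      by (subst code_proj_shift) simp
    then have "Pair s -` ((\<lambda>(s, u). case_nat s u) -` ?V \<inter> space (?M \<Otimes>\<^sub>M S)) =
        code_proj T \<omega> -` (affine_map T \<omega> s -` A)"
      by (auto simp: space_pair_measure space_PiM space_point_measure)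
    then show "emeasure S (Pair s -` ((\<lambda>(s, u). case_nat s u) -` ?V \<inter> space (?M \<Otimes>\<^sub>M S))) =
        emeasure (self_affine_measure T p \<omega>) (affine_map T \<omega> s -` A)"
      by (simp add: em[OF Ai])
  qed
  also have "\<dots> = (\<Sum>i\<in>UNIV. ennreal (p i) *
      emeasure (self_affine_measure T p \<omega>) (affine_map T \<omega> i -` A))"
    by (subst nn_integral_point_measure_finite) (auto simp: less_imp_le p)
  finally have "ennreal (measure (self_affine_measure T p \<omega>) A) =
      ennreal (\<Sum>i\<in>UNIV. p i * measure (self_affine_measure T p \<omega>) (affine_map T \<omega> i -` A))"
    unfolding SA.emeasure_eq_measure
    using p(1) by (simp add: ennreal_mult[symmetric] less_imp_le)
  then show ?thesis
    using p(1) by (subst (asm) ennreal_inj) (simp_all add: sum_nonneg less_imp_le)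
qed

end

end

theory Submission
  imports Defs
begin

text \<open>
  Up to constants, the singular value function \<open>\<phi>\<^sup>s(T)\<close> is the minimum over \<open>r\<close> of \<open>r\<^sup>s\<close> times the number
  of \<open>r\<close>-balls needed to cover the image of the unit ball.  As covering numbers are submultiplicative, \<open>ln (\<phi>\<^sup>s(T\<^sub>w) / \<mu>(C\<^sub>w))\<close> is
  subadditive along words up to a constant, with asymptotic mean \<open>- P(s, 1)\<close>; by the subadditive ergodic theorem its growth
  rate along almost every sequence is \<open>- P(s, 1)\<close>, whose sign decides whether \<open>s\<close> lies below or
  above \<open>d\<^sub>1\<close>.

  For \<open>s < d\<^sub>1\<close> the sums of \<open>\<mu>(C\<^sub>w) / \<phi>\<^sup>s(T\<^sub>w)\<close> over the prefixes \<open>w\<close> of almost every sequence converge.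
  The set of \<open>\<omega>\<close> in a bounded region for which two sequences with longest common prefix \<open>w\<close> are projected to distance
  at most \<open>r\<close> has measure at most a constant times \<open>r\<^sup>s / \<phi>\<^sup>s(T\<^sub>w)\<close>, so Fubini's theorem bounds the local dimension from below for almost
  every \<open>\<omega>\<close>.

  For \<open>s > d\<^sub>1\<close>, covering the image of each cylinder by balls of the radius \<open>r\<close> attaining the minimum in
  \<open>\<phi>\<^sup>s\<close>, and discarding balls of too small measure, bounds the local dimension from above; covering the whole support
  in the same way gives the bound by the dimension of the space.

  Finally, for a measure with constant local dimension, the cubes carrying most of the mass have comparable measures up
  to small powers of \<open>r\<close>, which determines the entropy of the mesh.
\<close>

section \<open>Singular bases\<close>

text \<open>The formula for \<open>\<phi>\<^sup>s\<close> as a minimum over radii enters in three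
  ways. As an inequality at an arbitrary radius it turns the transversality estimate into the power
  \<open>r\<^sup>s\<close>. Tested at the product of two critical radii it gives
  submultiplicativity. As an equality at the critical radius it says how many balls the upper bound
  has to pay for. The obstacle in the upper bound is that critical radii depend on the word: every
  point is controlled only along its own sequence of radii. These sequences suffice because
  appending a letter shrinks the critical radius by at most a constant factor. As
  \<open>P(s, 1)\<close> is strictly monotone, every \<open>s\<close> different from
  \<open>d\<^sub>1\<close> leaves a gap between the rate and 0, and one-sided bounds with half of
  that gap suffice. The upper bound on the local dimension holds for every \<omega>; only the lower
  bound discards a null set of \<omega>.\<close>

lemma linear_coeff_zero_of_quadratic_bound:
  fixes d c :: real
  assumes "\<And>t. 2 * t * d \<le> t\<^sup>2 * c"
  shows "d = 0"
proof (rule ccontr)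
  assume "d \<noteq> 0"
  then have d2: "d * d > 0" by (simp add: not_sum_squares_lt_zero flip: power2_eq_square)
  \<comment> \<open>The test value is \<open>t = d / C\<close>: the left side is then
    \<open>2 * d\<^sup>2 / C\<close> and the right side at most \<open>d\<^sup>2 / C\<close>. The
    summand 1 keeps \<open>C\<close> positive.\<close>
  define C where "C = \<bar>c\<bar> + 1"
  have "2 * (d / C) * d \<le> (d / C)\<^sup>2 * c" by (rule assms)
  also have "\<dots> \<le> (d / C)\<^sup>2 * C" by (rule mult_left_mono) (auto simp: C_def)
  finally have "2 * (d * d) / C \<le> d * d / C"
    by (simp add: power2_eq_square C_def)
  moreover have "C > 0" by (simp add: C_def)
  ultimately have "2 * (d * d) \<le> d * d"
    by (simp add: divide_le_cancel)
  with d2 show False by simp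
qed

text \<open>A maximum point \<open>v\<close> of the Rayleigh quotient on the unit sphere of
  \<open>W\<close> is an eigenvector. The first variation at \<open>v\<close> in the direction of
  the defect \<open>u = A v - l v\<close> is twice \<open>u \<bullet> u\<close> and has to vanish.
  Invariance of \<open>W\<close> puts \<open>u\<close>, and hence the variation, inside
  \<open>W\<close>.\<close>

lemma selfadjoint_eigenvector_exists:
  fixes A :: "'a::euclidean_space \<Rightarrow> 'a"
  assumes lin: "linear A" and sa: "\<And>x y. A x \<bullet> y = x \<bullet> A y"
    and W: "subspace W" "\<And>x. x \<in> W \<Longrightarrow> A x \<in> W" "\<exists>x\<in>W. x \<noteq> 0"
  shows "\<exists>v\<in>W. norm v = 1 \<and> (\<exists>c. A v = c *\<^sub>R v)"
proof -
  let ?S = "sphere 0 1 \<inter> W"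
  obtain x where x: "x \<in> W" "x \<noteq> 0" using W(3) by blast
  then have "x /\<^sub>R norm x \<in> ?S" by (simp add: W(1) subspace_scale)
  then have ne: "?S \<noteq> {}" by blast
  have comp: "compact ?S" by (intro compact_Int_closed closed_subspace W) auto
  have cont: "continuous_on ?S (\<lambda>x. A x \<bullet> x)"
    by (intro continuous_intros linear_continuous_on linear_linear[THEN iffD1] lin)
       (use lin linear_conv_bounded_linear in blast)
  obtain v where v: "v \<in> ?S" and max: "\<And>y. y \<in> ?S \<Longrightarrow> A y \<bullet> y \<le> A v \<bullet> v"
    using continuous_attains_sup[OF comp ne cont] by blast
  define l where "l = A v \<bullet> v"
  have le: "A w \<bullet> w \<le> l * (w \<bullet> w)" if "w \<in> W" for w
  proof (cases "w = 0")
    case False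
    have "w /\<^sub>R norm w \<in> ?S" using False that by (simp add: W(1) subspace_scale)
    from max[OF this] have "A (w /\<^sub>R norm w) \<bullet> (w /\<^sub>R norm w) \<le> l" by (simp add: l_def)
    then have "(A w \<bullet> w) / (norm w * norm w) \<le> l"
      by (simp add: linear_scale[OF lin] divide_inverse mult_ac)
    then show ?thesis using False
      by (simp add: divide_le_eq dot_square_norm power2_eq_square)
  qed (simp add: linear_0[OF lin])
  have vv: "v \<bullet> v = 1" "v \<in> W" "norm v = 1" using v by (auto simp: dot_square_norm)
  define u where "u = A v - l *\<^sub>R v"
  have uW: "u \<in> W" unfolding u_def using vv W by (intro subspace_diff subspace_scale) auto
  have "u \<bullet> u = 0"
  proof (rule linear_coeff_zero_of_quadratic_bound)
    fix t :: real
    have "A (v + t *\<^sub>R u) \<bullet> (v + t *\<^sub>R u) \<le> l * ((v + t *\<^sub>R u) \<bullet> (v + t *\<^sub>R u))"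
      by (rule le) (use vv uW W(1) in \<open>auto intro: subspace_add subspace_scale\<close>)
    also have "A (v + t *\<^sub>R u) \<bullet> (v + t *\<^sub>R u)
        = l + t * (A v \<bullet> u) + t * (A u \<bullet> v) + t\<^sup>2 * (A u \<bullet> u)"
      by (simp add: linear_add[OF lin] linear_scale[OF lin] inner_add_left inner_add_right l_def
          power2_eq_square algebra_simps)
    also have "A u \<bullet> v = A v \<bullet> u" using sa[of u v] by (simp add: inner_commute)
    also have "(v + t *\<^sub>R u) \<bullet> (v + t *\<^sub>R u) = 1 + 2 * t * (v \<bullet> u) + t\<^sup>2 * (u \<bullet> u)"
      by (simp add: inner_add_left inner_add_right vv inner_commute[of u v] power2_eq_square
          algebra_simps)
    finally have "l + t * (A v \<bullet> u) + t * (A v \<bullet> u) + t\<^sup>2 * (A u \<bullet> u)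
        \<le> l * (1 + 2 * t * (v \<bullet> u) + t\<^sup>2 * (u \<bullet> u))" .
    moreover have "2 * t * (u \<bullet> u) = 2 * t * (A v \<bullet> u) - 2 * t * l * (v \<bullet> u)"
      by (subst (1) u_def) (simp add: inner_diff_left algebra_simps)
    ultimately show "2 * t * (u \<bullet> u) \<le> t\<^sup>2 * (l * (u \<bullet> u) - A u \<bullet> u)"
      by (simp add: algebra_simps)
  qed
  then have "A v = l *\<^sub>R v" by (simp add: u_def)
  with vv show ?thesis by blast
qed

text \<open>An orthonormal set of eigenvectors of largest cardinality spans: otherwise its
  orthogonal complement is nonzero, is invariant by self-adjointness, and contains a further unit
  eigenvector.\<close>

theorem selfadjoint_orthonormal_eigenbasis:
  fixes A :: "'a::euclidean_space \<Rightarrow> 'a"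
  assumes lin: "linear A" and sa: "\<And>x y. A x \<bullet> y = x \<bullet> A y"
  shows "\<exists>B. finite B \<and> pairwise orthogonal B \<and> (\<forall>b\<in>B. norm b = 1) \<and> span B = UNIV
    \<and> (\<forall>b\<in>B. \<exists>c. A b = c *\<^sub>R b)"
proof -
  define P where "P B \<longleftrightarrow> pairwise orthogonal B \<and> (\<forall>b\<in>B. norm b = 1) \<and> (\<forall>b\<in>B. \<exists>c. A b = c *\<^sub>R b)" for B
  have ind: "independent B" if "P B" for B
    using that unfolding P_def by (intro pairwise_orthogonal_independent) auto
  have card_le: "card B \<le> DIM('a)" and fin: "finite B" if "P B" for B
    using independent_bound[OF ind[OF that]] by auto
  have "P {}" by (simp add: P_def)
  then have "\<exists>B. P B \<and> (\<forall>C. P C \<longrightarrow> card C \<le> card B)"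
    by (rule ex_has_greatest_nat[where b = "Suc DIM('a)"]) (use card_le in fastforce)
  then obtain B where B: "P B" and max: "\<And>C. P C \<Longrightarrow> card C \<le> card B" by blast
  have "span B = UNIV"
  proof (rule ccontr)
    assume "span B \<noteq> UNIV"
    then obtain z where z: "z \<noteq> 0" "\<And>y. y \<in> span B \<Longrightarrow> orthogonal z y"
      using orthogonal_to_subspace_exists_gen[of B UNIV]
      by (metis psubsetI span_UNIV subset_UNIV)
    let ?W = "{x. \<forall>b\<in>B. x \<bullet> b = 0}"
    have "\<exists>v\<in>?W. norm v = 1 \<and> (\<exists>c. A v = c *\<^sub>R v)"
    proof (rule selfadjoint_eigenvector_exists[OF lin sa])
      show "subspace ?W" by (auto simp: subspace_def inner_add_left)
      show "A x \<in> ?W" if "x \<in> ?W" for x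
        using that B unfolding P_def by (fastforce simp: sa)
      show "\<exists>x\<in>?W. x \<noteq> 0" using z unfolding orthogonal_def using span_base by blast
    qed
    then obtain v where v: "v \<in> ?W" "norm v = 1" "\<exists>c. A v = c *\<^sub>R v" by blast
    have vB: "v \<notin> B" using v by auto
    have "P (insert v B)"
      using B v unfolding P_def by (auto simp: pairwise_insert orthogonal_def inner_commute)
    from max[OF this] show False using vB fin[OF B] by simp
  qed
  with B fin[OF B] show ?thesis unfolding P_def by blast
qed

text \<open>These are right singular vectors, an orthonormal eigenbasis of
  \<open>adjoint f \<circ> f\<close>. Writing each eigenvalue as the square of
  \<open>norm (f b)\<close> makes the singular values readable from the basis, with multiplicity and
  without an enumeration.\<close>

definition singular_basis :: "('a::euclidean_space \<Rightarrow> 'a) \<Rightarrow> 'a set \<Rightarrow> bool" where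
  "singular_basis f B \<longleftrightarrow> finite B \<and> pairwise orthogonal B \<and> (\<forall>b\<in>B. norm b = 1) \<and>
     span B = UNIV \<and> (\<forall>b\<in>B. adjoint f (f b) = (norm (f b))\<^sup>2 *\<^sub>R b)"

lemma singular_basis_exists:
  fixes f :: "'a::euclidean_space \<Rightarrow> 'a"
  assumes lin: "linear f"
  shows "\<exists>B. singular_basis f B"
proof -
  have lin2: "linear (\<lambda>x. adjoint f (f x))"
    using linear_compose[OF lin adjoint_linear[OF lin]] by (simp add: o_def)
  obtain B where B: "finite B" "pairwise orthogonal B" "\<forall>b\<in>B. norm b = 1" "span B = UNIV"
    "\<forall>b\<in>B. \<exists>c. adjoint f (f b) = c *\<^sub>R b"
    using selfadjoint_orthonormal_eigenbasis[OF lin2]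
    by (metis adjoint_clauses(1) adjoint_clauses(2) lin)
  have "adjoint f (f b) = (norm (f b))\<^sup>2 *\<^sub>R b" if b: "b \<in> B" for b
  proof -
    obtain c where c: "adjoint f (f b) = c *\<^sub>R b" using B b by blast
    have "(norm (f b))\<^sup>2 = b \<bullet> adjoint f (f b)"
      by (simp add: adjoint_works[OF lin] power2_norm_eq_inner)
    also have "\<dots> = c * (norm b)\<^sup>2" by (simp add: c power2_norm_eq_inner)
    finally show ?thesis using c B(3) b by simp
  qed
  with B show ?thesis unfolding singular_basis_def by blast
qed

context
  fixes f :: "'a::euclidean_space \<Rightarrow> 'a" and B
  assumes lin: "linear f" and B: "singular_basis f B"
begin

lemma singular_basis_props:
  "finite B" "pairwise orthogonal B" "\<And>b. b \<in> B \<Longrightarrow> norm b = 1" "span B = UNIV"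
  "\<And>b. b \<in> B \<Longrightarrow> adjoint f (f b) = (norm (f b))\<^sup>2 *\<^sub>R b"
  using B by (auto simp: singular_basis_def)

lemma singular_basis_inner: "b \<in> B \<Longrightarrow> c \<in> B \<Longrightarrow> b \<bullet> c = (if b = c then 1 else 0)"
  using singular_basis_props(2,3) by (auto simp: pairwise_def orthogonal_def dot_square_norm)

lemma singular_basis_independent: "independent B"
  using singular_basis_props(2,3) by (intro pairwise_orthogonal_independent) force+

lemma card_singular_basis: "card B = DIM('a)"
  by (metis dim_UNIV dim_eq_card_independent dim_span singular_basis_independent singular_basis_props(4))

lemma singular_basis_expand: "(\<Sum>b\<in>B. (x \<bullet> b) *\<^sub>R b) = x"
  by (rule orthonormal_basis_expand) (simp_all add: singular_basis_props)

text \<open>The vectors \<open>f b\<close> are the orthogonal semi-axes of the image ellipsoid, so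
  pairing with one of them isolates one coordinate of \<open>x\<close>. The separation of grid
  points and the transversality estimate both rest on this.\<close>

lemma inner_image_singular_basis:
  "b \<in> B \<Longrightarrow> f x \<bullet> f b = (norm (f b))\<^sup>2 * (x \<bullet> b)"
  using adjoint_works[OF lin, of x "f b"] singular_basis_props(5) by simp

text \<open>Pairing the eigenvalue equation with \<open>b\<close> shows that the coordinate of
  \<open>x\<close> along \<open>b\<close> vanishes unless the squares of \<sigma> and
  \<open>norm (f b)\<close> agree; both being nonnegative, the numbers themselves agree.\<close>

lemma right_singular_space_eq_span:
  assumes "0 \<le> \<sigma>"
  shows "right_singular_space f \<sigma> = span {b\<in>B. norm (f b) = \<sigma>}" (is "_ = span ?E")
proof (intro equalityI subsetI)
  fix x assume x: "x \<in> right_singular_space f \<sigma>"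
  have "x \<bullet> b = 0" if b: "b \<in> B" "norm (f b) \<noteq> \<sigma>" for b
  proof -
    have "\<sigma>\<^sup>2 * (x \<bullet> b) = adjoint f (f x) \<bullet> b" using x by (simp add: right_singular_space_def)
    also have "\<dots> = f x \<bullet> f b" by (simp add: adjoint_clauses[OF lin])
    also have "\<dots> = (norm (f b))\<^sup>2 * (x \<bullet> b)" by (rule inner_image_singular_basis) fact
    finally show ?thesis using b assms by simp
  qed
  then have "x = (\<Sum>b\<in>?E. (x \<bullet> b) *\<^sub>R b)"
    by (subst singular_basis_expand[symmetric], intro sum.mono_neutral_right)
       (auto simp: singular_basis_props)
  then show "x \<in> span ?E"
    by (metis (no_types, lifting) span_base span_scale span_sum)
next
  fix x assume "x \<in> span ?E"
  have "subspace (right_singular_space f \<sigma>)"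
    by (simp add: right_singular_space_def subspace_def scaleR_add_right
        linear_0[OF lin] linear_add[OF lin] linear_scale[OF lin] linear_0[OF adjoint_linear[OF lin]]
        linear_add[OF adjoint_linear[OF lin]] linear_scale[OF adjoint_linear[OF lin]])
  moreover have "?E \<subseteq> right_singular_space f \<sigma>"
    by (auto simp: right_singular_space_def singular_basis_props)
  ultimately show "x \<in> right_singular_space f \<sigma>"
    using \<open>x \<in> span ?E\<close> span_minimal by blast
qed

text \<open>The multiplicity of \<tau> is the dimension of its eigenspace, and that eigenspace is
  spanned by those vectors of the independent set \<open>B\<close> whose image has norm
  \<tau>.\<close>

lemma singular_value_mset_eq: "singular_value_mset f = image_mset (\<lambda>b. norm (f b)) (mset_set B)"
proof (rule multiset_eqI)
  fix \<tau>
  let ?S = "{\<sigma>. 0 \<le> \<sigma> \<and> (\<exists>x\<in>right_singular_space f \<sigma>. x \<noteq> 0)}"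
  let ?E = "\<lambda>\<sigma>. {b\<in>B. norm (f b) = \<sigma>}"
  have S: "?S = (\<lambda>b. norm (f b)) ` B"
  proof (intro equalityI subsetI)
    fix \<sigma> assume "\<sigma> \<in> ?S"
    then obtain x where "0 \<le> \<sigma>" "x \<in> span (?E \<sigma>)" "x \<noteq> 0"
      using right_singular_space_eq_span by auto
    then have "?E \<sigma> \<noteq> {}" by (metis singletonD span_empty)
    then show "\<sigma> \<in> (\<lambda>b. norm (f b)) ` B" by blast
  next
    fix \<sigma> assume "\<sigma> \<in> (\<lambda>b. norm (f b)) ` B"
    then obtain b where "b \<in> B" "\<sigma> = norm (f b)" by blast
    then show "\<sigma> \<in> ?S"
      using singular_basis_props(3)[of b] singular_basis_props(5)[of b]
      by (auto simp: right_singular_space_def intro!: bexI[of _ b])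
  qed
  have dim: "dim (right_singular_space f \<sigma>) = card (?E \<sigma>)" if "0 \<le> \<sigma>" for \<sigma>
    unfolding right_singular_space_eq_span[OF that] dim_span
    by (rule dim_eq_card_independent, rule independent_mono[OF singular_basis_independent]) auto
  have "count (singular_value_mset f) \<tau> = (\<Sum>\<sigma>\<in>?S. if \<tau> = \<sigma> then dim (right_singular_space f \<sigma>) else 0)"
    unfolding singular_value_mset_def count_sum by (intro sum.cong) auto
  also have "\<dots> = (if \<tau> \<in> ?S then card (?E \<tau>) else 0)"
    unfolding S using singular_basis_props(1) by (auto simp: sum.delta dim)
  also have "\<dots> = card (?E \<tau>)"
    unfolding S using singular_basis_props(1) by auto
  also have "\<dots> = count (image_mset (\<lambda>b. norm (f b)) (mset_set B)) \<tau>"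
    unfolding count_image_mset using singular_basis_props(1)
    by (simp add: vimage_def Int_def conj_commute)
  finally show "count (singular_value_mset f) \<tau> = count (image_mset (\<lambda>b. norm (f b)) (mset_set B)) \<tau>" .
qed

text \<open>A product over all indices is symmetric, so it does not see the sorting in
  \<open>singular_value\<close> and may be computed in any singular basis.\<close>

lemma prod_singular_value:
  fixes h :: "real \<Rightarrow> real"
  shows "(\<Prod>j\<in>{1..DIM('a)}. h (singular_value f j)) = (\<Prod>b\<in>B. h (norm (f b)))"
proof -
  let ?xs = "rev (sorted_list_of_multiset (singular_value_mset f))"
  have m: "mset ?xs = image_mset (\<lambda>b. norm (f b)) (mset_set B)"
    by (simp add: singular_value_mset_eq)
  have len: "length ?xs = DIM('a)"
    by (metis m size_mset size_image_mset size_mset_set card_singular_basis)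
  have "(\<Prod>j\<in>{1..DIM('a)}. h (singular_value f j)) = (\<Prod>j<DIM('a). h (?xs ! j))"
    unfolding singular_value_def
    by (rule prod.reindex_bij_witness[of _ Suc "\<lambda>j. j - 1"]) auto
  also have "\<dots> = prod_list (map h ?xs)"
    unfolding prod.list_conv_set_nth len length_map atLeast0LessThan
    by (rule prod.cong[OF refl], subst nth_map) (simp_all only: len lessThan_iff)
  also have "\<dots> = prod_mset (image_mset h (mset ?xs))"
    by (simp add: prod_mset_prod_list[symmetric])
  also have "\<dots> = (\<Prod>b\<in>B. h (norm (f b)))"
    unfolding m by (simp add: prod_unfold_prod_mset image_mset.compositionality o_def)
  finally show ?thesis .
qed

end

lemma singular_value_attained:
  fixes f :: "'a::euclidean_space \<Rightarrow> 'a"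
  assumes lin: "linear f" and j: "1 \<le> j" "j \<le> DIM('a)"
  shows "\<exists>b. norm b = 1 \<and> singular_value f j = norm (f b)"
proof -
  obtain B where B: "singular_basis f B" using singular_basis_exists[OF lin] by blast
  let ?xs = "rev (sorted_list_of_multiset (singular_value_mset f))"
  have m: "mset ?xs = image_mset (\<lambda>b. norm (f b)) (mset_set B)"
    by (simp add: singular_value_mset_eq[OF lin B])
  have "length ?xs = DIM('a)"
    by (metis m size_mset size_image_mset size_mset_set card_singular_basis[OF lin B])
  with j have "?xs ! (j - 1) \<in> set ?xs" by (intro nth_mem) auto
  also have "set ?xs = (\<lambda>b. norm (f b)) ` B"
    unfolding set_mset_mset[symmetric] m using singular_basis_props(1)[OF lin B] by simp
  finally show ?thesis
    unfolding singular_value_def using singular_basis_props(3)[OF lin B] by auto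
qed

lemma singular_value_antimono:
  fixes f :: "'a::euclidean_space \<Rightarrow> 'a"
  assumes lin: "linear f" and j: "1 \<le> i" "i \<le> j" "j \<le> DIM('a)"
  shows "singular_value f j \<le> singular_value f i"
proof -
  obtain B where B: "singular_basis f B" using singular_basis_exists[OF lin] by blast
  let ?ys = "sorted_list_of_multiset (singular_value_mset f)"
  have m: "mset ?ys = image_mset (\<lambda>b. norm (f b)) (mset_set B)"
    by (simp add: singular_value_mset_eq[OF lin B])
  have len: "length ?ys = DIM('a)"
    by (metis m size_mset size_image_mset size_mset_set card_singular_basis[OF lin B])
  show ?thesis
    unfolding singular_value_def using j
    by (simp add: rev_nth len sorted_nth_mono)
qed

section \<open>Covering numbers of ellipsoids\<close>

text \<open>Up to constants depending on the dimension only, \<open>ellipsoid_count f r\<close> is the number of balls of radius \<open>r\<close>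
  needed to cover the image of the unit ball under \<open>f\<close>.  The singular value function is the minimum
  of \<open>r powr s * ellipsoid_count f r\<close> over \<open>r > 0\<close>, attained at the critical radius.\<close>

definition ellipsoid_count :: "('a::euclidean_space \<Rightarrow> 'a) \<Rightarrow> real \<Rightarrow> real" where
  "ellipsoid_count f r = (\<Prod>j\<in>{1..DIM('a)}. max 1 (singular_value f j / r))"

text \<open>This is the \<open>l\<close> with \<open>l - 1 < s \<le> l\<close> for positive
  \<open>s\<close>. At \<open>s = 0\<close> the maximum replaces 0 by 1, the first index of a
  singular value; the exponent \<open>s - l + 1\<close> is then 0, so the formula for
  \<open>\<phi>\<^sup>s\<close> still gives 1.\<close>

definition critical_index :: "real \<Rightarrow> nat" where
  "critical_index s = max 1 (nat \<lceil>s\<rceil>)"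

definition critical_radius :: "real \<Rightarrow> ('a::euclidean_space \<Rightarrow> 'a) \<Rightarrow> real" where
  "critical_radius s f = singular_value f (critical_index s)"

lemma ellipsoid_count_ge_1: "1 \<le> ellipsoid_count f r"
  unfolding ellipsoid_count_def by (rule prod_ge_1) auto

lemma ellipsoid_count_singular_basis:
  "linear f \<Longrightarrow> singular_basis f B \<Longrightarrow> ellipsoid_count f r = (\<Prod>b\<in>B. max 1 (norm (f b) / r))"
  unfolding ellipsoid_count_def by (rule prod_singular_value)

lemma ellipsoid_count_scale_le:
  assumes "linear (f :: 'a::euclidean_space \<Rightarrow> 'a)" "0 < r" "1 \<le> c"
  shows "ellipsoid_count f (r / c) \<le> c ^ DIM('a) * ellipsoid_count f r"
proof -
  have "ellipsoid_count f (r / c) \<le> (\<Prod>j\<in>{1..DIM('a)}. c * max 1 (singular_value f j / r))"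
    unfolding ellipsoid_count_def
  proof (intro prod_mono conjI)
    fix j assume j: "j \<in> {1..DIM('a)}"
    have "1 \<le> c * max 1 (singular_value f j / r)"
      using assms mult_mono[of 1 c 1 "max 1 (singular_value f j / r)"] by simp
    moreover have "singular_value f j / (r / c) \<le> c * max 1 (singular_value f j / r)"
      using assms mult_left_mono[of "singular_value f j / r" "max 1 (singular_value f j / r)" c]
      by (simp add: mult.commute)
    ultimately show "max 1 (singular_value f j / (r / c)) \<le> c * max 1 (singular_value f j / r)"
      by simp
  qed simp
  also have "\<dots> = c ^ DIM('a) * ellipsoid_count f r"
    by (simp add: ellipsoid_count_def prod.distrib)
  finally show ?thesis .
qed

lemma grid_approximation:
  fixes x :: real and n :: nat
  assumes "\<bar>x\<bar> \<le> 1" "0 < n"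
  shows "\<exists>k\<in>{- int n..int n}. \<bar>x - of_int k / n\<bar> \<le> 1 / n"
proof -
  \<comment> \<open>Rounding towards 0 cannot leave the range from \<open>- n\<close> to
    \<open>n\<close>.\<close>
  define k where "k = (if 0 \<le> x then \<lfloor>x * n\<rfloor> else \<lceil>x * n\<rceil>)"
  have k: "\<bar>x * n - of_int k\<bar> \<le> 1"
    unfolding k_def by (auto; linarith)
  have "x * real n \<le> real n" "- real n \<le> x * real n"
    using assms mult_right_mono[of x 1 "real n"] mult_right_mono[of "-1" x "real n"] by auto
  then have "\<lfloor>x * real n\<rfloor> \<le> int n" "- int n \<le> \<lfloor>x * real n\<rfloor>" "\<lceil>x * real n\<rceil> \<le> int n"
    "- int n \<le> \<lceil>x * real n\<rceil>"
    by linarith+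
  then have "k \<in> {- int n..int n}" unfolding k_def by simp
  moreover have "x - of_int k / n = (x * n - of_int k) / n" using assms by (simp add: field_simps)
  with k assms have "\<bar>x - of_int k / n\<bar> \<le> 1 / n"
    by (simp add: abs_divide divide_right_mono)
  ultimately show ?thesis by blast
qed

text \<open>The centres are the images of a grid in the coordinates along a singular basis, with a
  mesh adapted to each axis: an axis shorter than the radius needs boundedly many points, a longer
  one about \<open>norm (f b) / r\<close>.\<close>

lemma ellipsoid_cover_exists:
  fixes f :: "'a::euclidean_space \<Rightarrow> 'a"
  assumes lin: "linear f" and inj: "inj f" and r: "0 < r"
  shows "\<exists>X. finite X \<and> real (card X) \<le> real (2 * DIM('a) + 3) ^ DIM('a) * ellipsoid_count f r \<and>
    f ` cball 0 1 \<subseteq> (\<Union>x\<in>X. cball x r)"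
proof -
  obtain B where B: "singular_basis f B" using singular_basis_exists[OF lin] by blast
  note props = singular_basis_props[OF lin B] and exp = singular_basis_expand[OF lin B]
  let ?N = "DIM('a)"
  have pos: "0 < norm (f b)" if "b \<in> B" for b
    using props(3)[OF that] inj lin linear_injective_0 by fastforce
  \<comment> \<open>With step \<open>1 / n b\<close> the error along each axis is at most
    \<open>r / N\<close>, and the \<open>N\<close> axes add up to \<open>r\<close>.\<close>
  define n where "n b = nat \<lceil>?N * norm (f b) / r\<rceil>" for b
  have npos: "0 < n b" if "b \<in> B" for b
    using pos[OF that] r by (simp add: n_def)
  have n_ge: "?N * norm (f b) / r \<le> n b" for b unfolding n_def by linarith
  have n_le: "n b \<le> ?N * norm (f b) / r + 1" for b
    unfolding n_def using r by (simp; linarith)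
  define pt where "pt k = (\<Sum>b\<in>B. (of_int (k b) / n b) *\<^sub>R f b)" for k :: "'a \<Rightarrow> int"
  define K where "K = PiE B (\<lambda>b. {- int (n b)..int (n b)})"
  have finK: "finite K" unfolding K_def using props(1) by (intro finite_PiE) auto
  show ?thesis
  proof (intro exI conjI)
    show "finite (pt ` K)" using finK by simp
    have "card (pt ` K) \<le> card K" by (rule card_image_le[OF finK])
    also have "\<dots> = (\<Prod>b\<in>B. 2 * n b + 1)"
      unfolding K_def by (subst card_PiE[OF props(1)]) (auto intro!: prod.cong)
    finally have "real (card (pt ` K)) \<le> real (\<Prod>b\<in>B. 2 * n b + 1)"
      by (rule of_nat_mono)
    also have "\<dots> = (\<Prod>b\<in>B. 2 * real (n b) + 1)" by (simp add: algebra_simps)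
    \<comment> \<open>Rounding up gives \<open>n b \<le> N t + 1\<close> for
      \<open>t = norm (f b) / r\<close>, so \<open>2 * n b + 1 \<le> 2 N t + 3\<close>; replacing
      \<open>t\<close> and 1 by their maximum yields the factor \<open>2 N + 3\<close>.\<close>
    also have "\<dots> \<le> (\<Prod>b\<in>B. real (2 * ?N + 3) * max 1 (norm (f b) / r))"
    proof (intro prod_mono conjI)
      fix b
      let ?t = "norm (f b) / r"
      have "real (n b) \<le> ?N * ?t + 1" using n_le[of b] by simp
      also have "\<dots> \<le> ?N * max 1 ?t + max 1 ?t"
        by (intro add_mono mult_left_mono) auto
      finally have "2 * real (n b) + 1 \<le> 2 * (?N * max 1 ?t + max 1 ?t) + max 1 ?t" by simp
      also have "\<dots> = real (2 * ?N + 3) * max 1 ?t" by (simp add: algebra_simps)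
      finally show "2 * real (n b) + 1 \<le> real (2 * ?N + 3) * max 1 ?t" .
    qed simp
    also have "\<dots> = real (2 * ?N + 3) ^ ?N * ellipsoid_count f r"
      by (simp add: prod.distrib card_singular_basis[OF lin B]
          ellipsoid_count_singular_basis[OF lin B] del: of_nat_add of_nat_mult)
    finally show "real (card (pt ` K)) \<le> real (2 * ?N + 3) ^ ?N * ellipsoid_count f r" .
    show "f ` cball 0 1 \<subseteq> (\<Union>x\<in>pt ` K. cball x r)"
    proof
      fix y assume "y \<in> f ` cball 0 1"
      then obtain x where x: "y = f x" "norm x \<le> 1" by auto
      have "\<exists>k\<in>{- int (n b)..int (n b)}. \<bar>x \<bullet> b - of_int k / n b\<bar> \<le> 1 / n b" if "b \<in> B" for b
      proof (rule grid_approximation)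
        have "\<bar>x \<bullet> b\<bar> \<le> norm x * norm b" by (rule Cauchy_Schwarz_ineq2)
        then show "\<bar>x \<bullet> b\<bar> \<le> 1" using x props(3)[OF that] by simp
      qed (rule npos[OF that])
      then obtain k0 where k0: "\<And>b. b \<in> B \<Longrightarrow> k0 b \<in> {- int (n b)..int (n b)}"
        "\<And>b. b \<in> B \<Longrightarrow> \<bar>x \<bullet> b - of_int (k0 b) / n b\<bar> \<le> 1 / n b"
        by metis
      define k where "k = restrict k0 B"
      have kK: "k \<in> K" unfolding K_def k_def using k0(1) by auto
      have "f x = (\<Sum>b\<in>B. (x \<bullet> b) *\<^sub>R f b)"
        by (subst (1) exp[symmetric]) (simp add: linear_sum[OF lin] linear_scale[OF lin])
      then have "f x - pt k = (\<Sum>b\<in>B. (x \<bullet> b - of_int (k0 b) / n b) *\<^sub>R f b)"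
        by (simp add: pt_def k_def sum_subtractf scaleR_diff_left)
      also have "norm \<dots> \<le> (\<Sum>b\<in>B. \<bar>x \<bullet> b - of_int (k0 b) / n b\<bar> * norm (f b))"
        by (rule order_trans[OF norm_sum]) simp
      also have "\<dots> \<le> (\<Sum>b\<in>B. r / ?N)"
      proof (rule sum_mono)
        fix b assume b: "b \<in> B"
        have "\<bar>x \<bullet> b - of_int (k0 b) / n b\<bar> * norm (f b) \<le> 1 / n b * norm (f b)"
          by (rule mult_right_mono[OF k0(2)[OF b]]) simp
        also have "\<dots> \<le> r / ?N"
          using n_ge[of b] npos[OF b] r by (simp add: field_simps)
        finally show "\<bar>x \<bullet> b - of_int (k0 b) / n b\<bar> * norm (f b) \<le> r / ?N" .
      qed
      also have "\<dots> = r" by (simp add: card_singular_basis[OF lin B])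
      finally have "y \<in> cball (pt k) r" by (simp add: x dist_norm norm_minus_commute)
      with kK show "y \<in> (\<Union>x\<in>pt ` K. cball x r)" by blast
    qed
  qed
qed

text \<open>A grid inside the ellipsoid with spacing \<open>3 r\<close> along each axis meets every ball of radius
  \<open>r\<close> at most once.\<close>

lemma ellipsoid_count_le_card_cover:
  fixes f :: "'a::euclidean_space \<Rightarrow> 'a"
  assumes lin: "linear f" and inj: "inj f" and r: "0 < r"
    and X: "finite X" "f ` cball 0 1 \<subseteq> (\<Union>x\<in>X. cball x r)"
  shows "ellipsoid_count f r \<le> real (3 * DIM('a)) ^ DIM('a) * real (card X)"
proof -
  obtain B where B: "singular_basis f B" using singular_basis_exists[OF lin] by blast
  note props = singular_basis_props[OF lin B]
  let ?N = "DIM('a)"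
  have N: "0 < ?N" by simp
  have pos: "0 < norm (f b)" if "b \<in> B" for b
    using props(3)[OF that] inj lin linear_injective_0 by fastforce
  \<comment> \<open>The spacing \<open>3 r\<close> determines the number of points on an axis. The
    further factor \<open>N\<close> limits each coordinate of a grid point to \<open>1 / N\<close>,
    so that the point stays in the unit ball.\<close>
  define n where "n b = nat \<lfloor>norm (f b) / (3 * ?N * r)\<rfloor>" for b
  have n_le: "real (n b) \<le> norm (f b) / (3 * ?N * r)" for b
    unfolding n_def using r by simp
  have n_ge: "norm (f b) / (3 * ?N * r) \<le> real (n b) + 1" for b
    unfolding n_def by linarith
  define src where "src k = (\<Sum>b\<in>B. (real (k b) * (3 * r / norm (f b))) *\<^sub>R b)" for k :: "'a \<Rightarrow> nat"
  define K where "K = PiE B (\<lambda>b. {0..n b})"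
  have src_ball: "src k \<in> cball 0 1" if "k \<in> K" for k
  proof -
    have "norm (src k) \<le> (\<Sum>b\<in>B. 1 / ?N)"
      unfolding src_def
    proof (rule sum_norm_le)
      fix b assume b: "b \<in> B"
      have "k b \<le> n b" using that b unfolding K_def by (auto simp: PiE_iff)
      then have "real (k b) \<le> norm (f b) / (3 * ?N * r)" using n_le[of b] by linarith
      then have "real (k b) * (3 * r / norm (f b)) \<le> norm (f b) / (3 * ?N * r) * (3 * r / norm (f b))"
        using r by (intro mult_right_mono) auto
      also have "\<dots> = 1 / ?N" using r pos[OF b] by (simp add: field_simps)
      finally show "norm ((real (k b) * (3 * r / norm (f b))) *\<^sub>R b) \<le> 1 / ?N"
        using props(3)[OF b] r by simp
    qed
    also have "\<dots> = 1" by (simp add: card_singular_basis[OF lin B])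
    finally show ?thesis by simp
  qed
  have f_src: "f (src k) \<bullet> f b = real (k b) * (3 * r) * norm (f b)" if "b \<in> B" for k b
  proof -
    have "src k \<bullet> b = (\<Sum>c\<in>B. if c = b then real (k c) * (3 * r / norm (f c)) else 0)"
      unfolding src_def inner_sum_left
      using that by (intro sum.cong) (auto simp: singular_basis_inner[OF lin B])
    also have "\<dots> = real (k b) * (3 * r / norm (f b))"
      using that props(1) by (simp add: sum.delta')
    finally show ?thesis
      using inner_image_singular_basis[OF lin B that, of "src k"] pos[OF that]
      by (simp add: power2_eq_square)
  qed
  have "\<exists>x\<in>X. f (src k) \<in> cball x r" if "k \<in> K" for k
    using X(2) src_ball[OF that] by blast
  then obtain c where c: "\<And>k. k \<in> K \<Longrightarrow> c k \<in> X" "\<And>k. k \<in> K \<Longrightarrow> f (src k) \<in> cball (c k) r"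
    by metis
  \<comment> \<open>If two grid points share a ball, their images are within \<open>2 r\<close>. If
    they differ in the coordinate \<open>b\<close>, pairing with the axis \<open>f b\<close> shows
    that the images are at least \<open>3 r\<close> apart.\<close>
  have "inj_on c K"
  proof (rule inj_onI, rule ccontr)
    fix k l assume kl: "k \<in> K" "l \<in> K" "c k = c l" "k \<noteq> l"
    then obtain b where b: "b \<in> B" "k b \<noteq> l b" unfolding K_def by (meson PiE_ext)
    have "dist (f (src k)) (f (src l)) \<le> dist (f (src k)) (c k) + dist (f (src l)) (c k)"
      by (rule dist_triangle2)
    also have "\<dots> \<le> r + r" using c(2)[OF kl(1)] c(2)[OF kl(2)] kl(3) by (simp add: dist_commute)
    finally have d: "norm (f (src k) - f (src l)) \<le> 2 * r" by (simp add: dist_norm)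
    have "3 * r * norm (f b) \<le> \<bar>real (k b) - real (l b)\<bar> * (3 * r) * norm (f b)"
      using b r by (intro mult_right_mono) (auto simp: abs_real_def)
    also have "\<dots> = \<bar>(f (src k) - f (src l)) \<bullet> f b\<bar>"
      using r by (simp add: inner_diff_left f_src[OF b(1)] abs_mult flip: left_diff_distrib)
    also have "\<dots> \<le> norm (f (src k) - f (src l)) * norm (f b)" by (rule Cauchy_Schwarz_ineq2)
    also have "\<dots> \<le> 2 * r * norm (f b)" by (rule mult_right_mono[OF d]) simp
    finally show False using pos[OF b(1)] r by simp
  qed
  then have "card K \<le> card X" using c(1) X(1) by (intro card_inj_on_le[of c]) auto
  moreover have "card K = (\<Prod>b\<in>B. n b + 1)"
    unfolding K_def by (subst card_PiE[OF props(1)]) (auto intro!: prod.cong)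
  ultimately have card: "(\<Prod>b\<in>B. real (n b) + 1) \<le> real (card X)"
    by (metis (mono_tags, lifting) of_nat_1 of_nat_add of_nat_mono of_nat_prod prod.cong)
  have "ellipsoid_count f r = (\<Prod>b\<in>B. max 1 (norm (f b) / r))"
    by (rule ellipsoid_count_singular_basis[OF lin B])
  also have "\<dots> \<le> (\<Prod>b\<in>B. real (3 * ?N) * (real (n b) + 1))"
  proof (intro prod_mono conjI)
    fix b
    have "norm (f b) / r = real (3 * ?N) * (norm (f b) / (3 * ?N * r))" using N by (simp del: N)
    also have "\<dots> \<le> real (3 * ?N) * (real (n b) + 1)" by (rule mult_left_mono[OF n_ge]) simp
    finally have "norm (f b) / r \<le> real (3 * ?N) * (real (n b) + 1)" .
    moreover have "1 \<le> real (3 * ?N) * (real (n b) + 1)"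
      using N mult_mono[of 1 "real (3 * ?N)" 1 "real (n b) + 1"] DIM_ge_Suc0[where 'a='a] by simp
    ultimately show "max 1 (norm (f b) / r) \<le> real (3 * ?N) * (real (n b) + 1)" by simp
  qed simp
  also have "\<dots> = real (3 * ?N) ^ ?N * (\<Prod>b\<in>B. real (n b) + 1)"
    by (simp add: prod.distrib card_singular_basis[OF lin B])
  also have "\<dots> \<le> real (3 * ?N) ^ ?N * real (card X)"
    by (rule mult_left_mono[OF card]) simp
  finally show ?thesis .
qed

lemma ellipsoid_cover_ball:
  fixes f :: "'a::euclidean_space \<Rightarrow> 'a"
  assumes lin: "linear f" and t: "0 < t" and X: "f ` cball 0 1 \<subseteq> (\<Union>x\<in>X. cball x r)"
  shows "f ` cball y t \<subseteq> (\<Union>x\<in>X. cball (f y + t *\<^sub>R x) (t * r))"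
proof
  fix z assume "z \<in> f ` cball y t"
  then obtain v where v: "z = f v" "dist y v \<le> t" by auto
  let ?w = "(v - y) /\<^sub>R t"
  have "?w \<in> cball 0 1" using v t by (simp add: dist_norm norm_minus_commute divide_inverse_commute[symmetric])
  with X obtain x where x: "x \<in> X" "dist x (f ?w) \<le> r" by fastforce
  have "z = f y + t *\<^sub>R f ?w" using t by (simp add: v linear_scale[OF lin] linear_diff[OF lin])
  then have "dist (f y + t *\<^sub>R x) z = t * dist x (f ?w)"
    using t by (simp add: dist_norm flip: scaleR_diff_right)
  also have "\<dots> \<le> t * r" using x t by (intro mult_left_mono) auto
  finally show "z \<in> (\<Union>x\<in>X. cball (f y + t *\<^sub>R x) (t * r))" using x(1) by auto
qed

text \<open>The first factor turns the cardinality of a cover into a bound on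
  \<open>ellipsoid_count\<close>; the other two are the costs of optimal covers, one for each of the
  two maps composed.\<close>

definition cover_const :: "nat \<Rightarrow> real" where
  "cover_const N = real (3 * N) ^ N * (real (2 * N + 3) ^ N * real (2 * N + 3) ^ N)"

text \<open>Submultiplicativity of covering numbers replaces the usual argument with exterior powers.\<close>

lemma ellipsoid_count_comp_le:
  fixes f g :: "'a::euclidean_space \<Rightarrow> 'a"
  assumes f: "linear f" "inj f" and g: "linear g" "inj g" and r: "0 < r" and t: "0 < t"
  shows "ellipsoid_count (f \<circ> g) (t * r)
    \<le> cover_const DIM('a) * (ellipsoid_count f r * ellipsoid_count g t)"
proof -
  let ?N = "DIM('a)"
  let ?c = "real (2 * ?N + 3) ^ ?N"
  obtain X where X: "finite X" "real (card X) \<le> ?c * ellipsoid_count f r"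
    "f ` cball 0 1 \<subseteq> (\<Union>x\<in>X. cball x r)"
    using ellipsoid_cover_exists[OF f r] by blast
  obtain Y where Y: "finite Y" "real (card Y) \<le> ?c * ellipsoid_count g t"
    "g ` cball 0 1 \<subseteq> (\<Union>x\<in>Y. cball x t)"
    using ellipsoid_cover_exists[OF g t] by blast
  \<comment> \<open>Every ball of radius \<open>t\<close> in the cover for \<open>g\<close> is
    mapped by \<open>f\<close> to a translate of the \<open>t\<close>-fold image of the unit ball,
    so it is covered by \<open>t\<close>-scaled copies of the balls for \<open>f\<close>.\<close>
  define Z where "Z = (\<lambda>(x, y). f y + t *\<^sub>R x) ` (X \<times> Y)"
  have cover: "(f \<circ> g) ` cball 0 1 \<subseteq> (\<Union>z\<in>Z. cball z (t * r))"
  proof -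
    have "(f \<circ> g) ` cball 0 1 \<subseteq> (\<Union>y\<in>Y. f ` cball y t)"
      using Y(3) by (fastforce simp: image_subset_iff)
    also have "\<dots> \<subseteq> (\<Union>y\<in>Y. \<Union>x\<in>X. cball (f y + t *\<^sub>R x) (t * r))"
      using ellipsoid_cover_ball[OF f(1) t X(3)] by blast
    also have "\<dots> \<subseteq> (\<Union>z\<in>Z. cball z (t * r))" unfolding Z_def by auto
    finally show ?thesis .
  qed
  have "card Z \<le> card (X \<times> Y)" unfolding Z_def using X(1) Y(1) by (intro card_image_le) simp
  then have "real (card Z) \<le> real (card X) * real (card Y)"
    by (metis card_cartesian_product of_nat_mono of_nat_mult)
  also have "\<dots> \<le> (?c * ellipsoid_count f r) * (?c * ellipsoid_count g t)"
    using X(2) Y(2) by (intro mult_mono) (auto intro: order_trans[OF _ X(2)])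
  finally have card: "real (card Z) \<le> (?c * ellipsoid_count f r) * (?c * ellipsoid_count g t)" .
  have "ellipsoid_count (f \<circ> g) (t * r) \<le> real (3 * ?N) ^ ?N * real (card Z)"
    using X(1) Y(1) r t
    by (intro ellipsoid_count_le_card_cover cover linear_compose f g inj_compose) (auto simp: Z_def)
  also have "\<dots> \<le> real (3 * ?N) ^ ?N * ((?c * ellipsoid_count f r) * (?c * ellipsoid_count g t))"
    by (rule mult_left_mono[OF card]) simp
  finally show ?thesis by (simp add: cover_const_def mult_ac)
qed

section \<open>The singular value function\<close>

lemma prod_ratio_le_prod_max:
  fixes \<alpha> :: "nat \<Rightarrow> real"
  assumes "k \<le> N" "\<And>j. 1 \<le> j \<Longrightarrow> j \<le> N \<Longrightarrow> 0 < \<alpha> j" "0 < r"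
  shows "(\<Prod>j\<in>{1..k}. \<alpha> j) / r ^ k \<le> (\<Prod>j\<in>{1..N}. max 1 (\<alpha> j / r))"
proof -
  have "(\<Prod>j\<in>{1..k}. \<alpha> j) / r ^ k = (\<Prod>j\<in>{1..k}. \<alpha> j / r)"
    by (simp add: prod_dividef)
  also have "\<dots> \<le> (\<Prod>j\<in>{1..k}. max 1 (\<alpha> j / r))"
    using assms by (intro prod_mono) (auto intro!: divide_nonneg_pos less_imp_le)
  also have "\<dots> \<le> (\<Prod>j\<in>{1..N}. max 1 (\<alpha> j / r))"
    using assms by (intro prod_mono2) auto
  finally show ?thesis .
qed

lemma critical_index_bounds:
  assumes "0 \<le> s" "s \<le> real DIM('a::euclidean_space)"
  shows "1 \<le> critical_index s" "critical_index s \<le> DIM('a)"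
    "real (critical_index s) - 1 \<le> s" "s \<le> real (critical_index s)"
proof -
  have "\<lceil>s\<rceil> \<le> int DIM('a)" using assms by (simp add: ceiling_le_iff)
  then show "critical_index s \<le> DIM('a)"
    using DIM_ge_Suc0[where 'a='a] by (simp add: critical_index_def nat_le_iff del: ceiling_le_iff)
  show "1 \<le> critical_index s" by (simp add: critical_index_def)
  show "real (critical_index s) - 1 \<le> s" "s \<le> real (critical_index s)"
    using assms by (auto simp: critical_index_def max_def) linarith+
qed

context
  fixes f :: "'a::euclidean_space \<Rightarrow> 'a"
  assumes lin: "linear f" and inj: "inj f"
begin

lemma singular_value_pos:
  assumes "1 \<le> j" "j \<le> DIM('a)"
  shows "0 < singular_value f j"
proof -
  obtain b where b: "norm b = 1" "singular_value f j = norm (f b)"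
    using singular_value_attained[OF lin assms] by blast
  then have "b \<noteq> 0" by auto
  then have "f b \<noteq> 0" using inj lin linear_injective_0 by blast
  with b show ?thesis by simp
qed

lemma critical_radius_pos:
  assumes "0 \<le> s" "s \<le> real DIM('a)"
  shows "0 < critical_radius s f"
  unfolding critical_radius_def using critical_index_bounds[OF assms] by (intro singular_value_pos) auto

lemma singular_value_fun_eq:
  assumes "0 \<le> s" "s \<le> real DIM('a)"
  shows "singular_value_fun s f = (\<Prod>j\<in>{1..critical_index s - 1}. singular_value f j) *
    critical_radius s f powr (s - real (critical_index s) + 1)"
proof (cases "s = 0")
  case True
  then show ?thesis using critical_radius_pos[OF assms]
    by (simp add: singular_value_fun_def critical_index_def)
next
  case False
  then have "critical_index s = nat \<lceil>s\<rceil>" using assms by (simp add: critical_index_def max_def) linarith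
  with False assms show ?thesis
    by (simp add: singular_value_fun_def critical_radius_def Let_def)
qed

lemma singular_value_fun_pos:
  assumes "0 \<le> s"
  shows "0 < singular_value_fun s f"
proof (cases "s \<le> real DIM('a)")
  case True
  then show ?thesis
    unfolding singular_value_fun_eq[OF assms True]
    using critical_index_bounds[OF assms True] critical_radius_pos[OF assms True]
    by (intro mult_pos_pos prod_pos) (auto intro!: singular_value_pos)
next
  case False
  have "0 < (\<Prod>j\<in>{1..DIM('a)}. singular_value f j)"
    by (intro prod_pos) (auto intro: singular_value_pos)
  then have "0 < (\<Prod>j\<in>{1..DIM('a)}. singular_value f j) powr (s / real DIM('a))"
    by (metis order_less_irrefl powr_gt_zero)
  with False show ?thesis
    using assms by (simp add: singular_value_fun_def del: prod_zero_iff prod_pos_nat_iff)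
qed

text \<open>Only the leading factors of \<open>ellipsoid_count f r\<close> are kept:
  \<open>l\<close> of them if \<open>r\<close> is at most the critical radius \<rho>, and
  \<open>l - 1\<close> otherwise. The power of \<rho> left over has exponent
  \<open>s - l \<le> 0\<close> in the first case and \<open>s - l + 1 \<ge> 0\<close> in the second,
  so replacing \<rho> by \<open>r\<close> increases it in both.\<close>

lemma singular_value_fun_le:
  assumes s: "0 \<le> s" "s \<le> real DIM('a)" and r: "0 < r"
  shows "singular_value_fun s f \<le> r powr s * ellipsoid_count f r"
proof -
  define l where "l = critical_index s"
  define \<rho> where "\<rho> = critical_radius s f"
  define Q where "Q = (\<Prod>j\<in>{1..l - 1}. singular_value f j)"
  note b = critical_index_bounds[OF s, folded l_def]
  have rho: "0 < \<rho>" unfolding \<rho>_def by (rule critical_radius_pos[OF s])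
  have Q: "0 < Q" unfolding Q_def using b by (intro prod_pos) (auto intro!: singular_value_pos)
  have ec: "(\<Prod>j\<in>{1..k}. singular_value f j) / r ^ k \<le> ellipsoid_count f r" if "k \<le> DIM('a)" for k
    unfolding ellipsoid_count_def
    by (rule prod_ratio_le_prod_max) (auto intro: that r singular_value_pos)
  have svf: "singular_value_fun s f = Q * \<rho> powr (s - real l + 1)"
    unfolding singular_value_fun_eq[OF s] Q_def l_def \<rho>_def ..
  show ?thesis
  proof (cases "r \<le> \<rho>")
    case True
    have "{1..l} = insert l {1..l - 1}" using b(1) by auto
    then have Ql: "(\<Prod>j\<in>{1..l}. singular_value f j) = Q * \<rho>"
      using b(1) by (simp add: Q_def \<rho>_def critical_radius_def l_def mult.commute)
    have "\<rho> powr (s - real l + 1) = \<rho> powr (s - real l) * \<rho>"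
      using rho by (simp add: powr_add)
    also have "\<dots> \<le> r powr (s - real l) * \<rho>"
      using True r rho b by (intro mult_right_mono powr_mono2') auto
    finally have "singular_value_fun s f \<le> Q * (r powr (s - real l) * \<rho>)"
      unfolding svf using Q by (intro mult_left_mono) auto
    also have "\<dots> = r powr s * ((Q * \<rho>) / r ^ l)"
      using r by (simp add: powr_diff powr_realpow)
    also have "\<dots> \<le> r powr s * ellipsoid_count f r"
      by (rule mult_left_mono[OF ec[OF b(2), unfolded Ql]]) simp
    finally show ?thesis .
  next
    case False
    have "singular_value_fun s f \<le> Q * r powr (s - real (l - 1))"
      unfolding svf using Q False rho b by (intro mult_left_mono) (auto intro!: powr_mono2 simp: of_nat_diff algebra_simps)
    also have "\<dots> = r powr s * (Q / r ^ (l - 1))"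
      using r by (simp add: powr_diff powr_realpow)
    also have "\<dots> \<le> r powr s * ellipsoid_count f r"
      using ec[of "l - 1"] b by (intro mult_left_mono) (auto simp: Q_def)
    finally show ?thesis .
  qed
qed

text \<open>At the radius \<open>\<alpha>\<^sub>l\<close> the maxima with 1 are decided by the
  ordering: the first \<open>l - 1\<close> factors are the ratios, all others are 1.\<close>

lemma singular_value_fun_eq_critical:
  assumes s: "0 \<le> s" "s \<le> real DIM('a)"
  shows "singular_value_fun s f = critical_radius s f powr s * ellipsoid_count f (critical_radius s f)"
proof -
  define l where "l = critical_index s"
  define \<rho> where "\<rho> = critical_radius s f"
  note b = critical_index_bounds[OF s, folded l_def]
  have rho: "0 < \<rho>" unfolding \<rho>_def by (rule critical_radius_pos[OF s])
  have "ellipsoid_count f \<rho> = (\<Prod>j\<in>{1..l - 1}. max 1 (singular_value f j / \<rho>))"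
    unfolding ellipsoid_count_def
  proof (rule prod.mono_neutral_right)
    show "\<forall>i\<in>{1..DIM('a)} - {1..l - 1}. max 1 (singular_value f i / \<rho>) = 1"
    proof
      fix i assume "i \<in> {1..DIM('a)} - {1..l - 1}"
      then have "singular_value f i \<le> \<rho>"
        unfolding \<rho>_def critical_radius_def using b
        by (intro singular_value_antimono[OF lin]) (auto simp: l_def)
      then show "max 1 (singular_value f i / \<rho>) = 1" using rho by (simp add: divide_le_eq max_def)
    qed
  qed (use b in auto)
  also have "\<dots> = (\<Prod>j\<in>{1..l - 1}. singular_value f j / \<rho>)"
  proof (rule prod.cong[OF refl])
    fix i assume i: "i \<in> {1..l - 1}"
    then have "\<rho> \<le> singular_value f i"
      unfolding \<rho>_def critical_radius_def using b
      by (intro singular_value_antimono[OF lin]) (auto simp: l_def)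
    then show "max 1 (singular_value f i / \<rho>) = singular_value f i / \<rho>"
      using rho by (simp add: le_divide_eq max_def)
  qed
  also have "\<dots> = (\<Prod>j\<in>{1..l - 1}. singular_value f j) / \<rho> ^ (l - 1)"
    by (simp add: prod_dividef)
  finally have "\<rho> powr s * ellipsoid_count f \<rho>
      = (\<Prod>j\<in>{1..l - 1}. singular_value f j) * \<rho> powr (s - real (l - 1))"
    using rho by (simp add: powr_diff powr_realpow)
  also have "s - real (l - 1) = s - real l + 1" using b(1) by (simp add: of_nat_diff)
  finally show ?thesis
    unfolding singular_value_fun_eq[OF s] by (simp add: \<rho>_def l_def)
qed

lemma singular_value_fun_int:
  assumes "k \<le> DIM('a)"
  shows "singular_value_fun (real k) f = (\<Prod>j\<in>{1..k}. singular_value f j)"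
proof (cases k)
  case (Suc i)
  have "0 < singular_value f (Suc i)" using assms Suc by (intro singular_value_pos) auto
  then show ?thesis using assms Suc
    by (simp add: singular_value_fun_def prod.nat_ivl_Suc' mult.commute Let_def del: of_nat_Suc)
qed (simp add: singular_value_fun_def)

text \<open>A single singular value is not submultiplicative up to constants, but a quotient of two
  values of the singular value function inherits estimates from both.
  \<open>critical_radius_snoc\<close> uses it in this form.\<close>

lemma critical_radius_eq_quotient:
  assumes "0 \<le> s" "s \<le> real DIM('a)"
  shows "critical_radius s f * singular_value_fun (real (critical_index s - 1)) f =
    singular_value_fun (real (critical_index s)) f"
proof -
  note b = critical_index_bounds[OF assms]
  have "{1..critical_index s} = insert (critical_index s) {1..critical_index s - 1}" using b by auto
  then show ?thesis
    using b by (subst (1 2) singular_value_fun_int) (auto simp: critical_radius_def)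
qed

lemma singular_value_fun_large:
  assumes "real DIM('a) \<le> s"
  shows "singular_value_fun s f = singular_value_fun (real DIM('a)) f powr (s / DIM('a))"
proof -
  have p: "0 < (\<Prod>j\<in>{1..DIM('a)}. singular_value f j)"
    by (intro prod_pos) (auto intro: singular_value_pos)
  show ?thesis
  proof (cases "s = DIM('a)")
    case True
    with p show ?thesis using singular_value_fun_int[of "DIM('a)"] by simp
  next
    case False
    with assms show ?thesis using singular_value_fun_int[of "DIM('a)"]
      by (simp add: singular_value_fun_def)
  qed
qed

section \<open>Dependence of the singular value function on the exponent\<close>

context
  fixes a b :: real
  assumes a: "0 < a"
    and bounds: "\<And>j. 1 \<le> j \<Longrightarrow> j \<le> DIM('a) \<Longrightarrow> a \<le> singular_value f j"
      "\<And>j. 1 \<le> j \<Longrightarrow> j \<le> DIM('a) \<Longrightarrow> singular_value f j \<le> b"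
begin

text \<open>In each inequality the minimum for one exponent is tested at the radius that is critical
  for the other. The two expressions differ by that radius to the power \<open>t - s\<close>, and
  the radius, being a singular value, lies between \<open>a\<close> and \<open>b\<close>.\<close>

lemma singular_value_fun_mono_small:
  assumes "0 \<le> s" "s \<le> t" "t \<le> real DIM('a)"
  shows "singular_value_fun t f \<le> b powr (t - s) * singular_value_fun s f"
    "a powr (t - s) * singular_value_fun s f \<le> singular_value_fun t f"
proof -
  have s: "0 \<le> s" "s \<le> real DIM('a)" and t: "0 \<le> t" "t \<le> real DIM('a)" using assms by auto
  define \<rho> where "\<rho> = critical_radius s f"
  define \<tau> where "\<tau> = critical_radius t f"
  have rho: "0 < \<rho>" "\<rho> \<le> b"
    unfolding \<rho>_def critical_radius_def using critical_index_bounds[OF s]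
    by (auto intro: bounds singular_value_pos)
  have tau: "0 < \<tau>" "a \<le> \<tau>"
    unfolding \<tau>_def critical_radius_def using critical_index_bounds[OF t]
    by (auto intro: bounds singular_value_pos)
  have "singular_value_fun t f \<le> \<rho> powr t * ellipsoid_count f \<rho>"
    by (rule singular_value_fun_le[OF t rho(1)])
  also have "\<dots> = \<rho> powr (t - s) * singular_value_fun s f"
    unfolding singular_value_fun_eq_critical[OF s] \<rho>_def[symmetric]
    using rho by (simp flip: powr_add)
  also have "\<dots> \<le> b powr (t - s) * singular_value_fun s f"
    using rho assms singular_value_fun_pos[OF s(1)] by (intro mult_right_mono powr_mono2) auto
  finally show "singular_value_fun t f \<le> b powr (t - s) * singular_value_fun s f" .
  have "a powr (t - s) * singular_value_fun s f \<le> \<tau> powr (t - s) * singular_value_fun s f"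
    using tau a assms singular_value_fun_pos[OF s(1)] by (intro mult_right_mono powr_mono2) auto
  also have "\<dots> \<le> \<tau> powr (t - s) * (\<tau> powr s * ellipsoid_count f \<tau>)"
    by (intro mult_left_mono singular_value_fun_le[OF s tau(1)]) auto
  also have "\<dots> = singular_value_fun t f"
    unfolding singular_value_fun_eq_critical[OF t] \<tau>_def[symmetric]
    using tau by (simp flip: powr_add)
  finally show "a powr (t - s) * singular_value_fun s f \<le> singular_value_fun t f" .
qed

lemma singular_value_fun_mono_large:
  assumes "real DIM('a) \<le> s" "s \<le> t"
  shows "singular_value_fun t f \<le> b powr (t - s) * singular_value_fun s f"
    "a powr (t - s) * singular_value_fun s f \<le> singular_value_fun t f"
proof -
  let ?N = "real DIM('a)"
  \<comment> \<open>\<open>D\<close> is the absolute value of the determinant of \<open>f\<close>;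
    beyond the dimension the exponent acts on this number alone.\<close>
  define D where "D = singular_value_fun ?N f"
  have D: "0 < D" unfolding D_def by (rule singular_value_fun_pos) simp
  have b: "0 < b" using a bounds[of 1] DIM_ge_Suc0[where 'a='a] by simp
  have "singular_value_fun 0 f = 1" by (simp add: singular_value_fun_def)
  then have D2: "D \<le> b powr ?N" "a powr ?N \<le> D"
    using singular_value_fun_mono_small[of 0 ?N] by (auto simp: D_def)
  have eq: "singular_value_fun t f = D powr ((t - s) / ?N) * singular_value_fun s f"
    using assms by (simp add: singular_value_fun_large D_def[symmetric] flip: powr_add add_divide_distrib)
  have p: "0 < singular_value_fun s f" using assms by (intro singular_value_fun_pos) simp
  have "D powr ((t - s) / ?N) \<le> (b powr ?N) powr ((t - s) / ?N)"
    using D D2 assms by (intro powr_mono2) auto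
  then have "D powr ((t - s) / ?N) \<le> b powr (t - s)" using b by (simp add: powr_powr)
  then show "singular_value_fun t f \<le> b powr (t - s) * singular_value_fun s f"
    unfolding eq using p by (intro mult_right_mono) auto
  have "(a powr ?N) powr ((t - s) / ?N) \<le> D powr ((t - s) / ?N)"
    using D D2 assms by (intro powr_mono2) auto
  then have "a powr (t - s) \<le> D powr ((t - s) / ?N)" using a by (simp add: powr_powr)
  then show "a powr (t - s) * singular_value_fun s f \<le> singular_value_fun t f"
    unfolding eq using p by (intro mult_right_mono) auto
qed

lemma singular_value_fun_mono:
  assumes st: "0 \<le> s" "s \<le> t"
  shows "singular_value_fun t f \<le> b powr (t - s) * singular_value_fun s f"
    "a powr (t - s) * singular_value_fun s f \<le> singular_value_fun t f"
proof -
  let ?N = "real DIM('a)"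
  consider "t \<le> ?N" | "?N \<le> s" | "s < ?N" "?N < t" by linarith
  then have "singular_value_fun t f \<le> b powr (t - s) * singular_value_fun s f \<and>
    a powr (t - s) * singular_value_fun s f \<le> singular_value_fun t f"
  proof cases
    case 3
    have "singular_value_fun t f \<le> b powr (t - ?N) * singular_value_fun ?N f"
      using 3 by (intro singular_value_fun_mono_large) auto
    also have "\<dots> \<le> b powr (t - ?N) * (b powr (?N - s) * singular_value_fun s f)"
      using 3 st by (intro mult_left_mono singular_value_fun_mono_small) auto
    finally have 1: "singular_value_fun t f \<le> b powr (t - s) * singular_value_fun s f"
      by (simp flip: powr_add mult.assoc)
    have "a powr (t - ?N) * (a powr (?N - s) * singular_value_fun s f) \<le> a powr (t - ?N) * singular_value_fun ?N f"
      using 3 st by (intro mult_left_mono singular_value_fun_mono_small) auto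
    also have "\<dots> \<le> singular_value_fun t f"
      using 3 by (intro singular_value_fun_mono_large) auto
    finally have 2: "a powr (t - s) * singular_value_fun s f \<le> singular_value_fun t f"
      by (simp flip: powr_add mult.assoc)
    from 1 2 show ?thesis ..
  qed (use st in \<open>simp_all add: singular_value_fun_mono_small singular_value_fun_mono_large\<close>)
  then show "singular_value_fun t f \<le> b powr (t - s) * singular_value_fun s f"
    "a powr (t - s) * singular_value_fun s f \<le> singular_value_fun t f" by auto
qed

end

end

text \<open>The composition is tested at the product of the two critical radii: powers of radii
  multiply exactly, and covering numbers multiply up to the constant.\<close>

lemma singular_value_fun_comp_le_small:
  fixes f g :: "'a::euclidean_space \<Rightarrow> 'a"
  assumes f: "linear f" "inj f" and g: "linear g" "inj g" and s: "0 \<le> s" "s \<le> real DIM('a)"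
  shows "singular_value_fun s (f \<circ> g)
    \<le> cover_const DIM('a) * (singular_value_fun s f * singular_value_fun s g)"
proof -
  define \<rho> where "\<rho> = critical_radius s f"
  define \<tau> where "\<tau> = critical_radius s g"
  have pos: "0 < \<rho>" "0 < \<tau>" unfolding \<rho>_def \<tau>_def using f g s by (auto intro: critical_radius_pos)
  have "singular_value_fun s (f \<circ> g) \<le> (\<tau> * \<rho>) powr s * ellipsoid_count (f \<circ> g) (\<tau> * \<rho>)"
    using pos s f g by (intro singular_value_fun_le linear_compose inj_compose) auto
  also have "\<dots> \<le> (\<tau> * \<rho>) powr s * (cover_const DIM('a) * (ellipsoid_count f \<rho> * ellipsoid_count g \<tau>))"
    by (intro mult_left_mono ellipsoid_count_comp_le f g pos) auto
  also have "\<dots> = cover_const DIM('a) * (singular_value_fun s f * singular_value_fun s g)"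
    unfolding singular_value_fun_eq_critical[OF f s] singular_value_fun_eq_critical[OF g s]
    using pos by (simp add: \<rho>_def[symmetric] \<tau>_def[symmetric] powr_mult mult_ac)
  finally show ?thesis .
qed

lemma cover_const_pos: "0 < n \<Longrightarrow> 0 < cover_const n"
  by (simp add: cover_const_def)

lemma singular_value_fun_comp_le:
  assumes s: "0 \<le> s"
  obtains C :: real where "0 < C" "\<And>f g :: 'a::euclidean_space \<Rightarrow> 'a. linear f \<Longrightarrow> inj f \<Longrightarrow> linear g \<Longrightarrow> inj g \<Longrightarrow>
    singular_value_fun s (f \<circ> g) \<le> C * (singular_value_fun s f * singular_value_fun s g)"
proof (cases "s \<le> real DIM('a)")
  case True
  show ?thesis
    by (rule that[of "cover_const DIM('a)"])
       (auto intro: singular_value_fun_comp_le_small True s cover_const_pos)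
next
  case False
  let ?N = "real DIM('a)"
  let ?c = "cover_const DIM('a)"
  show ?thesis
  proof (rule that[of "?c powr (s / ?N)"])
    show "0 < ?c powr (s / ?N)" using cover_const_pos[of "DIM('a)"] by simp
    fix f g :: "'a \<Rightarrow> 'a" assume f: "linear f" "inj f" and g: "linear g" "inj g"
    have fg: "linear (f \<circ> g)" "inj (f \<circ> g)" using f g by (auto intro: linear_compose inj_compose)
    have p: "0 \<le> singular_value_fun ?N h" if "linear h" "inj h" for h :: "'a \<Rightarrow> 'a"
      using singular_value_fun_pos[OF that, of ?N] by simp
    have "singular_value_fun s (f \<circ> g) = singular_value_fun ?N (f \<circ> g) powr (s / ?N)"
      using False by (intro singular_value_fun_large fg) simp
    also have "\<dots> \<le> (?c * (singular_value_fun ?N f * singular_value_fun ?N g)) powr (s / ?N)"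
      using p[OF fg] s by (intro powr_mono2 singular_value_fun_comp_le_small f g) auto
    also have "\<dots> = ?c powr (s / ?N) * (singular_value_fun s f * singular_value_fun s g)"
    proof -
      have "singular_value_fun s h = singular_value_fun ?N h powr (s / ?N)"
        if "linear h" "inj h" for h :: "'a \<Rightarrow> 'a"
        using False by (intro singular_value_fun_large that) simp
      then show ?thesis
        using p[OF f] p[OF g] cover_const_pos[of "DIM('a)"] f g by (simp only: powr_mult)
    qed
    finally show "singular_value_fun s (f \<circ> g)
      \<le> ?c powr (s / ?N) * (singular_value_fun s f * singular_value_fun s g)" .
  qed
qed

section \<open>Subadditive processes over the Bernoulli shift\<close>

abbreviation (input) shift :: "nat \<Rightarrow> (nat \<Rightarrow> 'm) \<Rightarrow> nat \<Rightarrow> 'm" where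
  "shift n u \<equiv> (\<lambda>k. u (n + k))"

lemma eventually_le_real_mult:
  fixes x e :: real
  assumes "0 < e"
  shows "\<forall>\<^sub>F k in sequentially. x \<le> real k * e"
proof (rule eventually_sequentiallyI)
  fix k assume "nat \<lceil>x / e\<rceil> \<le> k"
  then have "x / e \<le> real k" by linarith
  with assms show "x \<le> real k * e" by (simp add: divide_le_eq)
qed

lemma cylinder_Nil [simp]: "cylinder [] = UNIV"
  by (simp add: cylinder_def)

text \<open>Two cylinders are nested or disjoint. Together with the empty set they therefore form an
  intersection-stable generator, on which finite measures can be compared.\<close>

lemma cylinder_Int:
  "cylinder v \<inter> cylinder w \<in> insert {} (range cylinder)"
proof -
  have *: "cylinder v \<inter> cylinder w \<in> insert {} (range cylinder)" if "length v \<le> length w" for v w :: "'a list"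
  proof (cases "\<forall>k<length v. v ! k = w ! k")
    case True
    then have "cylinder v \<inter> cylinder w = cylinder w"
      using that by (auto simp: cylinder_altdef)
    then show ?thesis by blast
  next
    case False
    then have "cylinder v \<inter> cylinder w = {}"
      using that by (auto simp: cylinder_altdef)
    then show ?thesis by blast
  qed
  show ?thesis using *[of v w] *[of w v] by (metis Int_commute nle_le)
qed

lemma finite_words [simp]: "finite {w :: 'm::finite list. length w = k}"
  using finite_lists_length_eq[of "UNIV :: 'm set" k] by simp

lemma sets_bernoulli_measure_eq_sigma:
  "sets (bernoulli_measure p) = sigma_sets UNIV (insert {} (range (cylinder :: 'm::finite list \<Rightarrow> _)))"
proof (intro equalityI)
  let ?G = "insert {} (range (cylinder :: 'm list \<Rightarrow> _))"
  let ?M = "point_measure UNIV (\<lambda>i. ennreal (p i))"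
  have "sets (Pi\<^sub>M UNIV (\<lambda>_::nat. ?M)) =
    sigma_sets (UNIV \<rightarrow>\<^sub>E UNIV) {{f \<in> UNIV \<rightarrow>\<^sub>E UNIV. f i \<in> A} |i A. i \<in> UNIV \<and> A \<in> sets ?M}"
    by (subst sets_PiM_single) (simp add: space_point_measure)
  also have "\<dots> = sigma_sets UNIV {{f. f i \<in> A} |i A. True}"
    by (simp add: sets_point_measure)
  finally have eq: "sets (bernoulli_measure p) = sigma_sets UNIV {{f. f i \<in> A} |i A. True}"
    by (simp add: bernoulli_measure_def)
  show "sets (bernoulli_measure p) \<subseteq> sigma_sets UNIV ?G"
    unfolding eq
  proof (rule sigma_sets_mono, safe)
    fix i :: nat and A :: "'m set"
    have "{f. f i \<in> A} = (\<Union>w\<in>{w. length w = Suc i \<and> w ! i \<in> A}. cylinder w)"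
    proof (intro equalityI subsetI)
      fix f assume f: "f \<in> {f. f i \<in> A}"
      show "f \<in> (\<Union>w\<in>{w. length w = Suc i \<and> w ! i \<in> A}. cylinder w)"
        by (rule UN_I[of "map f [0..<Suc i]"]) (use f in \<open>auto simp: cylinder_def nth_append\<close>)
    qed (auto simp: cylinder_altdef)
    moreover have "countable {w :: 'm list. length w = Suc i \<and> w ! i \<in> A}"
      by (rule countable_subset[OF _ countable_finite[OF finite_words[of "Suc i"]]]) auto
    ultimately show "{f. f i \<in> A} \<in> sigma_sets UNIV ?G"
      by (auto intro!: sigma_sets_UNION)
  qed
  have "?G \<subseteq> sets (bernoulli_measure p)" by auto
  from sets.sigma_sets_subset[OF this] show "sigma_sets UNIV ?G \<subseteq> sets (bernoulli_measure p)"
    unfolding space_bernoulli_measure .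
qed

section \<open>The Bernoulli shift, its 0-1 law and two ergodic bounds\<close>

locale bernoulli =
  fixes p :: "'m::finite \<Rightarrow> real"
  assumes p_pos: "\<And>i. 0 < p i" and p_sum: "sum p UNIV = 1"
begin

abbreviation "\<mu> \<equiv> bernoulli_measure p"

sublocale prob_space \<mu>
  by (rule prob_space_bernoulli_measure[OF p_pos p_sum])

lemma sequence_space: "sequence_space (point_measure UNIV (\<lambda>i. ennreal (p i)))"
  by (rule product_prob_space_point_measure[OF p_pos p_sum])

definition weight :: "'m list \<Rightarrow> real" where
  "weight w = prod_list (map p w)"

lemma measure_cylinder: "measure \<mu> (cylinder w) = weight w"
  unfolding weight_def by (rule bernoulli_measure_cylinder[OF p_pos p_sum])

lemma weight_simps [simp]: "weight [] = 1" "weight (i # w) = p i * weight w" "weight (v @ w) = weight v * weight w"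
  by (simp_all add: weight_def)

lemma weight_pos: "0 < weight w"
  by (induction w) (auto simp: p_pos)

lemma measurable_shift [measurable]: "shift n \<in> measurable \<mu> \<mu>"
  unfolding bernoulli_measure_def
  by (rule measurable_PiM_single', rule measurable_component_singleton)
     (auto simp: space_PiM space_point_measure)

lemma word_fun_eq_sum:
  fixes F :: "'m list \<Rightarrow> real"
  shows "(\<lambda>u. F (map u [0..<k])) = (\<lambda>u. \<Sum>w | length w = k. indicator (cylinder w) u * F w)"
proof
  fix u :: "nat \<Rightarrow> 'm"
  have "(\<Sum>w | length w = k. indicator (cylinder w) u * F w)
      = (\<Sum>w | length w = k. if w = map u [0..<k] then F w else 0)"
    by (intro sum.cong) (auto simp: cylinder_def indicator_def)
  then show "F (map u [0..<k]) = (\<Sum>w | length w = k. indicator (cylinder w) u * F w)"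
    by (simp add: sum.delta')
qed

lemma measurable_word_fun [measurable]:
  "(\<lambda>u. F (map u [0..<k]) :: real) \<in> borel_measurable \<mu>"
  unfolding word_fun_eq_sum
  by (intro borel_measurable_sum borel_measurable_times borel_measurable_indicator
      borel_measurable_const sets_cylinder)

lemma expectation_word_fun:
  fixes F :: "'m list \<Rightarrow> real"
  shows "expectation (\<lambda>u. F (map u [0..<k])) = (\<Sum>w | length w = k. weight w * F w)"
proof -
  have "expectation (\<lambda>u. \<Sum>w | length w = k. indicator (cylinder w) u * F w)
      = (\<Sum>w | length w = k. expectation (\<lambda>u. indicator (cylinder w) u * F w))"
    by (intro Bochner_Integration.integral_sum) (auto simp: emeasure_eq_measure)
  then show ?thesis by (subst word_fun_eq_sum) (simp add: measure_cylinder)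
qed

text \<open>Splicing the first \<open>k\<close> letters of one sample onto an independent second
  sample reproduces the measure. Independence of prefix and remainder, and invariance under the
  shift, are both read off from this.\<close>

lemma emeasure_comb_seq:
  assumes [measurable]: "X \<in> sets \<mu>"
  shows "emeasure \<mu> X = emeasure (\<mu> \<Otimes>\<^sub>M \<mu>) {(u, v). comb_seq k u v \<in> X}"
proof -
  interpret S: sequence_space "point_measure UNIV (\<lambda>i. ennreal (p i))" by (rule sequence_space)
  have "emeasure \<mu> X = emeasure (distr (\<mu> \<Otimes>\<^sub>M \<mu>) \<mu> (\<lambda>(u, v). comb_seq k u v)) X"
    unfolding bernoulli_measure_def S.PiM_comb_seq ..
  also have "\<dots> = emeasure (\<mu> \<Otimes>\<^sub>M \<mu>) ((\<lambda>(u, v). comb_seq k u v) -` X \<inter> space (\<mu> \<Otimes>\<^sub>M \<mu>))"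
    using measurable_comb_seq[of k "point_measure UNIV (\<lambda>i. ennreal (p i))"] assms
    by (intro emeasure_distr) (auto simp: bernoulli_measure_def)
  finally show ?thesis by (simp add: space_pair_measure vimage_def case_prod_unfold)
qed

lemma prob_cylinder_Int_shift:
  assumes A: "A \<in> sets \<mu>"
  shows "prob {u \<in> cylinder w. shift (length w) u \<in> A} = weight w * prob A"
proof -
  interpret P: pair_prob_space \<mu> \<mu> by unfold_locales
  have X: "{u \<in> cylinder w. shift (length w) u \<in> A} \<in> sets \<mu>"
  proof -
    have "{u \<in> cylinder w. shift (length w) u \<in> A} = cylinder w \<inter> (shift (length w) -` A \<inter> space \<mu>)"
      by auto
    also have "\<dots> \<in> sets \<mu>"
      by (intro sets.Int sets_cylinder measurable_sets[OF measurable_shift A])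
    finally show ?thesis .
  qed
  have "emeasure \<mu> {u \<in> cylinder w. shift (length w) u \<in> A}
      = emeasure (\<mu> \<Otimes>\<^sub>M \<mu>) (cylinder w \<times> A)"
    unfolding emeasure_comb_seq[OF X, of "length w"]
    by (rule arg_cong2[of _ _ _ _ emeasure])
       (auto simp: cylinder_altdef comb_seq_less, (simp_all add: comb_seq_def))
  also have "\<dots> = emeasure \<mu> (cylinder w) * emeasure \<mu> A"
    by (rule emeasure_pair_measure_Times) (auto simp: A)
  finally have "ennreal (prob {u \<in> cylinder w. shift (length w) u \<in> A}) = ennreal (weight w * prob A)"
    by (simp add: emeasure_eq_measure measure_cylinder ennreal_mult' less_imp_le[OF weight_pos])
  then show ?thesis
    by (subst (asm) ennreal_inj) (auto intro: mult_nonneg_nonneg less_imp_le[OF weight_pos])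
qed

lemma distr_shift: "distr \<mu> \<mu> (shift n) = \<mu>"
proof (rule measure_eqI)
  fix X assume X: "X \<in> sets (distr \<mu> \<mu> (shift n))"
  interpret P: pair_prob_space \<mu> \<mu> by unfold_locales
  have X': "shift n -` X \<in> sets \<mu>"
    using measurable_sets[OF measurable_shift, of X n] X by simp
  have "emeasure (distr \<mu> \<mu> (shift n)) X = emeasure \<mu> (shift n -` X)"
    using X by (subst emeasure_distr) auto
  also have "\<dots> = emeasure (\<mu> \<Otimes>\<^sub>M \<mu>) (UNIV \<times> X)"
    unfolding emeasure_comb_seq[OF X', of n]
    by (rule arg_cong2[of _ _ _ _ emeasure]) (auto simp: comb_seq_def)
  also have "\<dots> = emeasure \<mu> UNIV * emeasure \<mu> X"
    using X sets.top[of \<mu>] by (intro emeasure_pair_measure_Times) auto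
  finally show "emeasure (distr \<mu> \<mu> (shift n)) X = emeasure \<mu> X"
    using emeasure_space_1 by simp
qed simp

lemma expectation_shift:
  fixes h :: "_ \<Rightarrow> real"
  assumes [measurable]: "h \<in> borel_measurable \<mu>"
  shows "expectation (\<lambda>u. h (shift n u)) = expectation h"
  by (subst (2) distr_shift[of n, symmetric], subst integral_distr) auto

text \<open>Invariance lets \<open>A\<close> be replaced by its preimage under a shift past any
  given cylinder, so \<open>A\<close> is independent of all cylinders. Hence it is independent of
  every measurable set, including itself, and its probability equals its own square.\<close>

lemma shift_invariant_0_1:
  assumes A: "A \<in> sets \<mu>" and inv: "\<And>u. shift 1 u \<in> A \<longleftrightarrow> u \<in> A"
  shows "prob A = 0 \<or> prob A = 1"
proof -
  have invn: "shift n u \<in> A \<longleftrightarrow> u \<in> A" for n u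
  proof (induction n arbitrary: u)
    case (Suc n)
    show ?case using inv[of u] Suc[of "shift 1 u"] by simp
  qed simp
  have cyl: "prob (cylinder w \<inter> A) = weight w * prob A" for w
  proof -
    have "cylinder w \<inter> A = {u \<in> cylinder w. shift (length w) u \<in> A}" using invn by auto
    then show ?thesis using prob_cylinder_Int_shift[OF A] by simp
  qed
  define M1 where "M1 = density \<mu> (indicator A)"
  define M2 where "M2 = scale_measure (emeasure \<mu> A) \<mu>"
  have "M1 = M2"
  proof (rule measure_eqI_generator_eq[where E = "insert {} (range cylinder)" and \<Omega> = UNIV
        and A = "\<lambda>_. UNIV"])
    show "Int_stable (insert {} (range (cylinder :: 'm list \<Rightarrow> _)))"
      using cylinder_Int by (auto simp: Int_stable_def)
    show "emeasure M1 X = emeasure M2 X" if "X \<in> insert {} (range cylinder)" for X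
    proof (cases "X = {}")
      case False
      with that obtain w where w: "X = cylinder w" by blast
      have "emeasure M1 X = emeasure \<mu> (cylinder w \<inter> A)"
        unfolding M1_def w using A by (subst emeasure_density) (auto simp: Int_commute indicator_inter_arith[symmetric])
      also have "\<dots> = emeasure \<mu> A * emeasure \<mu> (cylinder w)"
        by (simp add: emeasure_eq_measure cyl measure_cylinder ennreal_mult' less_imp_le[OF weight_pos] mult.commute)
      finally show ?thesis by (simp add: M2_def w)
    qed simp
    show "sets M1 = sigma_sets UNIV (insert {} (range cylinder))"
      by (simp add: M1_def sets_bernoulli_measure_eq_sigma)
    show "sets M2 = sigma_sets UNIV (insert {} (range cylinder))"
      by (simp add: M2_def sets_bernoulli_measure_eq_sigma)
    have "UNIV = cylinder []" by simp
    then show "range (\<lambda>_. UNIV) \<subseteq> insert {} (range (cylinder :: 'm list \<Rightarrow> _))" by blast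
    show "emeasure M1 UNIV \<noteq> \<infinity>"
      unfolding M1_def using A sets.top[of \<mu>] by (subst emeasure_density) auto
  qed auto
  then have "emeasure M1 A = emeasure M2 A" by simp
  then have "emeasure \<mu> A = emeasure \<mu> A * emeasure \<mu> A"
    unfolding M1_def M2_def using A by (simp add: emeasure_density flip: indicator_inter_arith)
  then have "prob A = prob A * prob A"
    by (simp add: emeasure_eq_measure flip: ennreal_mult')
  then show ?thesis by simp
qed

text \<open>The lower half of Kingman's subadditive ergodic theorem.  If the lower limit were at most
  \<open>c < \<gamma>\<close> on a set of positive measure, then almost everywhere by the 0-1 law, and cutting orbits
  into blocks along which the process grows at rate at most \<open>c\<close> would make its mean grow
  at rate at most \<open>c\<close>.\<close>

theorem subadditive_liminf_ge:
  fixes g :: "nat \<Rightarrow> (nat \<Rightarrow> 'm) \<Rightarrow> real"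
  assumes meas [measurable]: "\<And>k. g k \<in> borel_measurable \<mu>"
    and sub: "\<And>k l u. g (k + l) u \<le> g k u + g l (shift k u)"
    and zero: "\<And>u. g 0 u \<le> 0"
    and bdd: "\<And>u. g 1 u \<le> M"
    and bdd_abs: "\<And>k. \<exists>b. \<forall>u. \<bar>g k u\<bar> \<le> b"
    and inv: "\<And>k u. g k (shift 1 u) \<le> g (Suc k) u + M"
    and mean: "\<And>k. expectation (g k) \<ge> real k * \<gamma>"
    and c: "c < \<gamma>"
  shows "AE u in \<mu>. \<forall>\<^sub>F k in sequentially. g k u \<ge> real k * c"
proof -
  \<comment> \<open>This is the set where the lower limit of \<open>g k u / k\<close> is at most
    \<open>c\<close>. Stating it with all margins \<open>1 / (n + 1)\<close> leaves room for the
    bounded error that a shift by one letter causes.\<close>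
  define A where "A = {u \<in> space \<mu>. \<forall>n. \<exists>\<^sub>F k in sequentially. g k u \<le> real k * (c + 1 / real (Suc n))}"
  have A: "A \<in> sets \<mu>" unfolding A_def frequently_sequentially by measurable
  have step: "shift 1 u \<in> A \<longleftrightarrow> u \<in> A" for u
  proof
    assume u: "shift 1 u \<in> A"
    show "u \<in> A" unfolding A_def
    proof (safe, simp)
      fix n
      \<comment> \<open>\<open>Suc (Suc (2 * n))\<close> is twice \<open>n + 1\<close>. Half of the
        margin goes into \<open>d\<close>, the other half absorbs the constant error once
        \<open>k\<close> is large; the converse inclusion uses the same split.\<close>
      define d where "d = c + 1 / real (Suc (Suc (2 * n)))"
      have "\<exists>\<^sub>F k in sequentially. g k (shift 1 u) \<le> real k * d"
        using u unfolding A_def d_def by blast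
      moreover have "\<forall>\<^sub>F k in sequentially. (M - d) \<le> real (Suc k) * (1 / real (Suc (Suc (2 * n))))"
        by (rule eventually_mono[OF eventually_le_real_mult[of "1 / real (Suc (Suc (2 * n)))" "M - d"]])
           (auto simp: add_divide_distrib intro: add_increasing)
      ultimately have "\<exists>\<^sub>F k in sequentially. g (Suc k) u \<le> real (Suc k) * (c + 1 / real (Suc n))"
      proof (rule frequently_rev_mp[OF frequently_eventually_conj], intro always_eventually allI impI, elim conjE)
        fix k assume k: "g k (shift 1 u) \<le> real k * d" "M - d \<le> real (Suc k) * (1 / real (Suc (Suc (2 * n))))"
        have "g (Suc k) u \<le> g 1 u + g k (shift 1 u)" using sub[of 1 k u] by simp
        also have "\<dots> \<le> M + real k * d" using bdd[of u] k by simp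
        also have "\<dots> = real (Suc k) * d + (M - d)" by (simp add: algebra_simps)
        also have "\<dots> \<le> real (Suc k) * (d + 1 / real (Suc (Suc (2 * n))))"
          using k(2) by (simp add: algebra_simps)
        also have "d + 1 / real (Suc (Suc (2 * n))) = c + 1 / real (Suc n)"
          by (simp add: d_def field_simps)
        finally show "g (Suc k) u \<le> real (Suc k) * (c + 1 / real (Suc n))" .
      qed
      then show "\<exists>\<^sub>F k in sequentially. g k u \<le> real k * (c + 1 / real (Suc n))"
        unfolding frequently_sequentially by (meson le_SucI)
    qed
  next
    assume u: "u \<in> A"
    show "shift 1 u \<in> A" unfolding A_def
    proof (safe, simp)
      fix n
      define d where "d = c + 1 / real (Suc (Suc (2 * n)))"
      have "\<exists>\<^sub>F k in sequentially. g k u \<le> real k * d"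
        using u unfolding A_def d_def by blast
      then have "\<exists>\<^sub>F k in sequentially. g (Suc k) u \<le> real (Suc k) * d"
        unfolding frequently_sequentially by (metis Suc_le_D Suc_le_mono)
      moreover have "\<forall>\<^sub>F k in sequentially. (M + d) \<le> real k * (1 / real (Suc (Suc (2 * n))))"
        by (rule eventually_le_real_mult) simp
      ultimately show "\<exists>\<^sub>F k in sequentially. g k (shift 1 u) \<le> real k * (c + 1 / real (Suc n))"
      proof (rule frequently_rev_mp[OF frequently_eventually_conj], intro always_eventually allI impI, elim conjE)
        fix k assume k: "g (Suc k) u \<le> real (Suc k) * d" "M + d \<le> real k * (1 / real (Suc (Suc (2 * n))))"
        have "g k (shift 1 u) \<le> real (Suc k) * d + M" using inv[of k u] k by simp
        also have "\<dots> = real k * d + (M + d)" by (simp add: algebra_simps)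
        also have "\<dots> \<le> real k * (d + 1 / real (Suc (Suc (2 * n))))"
          using k(2) by (simp add: algebra_simps)
        also have "d + 1 / real (Suc (Suc (2 * n))) = c + 1 / real (Suc n)"
          by (simp add: d_def field_simps)
        finally show "g k (shift 1 u) \<le> real k * (c + 1 / real (Suc n))" .
      qed
    qed
  qed
  have "prob A \<noteq> 1"
  proof
    assume "prob A = 1"
    then have AE_A: "AE u in \<mu>. u \<in> A" using A by (simp add: prob_eq_1)
    obtain n where n: "c + 1 / real (Suc n) < \<gamma>"
      using c nat_approx_posE[of "\<gamma> - c"] by (auto simp: algebra_simps)
    define d where "d = c + 1 / real (Suc n)"
    \<comment> \<open>\<open>M'\<close> is the price of one letter beyond the rate \<open>d\<close>;
      it is also charged for each letter of an unfinished last block.\<close>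
    define M' where "M' = \<bar>M\<bar> + \<bar>d\<bar>"
    have M': "0 \<le> M'" "M - d \<le> M'" by (auto simp: M'_def)
    \<comment> \<open>\<open>Z L\<close> contains the bad starting points: no block of length at
      most \<open>L\<close> from there grows at rate \<open>d\<close> or less. Almost every point
      lies in \<open>A\<close> and so leaves \<open>Z L\<close> once \<open>L\<close> is
      large.\<close>
    define Z where "Z L = {u \<in> space \<mu>. \<forall>k\<in>{1..L}. g k u > real k * d}" for L
    have Z [measurable]: "Z L \<in> sets \<mu>" for L unfolding Z_def by measurable
    have "(\<lambda>L. prob (Z L)) \<longlonglongrightarrow> prob (\<Inter>L. Z L)"
    proof (rule finite_Lim_measure_decseq)
      show "range Z \<subseteq> sets \<mu>" using Z by blast
      show "decseq Z" by (auto simp: decseq_def Z_def)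
    qed
    moreover have "prob (\<Inter>L. Z L) = 0"
    proof -
      have "AE u in \<mu>. u \<notin> (\<Inter>L. Z L)"
        using AE_A
      proof (rule AE_mp, intro AE_I2 impI notI)
        fix u assume u: "u \<in> A" "u \<in> (\<Inter>L. Z L)"
        from u(1) have "\<exists>\<^sub>F k in sequentially. g k u \<le> real k * d" by (simp add: A_def d_def)
        then obtain k where k: "k \<ge> 1" "g k u \<le> real k * d" unfolding frequently_sequentially by blast
        with u(2) show False by (auto simp: Z_def not_less dest!: spec[of _ k] bspec[of _ _ k])
      qed
      then show ?thesis by (subst prob_eq_0) auto
    qed
    ultimately have Z_lim: "(\<lambda>L. prob (Z L)) \<longlonglongrightarrow> 0" by simp
    \<comment> \<open>The orbit is cut greedily. At a point of \<open>Z L\<close> one letter is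
      removed at the extra price \<open>M'\<close>; elsewhere a block of length at most
      \<open>L\<close> is removed at rate \<open>d\<close>. If the block would exceed the remaining
      length, fewer than \<open>L\<close> letters are left, which the last summand pays for.\<close>
    have block: "g n u \<le> real n * d + M' * (\<Sum>j<n. indicator (Z L) (shift j u)) + real L * M'" for n L u
    proof (induction n arbitrary: u rule: less_induct)
      case (less n)
      let ?I = "\<lambda>u n. \<Sum>j<n. indicator (Z L) (shift j u) :: real"
      have I_nonneg: "0 \<le> ?I u n" for u n by (intro sum_nonneg) auto
      have gn: "g n u \<le> real n * M" for n u
      proof (induction n arbitrary: u)
        case (Suc n)
        show ?case using sub[of 1 n u] bdd[of u] Suc[of "shift 1 u"] by (simp add: algebra_simps)
      qed (simp add: zero)
      show ?case
      proof (cases "n = 0")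
        case True
        then show ?thesis using zero[of u] mult_nonneg_nonneg[OF of_nat_0_le_iff[of L] M'(1)] by simp
      next
        case n0: False
        show ?thesis
        proof (cases "u \<in> Z L")
          case True
          obtain l where l: "n = Suc l" using n0 by (cases n) auto
          have "g n u \<le> M + g l (shift 1 u)" using sub[of 1 l u] bdd[of u] by (simp add: l)
          also have "\<dots> \<le> M + (real l * d + M' * ?I (shift 1 u) l + real L * M')"
            using less[of l "shift 1 u"] by (simp add: l)
          also have "?I (shift 1 u) l = ?I u n - 1"
            unfolding l using True by (subst sum.lessThan_Suc_shift) simp
          finally show ?thesis using M' by (simp add: l algebra_simps)
        next
          case False
          then obtain k where k: "k \<ge> 1" "k \<le> L" "g k u \<le> real k * d"
            by (auto simp: Z_def not_less)
          show ?thesis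
          proof (cases "k \<le> n")
            case True
            have "g n u \<le> g k u + g (n - k) (shift k u)" using sub[of k "n - k" u] True by simp
            also have "\<dots> \<le> real k * d + (real (n - k) * d + M' * ?I (shift k u) (n - k) + real L * M')"
              using less[of "n - k" "shift k u"] k n0 by simp
            also have "?I (shift k u) (n - k) = (\<Sum>j\<in>{k..<n}. indicator (Z L) (shift j u))"
              using True by (intro sum.reindex_bij_witness[of _ "\<lambda>j. j - k" "\<lambda>j. k + j"]) (auto simp: add.assoc)
            also have "M' * \<dots> \<le> M' * ?I u n"
              by (intro mult_left_mono sum_mono2 M') auto
            finally show ?thesis using True by (simp add: of_nat_diff algebra_simps)
          next
            case kn: False
            have "real n * (M - d) \<le> real n * M'" by (rule mult_left_mono[OF M'(2)]) simp
            also have "\<dots> \<le> real L * M'" using kn k by (intro mult_right_mono M'(1)) simp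
            finally have "real n * M \<le> real n * d + real L * M'" by (simp add: algebra_simps)
            then show ?thesis
              using gn[of n u] mult_nonneg_nonneg[OF M'(1) I_nonneg[of u n]] by linarith
          qed
        qed
      qed
    qed
    have g_int: "integrable \<mu> (g n)" for n
    proof -
      obtain b where "\<And>u. \<bar>g n u\<bar> \<le> b" using bdd_abs by blast
      then show ?thesis by (intro integrable_const_bound[of _ b]) auto
    qed
    \<comment> \<open>Integrating the block estimate replaces each indicator by
      \<open>prob (Z L)\<close>, by shift invariance. Division by \<open>n\<close> and
      \<open>n\<close> tending to infinity remove the term for the last block; only afterwards does
      \<open>L\<close> tend to infinity.\<close>
    have "\<gamma> \<le> d + M' * prob (Z L)" for L
    proof -
      have bound: "real n * \<gamma> \<le> real n * d + real n * (M' * prob (Z L)) + real L * M'" for n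
      proof -
        have ind: "integrable \<mu> (\<lambda>u. indicator (Z L) (shift j u) :: real)" for j
          by (intro integrable_const_bound[of _ 1]) auto
        have "expectation (\<lambda>u. indicator (Z L) (shift j u) :: real) = prob (Z L)" for j
          using expectation_shift[of "indicator (Z L)" j] by simp
        moreover have "real n * \<gamma> \<le> expectation (\<lambda>u. real n * d + M' * (\<Sum>j<n. indicator (Z L) (shift j u)) + real L * M')"
          by (rule order_trans[OF mean integral_mono[OF g_int _ block]])
             (intro Bochner_Integration.integrable_add Bochner_Integration.integrable_mult_right
               Bochner_Integration.integrable_sum ind integrable_const)
        ultimately show ?thesis
          by (simp add: ind prob_space[simplified] mult_ac)
      qed
      have ev: "\<gamma> \<le> d + M' * prob (Z L) + real L * M' / real n" if "n > 0" for n
      proof -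
        have "real n * \<gamma> \<le> real n * (d + M' * prob (Z L) + real L * M' / real n)"
          using bound[of n] that by (simp add: algebra_simps)
        with that show ?thesis by simp
      qed
      have "(\<lambda>n. d + M' * prob (Z L) + real L * M' / real n) \<longlonglongrightarrow> d + M' * prob (Z L) + 0"
        by (intro tendsto_intros lim_const_over_n)
      then have "\<gamma> \<le> d + M' * prob (Z L) + 0"
        by (rule LIMSEQ_le_const) (use ev in \<open>auto intro!: exI[of _ 1]\<close>)
      then show ?thesis by simp
    qed
    moreover have "(\<lambda>L. d + M' * prob (Z L)) \<longlonglongrightarrow> d + M' * 0"
      by (intro tendsto_intros Z_lim)
    ultimately have "\<gamma> \<le> d + M' * 0"
      by (intro LIMSEQ_le_const[of "\<lambda>L. d + M' * prob (Z L)"]) auto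
    then have "\<gamma> \<le> d" by simp
    with n show False by (simp add: d_def)
  qed
  then have "prob A = 0" using shift_invariant_0_1[OF A step] by blast
  then have "AE u in \<mu>. u \<notin> A" using A by (subst (asm) prob_eq_0)
  then show ?thesis
  proof (rule AE_mp, intro AE_I2 impI)
    fix u assume "u \<notin> A"
    then obtain n where "\<forall>\<^sub>F k in sequentially. \<not> g k u \<le> real k * (c + 1 / real (Suc n))"
      by (auto simp: A_def not_frequently)
    then show "\<forall>\<^sub>F k in sequentially. g k u \<ge> real k * c"
    proof (rule eventually_mono)
      fix k assume "\<not> g k u \<le> real k * (c + 1 / real (Suc n))"
      moreover have "real k * c \<le> real k * (c + 1 / real (Suc n))" by (intro mult_left_mono) auto
      ultimately show "g k u \<ge> real k * c" by linarith
    qed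
  qed
qed

text \<open>Averaging over the \<open>n\<close> ways of cutting an orbit into blocks of length \<open>n\<close> bounds \<open>n * g k\<close> by an
  ergodic sum of \<open>g n\<close>, and the preceding theorem applies to the negative of that sum.\<close>

theorem subadditive_limsup_le:
  fixes g :: "nat \<Rightarrow> (nat \<Rightarrow> 'm) \<Rightarrow> real"
  assumes meas [measurable]: "\<And>k. g k \<in> borel_measurable \<mu>"
    and sub: "\<And>k l u. g (k + l) u \<le> g k u + g l (shift k u)"
    and bdd_abs: "\<And>k. \<exists>b. \<forall>u. \<bar>g k u\<bar> \<le> b"
    and n: "0 < n" and mean: "expectation (g n) < real n * c"
  shows "AE u in \<mu>. \<forall>\<^sub>F k in sequentially. g k u \<le> real k * c"
proof -
  define e where "e = (real n * c - expectation (g n)) / 2"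
  have e: "0 < e" "expectation (g n) + e = real n * c - e" using mean by (auto simp: e_def field_simps)
  obtain b where b: "\<And>k u. \<bar>g k u\<bar> \<le> b k" using bdd_abs by metis
  \<comment> \<open>The negative of the ergodic sum is additive, hence subadditive, with mean
    \<open>- expectation (g n)\<close> per step, so a lower bound for it bounds the ergodic sum from
    above.\<close>
  define a where "a q u = - (\<Sum>j<q. g n (shift j u))" for q u
  have meas_a: "a q \<in> borel_measurable \<mu>" for q unfolding a_def by measurable
  have int: "integrable \<mu> (\<lambda>u. g n (shift j u))" for j
    by (rule integrable_const_bound[of _ "b n"]) (auto simp: b)
  have a_Suc: "a (Suc q) u = - g n u + a q (shift 1 u)" for q u
    unfolding a_def by (subst sum.lessThan_Suc_shift) simp
  have a_add: "a (k + l) u = a k u + a l (shift k u)" for k l u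
    by (induction k arbitrary: u) (simp_all add: a_def[of 0] a_Suc)
  have a_bound: "\<bar>a q u\<bar> \<le> real q * b n" for q u
  proof (induction q arbitrary: u)
    case (Suc q)
    show ?case using a_Suc[of q u] b[of n u] Suc[of "shift 1 u"] by (simp add: algebra_simps abs_le_iff)
  qed (simp add: a_def)
  have "AE u in \<mu>. \<forall>\<^sub>F q in sequentially. a q u \<ge> real q * - (expectation (g n) + e)"
  proof (rule subadditive_liminf_ge[where \<gamma> = "- expectation (g n)" and M = "b n"])
    show "a 1 u \<le> b n" for u using b[of n u] by (simp add: a_def abs_le_iff)
    show "\<exists>b. \<forall>u. \<bar>a k u\<bar> \<le> b" for k using a_bound by blast
    show "a k (shift 1 u) \<le> a (Suc k) u + b n" for k u
      using b[of n u] by (simp add: a_Suc abs_le_iff)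
    show "real k * - expectation (g n) \<le> expectation (a k)" for k
      unfolding a_def by (simp add: int expectation_shift sum_negf)
  qed (use e in \<open>auto simp: meas_a a_add a_def[of 0]\<close>)
  then show ?thesis
  proof (rule AE_mp, intro AE_I2 impI)
    fix u assume ev: "\<forall>\<^sub>F q in sequentially. a q u \<ge> real q * - (expectation (g n) + e)"
    \<comment> \<open>\<open>R q u\<close> adds, over the \<open>n\<close> phases \<open>t\<close>,
      the value of the process from position \<open>t\<close> up to the common end
      \<open>n - 1 + q\<close>. When \<open>q\<close> grows by 1, only the phase 0 is split: its
      first block contributes \<open>g n u\<close>, and its remainder becomes the last phase for the
      shifted sequence.\<close>
    define R where "R q u = (\<Sum>t<n. g (n - 1 + q - t) (shift t u))" for q u
    define B where "B = (\<Sum>t<n. b t)"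
    have R_Suc: "R (Suc q) u \<le> g n u + R q (shift 1 u)" for q u
    proof -
      obtain m where m: "n = Suc m" using n by (cases n) auto
      have "R (Suc q) u = g (n + q) u + (\<Sum>t<m. g (m + q - t) (shift (Suc t) u))"
        unfolding R_def m by (subst sum.lessThan_Suc_shift) simp
      also have "g (n + q) u \<le> g n u + g q (shift n u)" by (rule sub)
      also have "g n u + g q (shift n u) + (\<Sum>t<m. g (m + q - t) (shift (Suc t) u)) = g n u + R q (shift 1 u)"
        unfolding R_def m by simp
      finally show ?thesis by simp
    qed
    have R_le: "R q u \<le> - a q u + B" for q u
    proof (induction q arbitrary: u)
      case 0
      have "R 0 u \<le> (\<Sum>t<n. b (n - 1 - t))"
        unfolding R_def by (rule sum_mono) (use b in \<open>simp add: abs_le_iff\<close>)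
      also have "\<dots> = B"
        unfolding B_def by (rule sum.reindex_bij_witness[of _ "\<lambda>t. n - 1 - t" "\<lambda>t. n - 1 - t"]) auto
      finally show ?case by (simp add: a_def)
    next
      case (Suc q)
      show ?case using R_Suc[of q u] Suc[of "shift 1 u"] a_Suc[of q u] by simp
    qed
    have main: "real n * g (n - 1 + q) u \<le> - a q u + 2 * B" for q
    proof -
      have "real n * g (n - 1 + q) u = (\<Sum>t<n. g (n - 1 + q) u)" by (simp only: sum_constant card_lessThan)
      also have "\<dots> = (\<Sum>t<n. g (t + (n - 1 + q - t)) u)" by (intro sum.cong) auto
      also have "\<dots> \<le> (\<Sum>t<n. b t + g (n - 1 + q - t) (shift t u))"
      proof (rule sum_mono)
        fix t
        show "g (t + (n - 1 + q - t)) u \<le> b t + g (n - 1 + q - t) (shift t u)"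
          using sub[of t "n - 1 + q - t" u] b[of t u] by (simp add: abs_le_iff)
      qed
      also have "\<dots> = B + R q u" by (simp add: B_def R_def sum.distrib)
      finally show ?thesis using R_le[of q u] by simp
    qed
    define D where "D = 2 * B - real (n - 1) * (real n * c)"
    have "\<forall>\<^sub>F q in sequentially. D \<le> real q * e" by (rule eventually_le_real_mult[OF e(1)])
    with ev have "\<forall>\<^sub>F q in sequentially. g (q + (n - 1)) u \<le> real (q + (n - 1)) * c"
    proof eventually_elim
      case (elim q)
      have "real n * g (n - 1 + q) u \<le> real q * (real n * c - e) + 2 * B"
        using main[of q] elim(1)[unfolded e(2) mult_minus_right] by linarith
      also have "\<dots> \<le> real n * (real (n - 1 + q) * c)"
        using elim(2) by (simp add: D_def algebra_simps)
      finally have "g (n - 1 + q) u \<le> real (n - 1 + q) * c" using n by simp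
      then show ?case by (simp add: add.commute)
    qed
    then show "\<forall>\<^sub>F k in sequentially. g k u \<le> real k * c"
      by (rule eventually_sequentially_seg[THEN iffD1])
  qed
qed

end

section \<open>The pressure function\<close>

text \<open>The limit is the infimum of the quotients. This is why it bounds every single term from
  below, as the hypothesis on the mean in \<open>subadditive_liminf_ge\<close> demands.\<close>

lemma fekete:
  fixes e :: "nat \<Rightarrow> real"
  assumes sub: "\<And>k l. 0 < k \<Longrightarrow> 0 < l \<Longrightarrow> e (k + l) \<le> e k + e l"
    and low: "\<And>k. - B * real k \<le> e k"
  obtains \<gamma> where "(\<lambda>k. e k / real k) \<longlonglongrightarrow> \<gamma>" "\<And>k. 0 < k \<Longrightarrow> real k * \<gamma> \<le> e k"
proof -
  define \<gamma> where "\<gamma> = (INF k\<in>{0<..}. e k / real k)"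
  have bdd: "bdd_below ((\<lambda>k. e k / real k) ` {0<..})"
    using low by (intro bdd_belowI[of _ "- B"]) (auto simp: le_divide_eq)
  have ge: "\<gamma> \<le> e k / real k" if "0 < k" for k
    unfolding \<gamma>_def using that by (intro cINF_lower bdd) auto
  have "(\<lambda>k. e k / real k) \<longlonglongrightarrow> \<gamma>"
  proof (rule LIMSEQ_I)
    fix \<epsilon> :: real assume "0 < \<epsilon>"
    then have "\<gamma> < \<gamma> + \<epsilon> / 2" by simp
    then obtain n where n: "0 < n" "e n / real n < \<gamma> + \<epsilon> / 2"
      unfolding \<gamma>_def by (subst (asm) cINF_less_iff[OF _ bdd]) auto
    define R where "R = \<bar>e n\<bar> + (\<Sum>r\<le>n. \<bar>e r\<bar>)"
    have iter: "e (q * n + r) \<le> real q * e n + e r" if "0 < r" for q r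
    proof (induction q)
      case (Suc q)
      have "e (n + (q * n + r)) \<le> e n + e (q * n + r)" using n that by (intro sub) auto
      with Suc show ?case by (simp add: algebra_simps)
    qed simp
    have up: "e k \<le> real k * (e n / real n) + R" if "0 < k" for k
    proof -
      \<comment> \<open>The remainder is taken from 1 to \<open>n\<close> instead of 0 to
        \<open>n - 1\<close>, because subadditivity is available for positive indices only.\<close>
      define q where "q = (k - 1) div n"
      define r where "r = (k - 1) mod n + 1"
      have k: "k = q * n + r" using that by (simp add: q_def r_def)
      have r: "0 < r" "r \<le> n" using n by (auto simp: r_def Suc_leI)
      have 1: "e k \<le> real q * e n + e r" unfolding k by (rule iter[OF r(1)])
      have 2: "real q * e n = real k * (e n / real n) - real r / real n * e n"
        using n by (simp add: k field_simps)
      have 3: "e r \<le> (\<Sum>r\<le>n. \<bar>e r\<bar>)"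
        using member_le_sum[of r "{..n}" "\<lambda>r. \<bar>e r\<bar>"] r by (simp add: abs_le_iff)
      have "\<bar>real r / real n * e n\<bar> \<le> 1 * \<bar>e n\<bar>"
        unfolding abs_mult using r n by (intro mult_right_mono) auto
      then have "- (real r / real n * e n) \<le> \<bar>e n\<bar>" by linarith
      with 1 2 3 show ?thesis unfolding R_def by linarith
    qed
    obtain k0 where k0: "\<And>k. k \<ge> k0 \<Longrightarrow> R \<le> real k * (\<epsilon> / 4)"
      using eventually_le_real_mult[of "\<epsilon> / 4" R] \<open>0 < \<epsilon>\<close> by (auto simp: eventually_sequentially)
    show "\<exists>no. \<forall>k\<ge>no. norm (e k / real k - \<gamma>) < \<epsilon>"
    proof (intro exI allI impI)
      fix k assume k: "k \<ge> max 1 k0"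
      then have "e k / real k \<le> (real k * (e n / real n) + real k * (\<epsilon> / 4)) / real k"
        using up[of k] k0[of k] by (intro divide_right_mono) auto
      also have "\<dots> = e n / real n + \<epsilon> / 4" using k by (simp add: add_divide_distrib)
      finally show "norm (e k / real k - \<gamma>) < \<epsilon>"
        using n ge[of k] k \<open>0 < \<epsilon>\<close> by simp
    qed
  qed
  then show ?thesis
    using that ge by (metis le_divide_eq mult.commute of_nat_0_less_iff)
qed

lemma word_map_append: "word_map T (v @ w) = word_map T v \<circ> word_map T w"
  by (induction v) auto

lemma map_shift_append: "map u [0..<k + l] = map u [0..<k] @ map (shift k u) [0..<l]"
  by (rule nth_equalityI) (auto simp: nth_append)

section \<open>Estimates along words\<close>

locale self_affine_system = bernoulli p
  for p :: "'m::finite \<Rightarrow> real" +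
  fixes T :: "'m \<Rightarrow> 'a::euclidean_space \<Rightarrow> 'a"
  assumes card_ge_2: "2 \<le> CARD('m)"
    and lin: "\<And>i. linear (T i)" and bij: "\<And>i. bij (T i)" and onorm_lt: "\<And>i. onorm (T i) < 1/2"
begin

sublocale contracting_maps T "\<omega> :: 'a ^ 'm" for \<omega>
  by (rule contracting_maps.intro, rule lin, rule onorm_lt)

abbreviation "Tw w \<equiv> word_map T w"

lemma linear_word_map: "linear (Tw w)"
proof (induction w)
  case (Cons i w)
  then show ?case unfolding word_map.simps by (rule linear_compose[OF _ lin])
qed (simp add: id_def linear_ident)

lemma inj_word_map: "inj (Tw w)"
proof (induction w)
  case (Cons i w)
  then show ?case unfolding word_map.simps by (rule inj_compose[OF bij_is_inj[OF bij]])
qed simp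

lemma norm_word_map_lower:
  obtains a where "0 < a" "a \<le> 1/2" "\<And>w x. a ^ length w * norm x \<le> norm (Tw w x)"
proof -
  have "\<exists>a>0. \<forall>x. a * norm x \<le> norm (T i x)" for i
    using linear_inj_bounded_below_pos[OF lin bij_is_inj[OF bij]] by metis
  then obtain A where A: "\<And>i. 0 < A i" "\<And>i x. A i * norm x \<le> norm (T i x)" by metis
  \<comment> \<open>The minimum with 1/2 keeps \<open>a\<close> below 1, so that
    \<open>- ln a\<close> is a positive rate.\<close>
  define a where "a = min (1/2) (Min (range A))"
  have a: "0 < a" "a \<le> 1/2" "\<And>i. a \<le> A i"
    using A(1) by (auto simp: a_def min_le_iff_disj)
  have "a ^ length w * norm x \<le> norm (Tw w x)" for w x
  proof (induction w)
    case (Cons i w)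
    have "a ^ length (i # w) * norm x \<le> a * norm (Tw w x)"
      using Cons a by (simp add: mult.assoc)
    also have "\<dots> \<le> A i * norm (Tw w x)" by (intro mult_right_mono a) simp
    also have "\<dots> \<le> norm (Tw (i # w) x)" using A(2) by simp
    finally show ?case .
  qed simp
  with a show ?thesis using that by blast
qed

text \<open>The sign is opposite to that of the summand in the pressure: in this form
  submultiplicativity of \<open>\<phi>\<^sup>s\<close> becomes subadditivity, and positive growth
  means that \<open>\<mu>(C\<^sub>w) / \<phi>\<^sup>s(T\<^sub>w)\<close> decays.\<close>

definition log_ratio :: "real \<Rightarrow> 'm list \<Rightarrow> real" where
  "log_ratio s w = ln (singular_value_fun s (Tw w)) - ln (weight w)"

lemma svf_pos: "0 \<le> s \<Longrightarrow> 0 < singular_value_fun s (Tw w)"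
  by (rule singular_value_fun_pos[OF linear_word_map inj_word_map])

text \<open>All singular values of a product of \<open>k\<close> maps lie between
  \<open>a ^ k\<close> and \<open>(1/2) ^ k\<close>, so changing the exponent changes the logarithm
  by an amount linear in \<open>k\<close>. In the limit this makes the growth rate strictly
  decreasing and Lipschitz continuous.\<close>

lemma log_ratio_diff_bounds:
  obtains \<Lambda> where "0 < \<Lambda>" "\<And>s t w. 0 \<le> s \<Longrightarrow> s \<le> t \<Longrightarrow>
    log_ratio t w \<le> log_ratio s w - real (length w) * (t - s) * ln 2"
    "\<And>s t w. 0 \<le> s \<Longrightarrow> s \<le> t \<Longrightarrow> log_ratio s w - real (length w) * (t - s) * \<Lambda> \<le> log_ratio t w"
proof -
  obtain a where a: "0 < a" "a \<le> 1/2" "\<And>w x. a ^ length w * norm x \<le> norm (Tw w x)"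
    using norm_word_map_lower by blast
  have sv: "a ^ length w \<le> singular_value (Tw w) j" "singular_value (Tw w) j \<le> (1/2) ^ length w"
    if j: "1 \<le> j" "j \<le> DIM('a)" for w j
  proof -
    obtain b where b: "norm b = 1" "singular_value (Tw w) j = norm (Tw w b)"
      using singular_value_attained[OF linear_word_map j] by blast
    show "a ^ length w \<le> singular_value (Tw w) j" using a(3)[of w b] b by simp
    show "singular_value (Tw w) j \<le> (1/2) ^ length w" using norm_word_map_le[of w b] b by simp
  qed
  show ?thesis
  proof (rule that[of "- ln a"])
    show "0 < - ln a" using a by (simp add: ln_less_zero)
    fix s t :: real and w :: "'m list" assume st: "0 \<le> s" "s \<le> t"
    let ?k = "length w"
    note mono = singular_value_fun_mono[OF linear_word_map inj_word_map _ sv st, of w]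
    have ap: "0 < a ^ ?k" using a by simp
    note pos = svf_pos[OF st(1), of w] svf_pos[OF order_trans[OF st], of w]
    have "ln (singular_value_fun t (Tw w)) \<le> ln (((1/2) ^ ?k) powr (t - s) * singular_value_fun s (Tw w))"
      using mono(1)[OF ap] pos by (subst ln_le_cancel_iff) auto
    also have "\<dots> = (t - s) * (real ?k * ln (1/2)) + ln (singular_value_fun s (Tw w))"
      using pos by (subst ln_mult) (auto simp: ln_powr ln_realpow simp del: power_one_over power_divide)
    also have "ln (1/2 :: real) = - ln 2" by (simp add: ln_div)
    finally show "log_ratio t w \<le> log_ratio s w - real ?k * (t - s) * ln 2"
      by (simp add: log_ratio_def algebra_simps)
    have "ln ((a ^ ?k) powr (t - s) * singular_value_fun s (Tw w)) \<le> ln (singular_value_fun t (Tw w))"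
      using mono(2)[OF ap] pos ap a(1) by (intro iffD2[OF ln_le_cancel_iff] mult_pos_pos) auto
    also have "ln ((a ^ ?k) powr (t - s) * singular_value_fun s (Tw w)) =
        (t - s) * (real ?k * ln a) + ln (singular_value_fun s (Tw w))"
      using pos a by (subst ln_mult) (auto simp: ln_powr ln_realpow)
    finally show "log_ratio s w - real ?k * (t - s) * - ln a \<le> log_ratio t w"
      by (simp add: log_ratio_def algebra_simps)
  qed
qed

text \<open>A second letter has positive probability. This makes the entropy positive, hence the
  growth rate at \<open>s = 0\<close> and finally \<open>d\<^sub>1\<close>.\<close>

lemma p_lt_1: "p i < 1"
proof -
  have "\<exists>j. j \<noteq> i"
  proof (rule ccontr)
    assume "\<not> (\<exists>j. j \<noteq> i)"
    then have "(UNIV :: 'm set) = {i}" by auto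
    then show False using card_ge_2 by (metis card.empty card.insert empty_iff finite.emptyI Suc_1 not_less_eq_eq One_nat_def le_refl)
  qed
  then obtain j where "j \<noteq> i" by blast
  then have "p i + p j = sum p {i, j}" by simp
  also have "\<dots> \<le> sum p UNIV" by (intro sum_mono2) (auto simp: less_imp_le p_pos)
  finally show ?thesis using p_pos[of j] p_sum by simp
qed

lemma weight_bounds:
  obtains q q' where "0 < q" "q \<le> q'" "q' < 1" "\<And>w. q ^ length w \<le> weight w" "\<And>w. weight w \<le> q' ^ length w"
proof -
  define q where "q = Min (range p)"
  define q' where "q' = Max (range p)"
  have q: "0 < q" "q' < 1" "\<And>i. q \<le> p i" "\<And>i. p i \<le> q'"
    by (auto simp: q_def q'_def p_pos p_lt_1)
  then have q': "q \<le> q'" by (meson order_trans)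
  have "q ^ length w \<le> weight w \<and> weight w \<le> q' ^ length w" for w
  proof (induction w)
    case (Cons i w)
    have "q * q ^ length w \<le> p i * weight w" "p i * weight w \<le> q' * q' ^ length w"
      using Cons q q' p_pos[of i] weight_pos[of w] by (intro mult_mono; auto)+
    then show ?case by simp
  qed simp
  with q q' show ?thesis using that by blast
qed

lemma log_ratio_zero_bounds:
  obtains h H where "0 < h" "\<And>w. real (length w) * h \<le> log_ratio 0 w"
    "\<And>w. log_ratio 0 w \<le> real (length w) * H"
proof -
  obtain q q' where q: "0 < q" "q \<le> q'" "q' < 1"
    "\<And>w. q ^ length w \<le> weight w" "\<And>w. weight w \<le> q' ^ length w"
    using weight_bounds by blast
  have lr: "log_ratio 0 w = - ln (weight w)" for w
    by (simp add: log_ratio_def singular_value_fun_def)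
  show ?thesis
  proof (rule that[of "- ln q'" "- ln q"])
    show "0 < - ln q'" using q by simp
    show "real (length w) * - ln q' \<le> log_ratio 0 w" for w
    proof -
      have "ln (weight w) \<le> ln (q' ^ length w)"
        using q weight_pos[of w] by (subst ln_le_cancel_iff) auto
      then show ?thesis using q by (simp add: lr ln_realpow)
    qed
    show "log_ratio 0 w \<le> real (length w) * - ln q" for w
    proof -
      have "ln (q ^ length w) \<le> ln (weight w)"
        using q weight_pos[of w] by (subst ln_le_cancel_iff) auto
      then show ?thesis using q by (simp add: lr ln_realpow)
    qed
  qed
qed

lemma log_ratio_abs_le:
  assumes "0 \<le> s"
  obtains K where "0 \<le> K" "\<And>w. \<bar>log_ratio s w\<bar> \<le> real (length w) * K"
proof -
  obtain \<Lambda> where L: "0 < \<Lambda>" "\<And>s t w. 0 \<le> s \<Longrightarrow> s \<le> t \<Longrightarrow>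
    log_ratio t w \<le> log_ratio s w - real (length w) * (t - s) * ln 2"
    "\<And>s t w. 0 \<le> s \<Longrightarrow> s \<le> t \<Longrightarrow> log_ratio s w - real (length w) * (t - s) * \<Lambda> \<le> log_ratio t w"
    using log_ratio_diff_bounds by metis
  obtain h H where h: "0 < h" "\<And>w. real (length w) * h \<le> log_ratio 0 w"
    "\<And>w. log_ratio 0 w \<le> real (length w) * H" using log_ratio_zero_bounds by metis
  show ?thesis
  proof (rule that[of "\<bar>H\<bar> + s * \<Lambda>"])
    have sL: "0 \<le> s * \<Lambda>" using L(1) assms by simp
    then show "0 \<le> \<bar>H\<bar> + s * \<Lambda>" by simp
    fix w :: "'m list"
    let ?k = "real (length w)"
    have "0 \<le> ?k * s * ln 2" using assms by simp
    then have "log_ratio s w \<le> ?k * H" using L(2)[OF order_refl assms, of w] h(3)[of w] by (simp only: diff_zero)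
    also have "\<dots> \<le> ?k * (\<bar>H\<bar> + s * \<Lambda>)"
      using sL abs_ge_self[of H] abs_ge_zero[of H] by (intro mult_left_mono; linarith)
    finally have 1: "log_ratio s w \<le> ?k * (\<bar>H\<bar> + s * \<Lambda>)" .
    have "0 \<le> ?k * h" using h(1) by simp
    then have "- log_ratio s w \<le> ?k * (s * \<Lambda>)"
      using L(3)[OF order_refl assms, of w] h(2)[of w]
      by (simp only: diff_zero mult.assoc)
    also have "\<dots> \<le> ?k * (\<bar>H\<bar> + s * \<Lambda>)"
      using sL abs_ge_self[of H] abs_ge_zero[of H] by (intro mult_left_mono; linarith)
    finally show "\<bar>log_ratio s w\<bar> \<le> ?k * (\<bar>H\<bar> + s * \<Lambda>)" using 1 by (simp add: abs_le_iff)
  qed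
qed

lemma log_ratio_append:
  assumes "0 \<le> s"
  obtains c where "0 \<le> c" "\<And>v w. log_ratio s (v @ w) \<le> log_ratio s v + log_ratio s w + c"
proof -
  obtain C where C: "0 < C" "\<And>f g :: 'a \<Rightarrow> 'a. linear f \<Longrightarrow> inj f \<Longrightarrow> linear g \<Longrightarrow> inj g \<Longrightarrow>
    singular_value_fun s (f \<circ> g) \<le> C * (singular_value_fun s f * singular_value_fun s g)"
    using singular_value_fun_comp_le[OF assms] by metis
  show ?thesis
  proof (rule that[of "\<bar>ln C\<bar>"])
    fix v w :: "'m list"
    note pos = svf_pos[OF assms]
    have "ln (singular_value_fun s (Tw (v @ w))) \<le> ln (C * (singular_value_fun s (Tw v) * singular_value_fun s (Tw w)))"
      unfolding word_map_append
    proof (rule iffD2[OF ln_le_cancel_iff])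
      show "0 < singular_value_fun s (Tw v \<circ> Tw w)"
        using pos[of "v @ w"] unfolding word_map_append .
      show "0 < C * (singular_value_fun s (Tw v) * singular_value_fun s (Tw w))"
        using C(1) pos[of v] pos[of w] by simp
      show "singular_value_fun s (Tw v \<circ> Tw w) \<le> C * (singular_value_fun s (Tw v) * singular_value_fun s (Tw w))"
        by (intro C(2) linear_word_map inj_word_map)
    qed
    also have "\<dots> = ln C + ln (singular_value_fun s (Tw v)) + ln (singular_value_fun s (Tw w))"
      using C pos[of v] pos[of w] by (simp add: ln_mult)
    finally show "log_ratio s (v @ w) \<le> log_ratio s v + log_ratio s w + \<bar>ln C\<bar>"
      using weight_pos[of v] weight_pos[of w] by (simp add: log_ratio_def ln_mult)
  qed simp
qed

lemma inverse_maps: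
  obtains G where "\<And>i. linear (G i)" "\<And>i. inj (G i)" "\<And>i. G i \<circ> T i = id" "\<And>i. T i \<circ> G i = id"
proof -
  have "\<exists>g. linear g \<and> inj g \<and> g \<circ> T i = id \<and> T i \<circ> g = id" for i
  proof -
    obtain g where g: "linear g" "g \<circ> T i = id"
      using linear_injective_left_inverse[OF lin bij_is_inj[OF bij]] by blast
    then have "g = inv (T i)" by (metis bij bij_is_surj surj_iff o_assoc o_id id_o)
    moreover from this have "inj g" by (metis bij bij_betw_inv_into bij_is_inj)
    ultimately show ?thesis using g bij[of i] by (metis bij_is_surj surj_iff)
  qed
  then show ?thesis using that by metis
qed

text \<open>Undoing the first map by its inverse costs a bounded factor by submultiplicativity, and
  the weight of the removed letter changes the logarithm in the favourable direction. This gives the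
  near invariance under the shift that the ergodic theorem asks for.\<close>

lemma log_ratio_tail:
  assumes "0 \<le> s"
  obtains c where "\<And>i w. log_ratio s w \<le> log_ratio s (i # w) + c"
proof -
  obtain C where C: "0 < C" "\<And>f g :: 'a \<Rightarrow> 'a. linear f \<Longrightarrow> inj f \<Longrightarrow> linear g \<Longrightarrow> inj g \<Longrightarrow>
    singular_value_fun s (f \<circ> g) \<le> C * (singular_value_fun s f * singular_value_fun s g)"
    using singular_value_fun_comp_le[OF assms] by metis
  obtain G where G: "\<And>i. linear (G i)" "\<And>i. inj (G i)" "\<And>i. G i \<circ> T i = id"
    using inverse_maps by metis
  define c where "c = ln C + Max (range (\<lambda>i. ln (singular_value_fun s (G i))))"
  show ?thesis
  proof (rule that[of c])
    fix i w
    note pos = svf_pos[OF assms]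
    have Gp: "0 < singular_value_fun s (G i)" by (rule singular_value_fun_pos[OF G(1,2) assms])
    have "Tw w = G i \<circ> Tw (i # w)" by (simp add: G(3) flip: o_assoc) (simp add: o_assoc G(3))
    then have "ln (singular_value_fun s (Tw w)) = ln (singular_value_fun s (G i \<circ> Tw (i # w)))" by simp
    also have "\<dots> \<le> ln (C * (singular_value_fun s (G i) * singular_value_fun s (Tw (i # w))))"
    proof (rule iffD2[OF ln_le_cancel_iff])
      show "0 < singular_value_fun s (G i \<circ> Tw (i # w))"
        by (intro singular_value_fun_pos linear_compose linear_word_map G inj_compose inj_word_map assms)
      show "0 < C * (singular_value_fun s (G i) * singular_value_fun s (Tw (i # w)))"
        using C(1) Gp pos[of "i # w"] by simp
      show "singular_value_fun s (G i \<circ> Tw (i # w)) \<le> C * (singular_value_fun s (G i) * singular_value_fun s (Tw (i # w)))"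
        by (intro C(2) linear_word_map G inj_word_map)
    qed
    also have "\<dots> = ln C + ln (singular_value_fun s (G i)) + ln (singular_value_fun s (Tw (i # w)))"
      using C Gp pos[of "i # w"] by (simp add: ln_mult del: word_map.simps)
    also have "ln (singular_value_fun s (G i)) \<le> Max (range (\<lambda>i. ln (singular_value_fun s (G i))))"
      by (rule Max_ge) auto
    finally have "ln (singular_value_fun s (Tw w)) \<le> c + ln (singular_value_fun s (Tw (i # w)))"
      unfolding c_def by linarith
    moreover have "ln (p i) \<le> 0" using p_pos[of i] p_lt_1[of i] by simp
    moreover have "ln (weight (i # w)) = ln (p i) + ln (weight w)"
      using weight_pos[of w] p_pos[of i] by (simp add: ln_mult)
    ultimately show "log_ratio s w \<le> log_ratio s (i # w) + c"
      unfolding log_ratio_def by linarith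
  qed
qed

section \<open>Growth rate and pressure\<close>

definition mean_log_ratio :: "real \<Rightarrow> nat \<Rightarrow> real" where
  "mean_log_ratio s k = (\<Sum>w | length w = k. weight w * log_ratio s w)"

lemma sum_weight: "(\<Sum>w | length w = k. weight w) = 1"
  using expectation_word_fun[of "\<lambda>_. 1" k] prob_space by simp

lemma mean_log_ratio_mono:
  assumes "\<And>w. length w = k \<Longrightarrow> log_ratio s w \<le> log_ratio t w + c"
  shows "mean_log_ratio s k \<le> mean_log_ratio t k + c"
proof -
  have "mean_log_ratio s k \<le> (\<Sum>w | length w = k. weight w * log_ratio t w + weight w * c)"
    unfolding mean_log_ratio_def
    by (intro sum_mono) (auto simp flip: distrib_left intro!: mult_left_mono assms less_imp_le[OF weight_pos])
  also have "\<dots> = mean_log_ratio t k + c"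
    by (simp add: mean_log_ratio_def sum.distrib sum_weight flip: sum_distrib_right)
  finally show ?thesis .
qed

text \<open>The summand \<open>c\<close> absorbs the constant in the submultiplicativity of the singular value function.\<close>

definition log_process :: "real \<Rightarrow> real \<Rightarrow> nat \<Rightarrow> (nat \<Rightarrow> 'm) \<Rightarrow> real" where
  "log_process s c k u = (if k = 0 then 0 else log_ratio s (map u [0..<k]) + c)"

lemma log_process_measurable [measurable]: "log_process s c k \<in> borel_measurable \<mu>"
  unfolding log_process_def by measurable

lemma expectation_log_process:
  assumes "0 < k"
  shows "expectation (log_process s c k) = mean_log_ratio s k + c"
proof -
  have "log_process s c k = (\<lambda>u. log_ratio s (map u [0..<k]) + c)"
    using assms by (auto simp: log_process_def)
  then have "expectation (log_process s c k) = (\<Sum>w | length w = k. weight w * (log_ratio s w + c))"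
    using expectation_word_fun[of "\<lambda>w. log_ratio s w + c" k] by simp
  also have "\<dots> = mean_log_ratio s k + c"
    by (simp add: mean_log_ratio_def distrib_left sum.distrib sum_weight flip: sum_distrib_right)
  finally show ?thesis .
qed

text \<open>This gathers what the two ergodic theorems require, with the rate \<gamma> supplied by
  Fekete's lemma for the expectations. The additive constant disappears after division by
  \<open>k\<close>, so the process and \<open>mean_log_ratio\<close> have the same rate.\<close>

lemma log_process_facts:
  assumes s: "0 \<le> s"
  obtains c M \<gamma> where "0 \<le> c"
    "\<And>k l u. log_process s c (k + l) u \<le> log_process s c k u + log_process s c l (shift k u)"
    "\<And>u. log_process s c 1 u \<le> M"
    "\<And>k. \<exists>b. \<forall>u. \<bar>log_process s c k u\<bar> \<le> b"
    "\<And>k u. log_process s c k (shift 1 u) \<le> log_process s c (Suc k) u + M"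
    "\<And>k. real k * \<gamma> \<le> expectation (log_process s c k)"
    "(\<lambda>k. mean_log_ratio s k / real k) \<longlonglongrightarrow> \<gamma>"
    "(\<lambda>k. expectation (log_process s c k) / real k) \<longlonglongrightarrow> \<gamma>"
proof -
  obtain c where c: "0 \<le> c" "\<And>v w. log_ratio s (v @ w) \<le> log_ratio s v + log_ratio s w + c"
    using log_ratio_append[OF s] by metis
  obtain c' where c': "\<And>i w. log_ratio s w \<le> log_ratio s (i # w) + c'"
    using log_ratio_tail[OF s] by metis
  obtain K where K: "0 \<le> K" "\<And>w. \<bar>log_ratio s w\<bar> \<le> real (length w) * K"
    using log_ratio_abs_le[OF s] by metis
  let ?g = "log_process s c"
  have sub: "?g (k + l) u \<le> ?g k u + ?g l (shift k u)" for k l u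
    using c(2)[of "map u [0..<k]" "map (shift k u) [0..<l]"]
    by (auto simp: log_process_def map_shift_append simp del: upt_Suc)
  have bdd: "\<bar>?g k u\<bar> \<le> real k * K + c" for k u
    using K(2)[of "map u [0..<k]"] c(1) by (auto simp: log_process_def)
  define M where "M = K + c + \<bar>c'\<bar>"
  have g1: "?g 1 u \<le> M" for u
    using abs_ge_self[of "?g 1 u"] bdd[of 1 u] abs_ge_zero[of c'] unfolding M_def by linarith
  have inv: "?g k (shift 1 u) \<le> ?g (Suc k) u + M" for k u
  proof (cases "k = 0")
    case True
    then have "?g k (shift 1 u) = 0" by (simp add: log_process_def)
    with True show ?thesis
      using abs_ge_minus_self[of "?g 1 u"] bdd[of 1 u] abs_ge_zero[of c'] by (simp add: M_def)
  next
    case False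
    have "map u [0..<Suc k] = u 0 # map (shift 1 u) [0..<k]"
      using map_shift_append[of u 1 k] by simp
    then show ?thesis using False c'[of "map (shift 1 u) [0..<k]" "u 0"] K(1) c(1)
      by (simp add: log_process_def M_def del: upt_Suc)
  qed
  have int: "integrable \<mu> (?g k)" for k
    by (rule integrable_const_bound[of _ "real k * K + c"]) (auto simp: bdd)
  define e where "e k = expectation (?g k)" for k
  have esub: "e (k + l) \<le> e k + e l" for k l
  proof -
    have i: "integrable \<mu> (\<lambda>u. ?g l (shift k u))"
      by (rule integrable_const_bound[of _ "real l * K + c"]) (auto simp: bdd)
    have "e (k + l) \<le> expectation (\<lambda>u. ?g k u + ?g l (shift k u))"
      unfolding e_def by (intro integral_mono int Bochner_Integration.integrable_add i sub)
    also have "\<dots> = e k + e l"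
      unfolding e_def by (simp add: int i expectation_shift)
    finally show ?thesis .
  qed
  have "- K * real k \<le> e k" for k
  proof (cases "k = 0")
    case True
    then show ?thesis by (simp add: e_def log_process_def[abs_def])
  next
    case False
    have "- K * real k \<le> ?g k u" for u
      using K(2)[of "map u [0..<k]"] c(1) False by (auto simp: log_process_def abs_le_iff mult.commute)
    then have "expectation (\<lambda>_. - K * real k) \<le> e k"
      unfolding e_def by (intro integral_mono int) auto
    then show ?thesis using prob_space[simplified] by simp
  qed
  then obtain \<gamma> where \<gamma>: "(\<lambda>k. e k / real k) \<longlonglongrightarrow> \<gamma>" "\<And>k. 0 < k \<Longrightarrow> real k * \<gamma> \<le> e k"
    using fekete[of e K] esub by metis
  have "(\<lambda>k. e k / real k - c / real k) \<longlonglongrightarrow> \<gamma> - 0"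
    by (intro tendsto_diff \<gamma>(1) lim_const_over_n)
  then have "(\<lambda>k. e k / real k - c / real k) \<longlonglongrightarrow> \<gamma>" by simp
  then have "(\<lambda>k. mean_log_ratio s k / real k) \<longlonglongrightarrow> \<gamma>"
  proof (rule Lim_transform_eventually)
    show "\<forall>\<^sub>F k in sequentially. e k / real k - c / real k = mean_log_ratio s k / real k"
      using eventually_gt_at_top[of 0]
      by eventually_elim (simp add: e_def expectation_log_process add_divide_distrib)
  qed
  moreover have "real k * \<gamma> \<le> expectation (?g k)" for k
    using \<gamma>(2)[of k] by (cases "k = 0") (auto simp: e_def log_process_def[abs_def])
  moreover have "\<exists>b. \<forall>u. \<bar>?g k u\<bar> \<le> b" for k using bdd by blast
  ultimately show ?thesis
    using \<gamma>(1) by (intro that[OF c(1) sub g1 _ inv]) (auto simp: e_def)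
qed

definition growth :: "real \<Rightarrow> real" where
  "growth s = lim (\<lambda>k. mean_log_ratio s k / real k)"

lemma growth_LIMSEQ: "0 \<le> s \<Longrightarrow> (\<lambda>k. mean_log_ratio s k / real k) \<longlonglongrightarrow> growth s"
  unfolding growth_def by (rule log_process_facts[of s]) (auto intro: convergentI simp flip: convergent_LIMSEQ_iff)

lemma pressure_one_eq:
  assumes "0 \<le> s"
  shows "pressure_one T p s = - growth s"
proof -
  have "(\<lambda>k. 1 / real k * (\<Sum>w | length w = k. measure \<mu> (cylinder w) *
      ln (inverse (singular_value_fun s (Tw w)) * measure \<mu> (cylinder w))))
    = (\<lambda>k. - (mean_log_ratio s k / real k))"
  proof
    fix k
    have "measure \<mu> (cylinder w) * ln (inverse (singular_value_fun s (Tw w)) * measure \<mu> (cylinder w))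
        = - (weight w * log_ratio s w)" for w
      using svf_pos[OF assms, of w] weight_pos[of w]
      by (simp add: measure_cylinder ln_mult ln_inverse log_ratio_def algebra_simps)
    then show "1 / real k * (\<Sum>w | length w = k. measure \<mu> (cylinder w) *
      ln (inverse (singular_value_fun s (Tw w)) * measure \<mu> (cylinder w))) = - (mean_log_ratio s k / real k)"
      by (simp add: mean_log_ratio_def sum_negf)
  qed
  then show ?thesis
    unfolding pressure_one_def using limI[OF tendsto_minus[OF growth_LIMSEQ[OF assms]]] by simp
qed

lemma growth_diff_bounds:
  obtains \<Lambda> where "0 < \<Lambda>" "\<And>s t. 0 \<le> s \<Longrightarrow> s \<le> t \<Longrightarrow> growth t \<le> growth s - (t - s) * ln 2"
    "\<And>s t. 0 \<le> s \<Longrightarrow> s \<le> t \<Longrightarrow> growth s - (t - s) * \<Lambda> \<le> growth t"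
proof -
  obtain \<Lambda> where L: "0 < \<Lambda>" "\<And>s t w. 0 \<le> s \<Longrightarrow> s \<le> t \<Longrightarrow>
    log_ratio t w \<le> log_ratio s w - real (length w) * (t - s) * ln 2"
    "\<And>s t w. 0 \<le> s \<Longrightarrow> s \<le> t \<Longrightarrow> log_ratio s w - real (length w) * (t - s) * \<Lambda> \<le> log_ratio t w"
    using log_ratio_diff_bounds by metis
  have *: "mean_log_ratio s k / real k \<le> mean_log_ratio t k / real k + d"
    if "0 < k" "mean_log_ratio s k \<le> mean_log_ratio t k + real k * d" for s t k d
    using divide_right_mono[OF that(2), of "real k"] that(1) by (simp add: add_divide_distrib)
  show ?thesis
  proof (rule that[of \<Lambda>])
    fix s t :: real assume st: "0 \<le> s" "s \<le> t"
    have "mean_log_ratio t k / real k \<le> mean_log_ratio s k / real k + - (t - s) * ln 2" if "0 < k" for k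
    proof (rule *[OF that], rule mean_log_ratio_mono)
      fix w :: "'m list" assume "length w = k"
      then show "log_ratio t w \<le> log_ratio s w + real k * (- (t - s) * ln 2)"
        using L(2)[OF st, of w] by (simp add: algebra_simps)
    qed
    then have "growth t \<le> growth s + - (t - s) * ln 2"
      using st by (intro LIMSEQ_le[OF growth_LIMSEQ tendsto_add[OF growth_LIMSEQ tendsto_const]])
         (auto intro!: exI[of _ 1])
    then show "growth t \<le> growth s - (t - s) * ln 2" by (simp add: algebra_simps)
    have "mean_log_ratio s k / real k \<le> mean_log_ratio t k / real k + (t - s) * \<Lambda>" if "0 < k" for k
    proof (rule *[OF that], rule mean_log_ratio_mono)
      fix w :: "'m list" assume "length w = k"
      then show "log_ratio s w \<le> log_ratio t w + real k * ((t - s) * \<Lambda>)"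
        using L(3)[OF st, of w] by (simp add: algebra_simps)
    qed
    then have "growth s \<le> growth t + (t - s) * \<Lambda>"
      using st by (intro LIMSEQ_le[OF growth_LIMSEQ tendsto_add[OF growth_LIMSEQ tendsto_const]])
         (auto intro!: exI[of _ 1])
    then show "growth s - (t - s) * \<Lambda> \<le> growth t" by (simp add: algebra_simps)
  qed (rule L(1))
qed

lemma growth_zero_pos: "0 < growth 0"
proof -
  obtain h H where h: "0 < h" "\<And>w. real (length w) * h \<le> log_ratio 0 w"
    "\<And>w. log_ratio 0 w \<le> real (length w) * H" using log_ratio_zero_bounds by metis
  have "h \<le> mean_log_ratio 0 k / real k" if "0 < k" for k
  proof -
    have "(\<Sum>w | length w = k. weight w * (real k * h)) \<le> mean_log_ratio 0 k"
      unfolding mean_log_ratio_def using h(2)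
      by (intro sum_mono mult_left_mono) (auto intro: less_imp_le[OF weight_pos])
    then have "real k * h \<le> mean_log_ratio 0 k" by (simp add: sum_weight flip: sum_distrib_right)
    then show ?thesis using that by (simp add: le_divide_eq mult.commute)
  qed
  then have "h \<le> growth 0"
    by (intro LIMSEQ_le_const[OF growth_LIMSEQ]) (auto intro!: exI[of _ 1])
  with h show ?thesis by simp
qed

text \<open>The growth rate is positive at 0, continuous, and falls with slope at most
  \<open>- ln 2\<close>, so it has exactly one zero. The description in \<open>d_one\<close>
  therefore picks this zero, and strict monotonicity gives the signs on both sides.\<close>

lemma d_one_props:
  shows "0 < d_one T p" "\<And>s. 0 \<le> s \<Longrightarrow> s < d_one T p \<Longrightarrow> 0 < growth s"
    "\<And>s. d_one T p < s \<Longrightarrow> growth s < 0"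
proof -
  obtain \<Lambda> where L: "0 < \<Lambda>" "\<And>s t. 0 \<le> s \<Longrightarrow> s \<le> t \<Longrightarrow> growth t \<le> growth s - (t - s) * ln 2"
    "\<And>s t. 0 \<le> s \<Longrightarrow> s \<le> t \<Longrightarrow> growth s - (t - s) * \<Lambda> \<le> growth t"
    using growth_diff_bounds by metis
  have strict: "growth t < growth s" if "0 \<le> s" "s < t" for s t
  proof -
    have "0 < (t - s) * ln 2" using that by (intro mult_pos_pos) auto
    with L(2)[of s t] that show ?thesis by linarith
  qed
  have lip: "\<bar>growth s - growth t\<bar> \<le> \<Lambda> * \<bar>s - t\<bar>" if "0 \<le> s" "0 \<le> t" for s t
  proof -
    have *: "\<bar>growth s - growth t\<bar> \<le> \<Lambda> * \<bar>s - t\<bar>" if "0 \<le> s" "s \<le> t" for s t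
    proof -
      have "0 \<le> (t - s) * ln 2" using that by simp
      then have "growth t \<le> growth s" using L(2)[OF that] by linarith
      then show ?thesis using L(3)[OF that] that by (simp add: mult.commute)
    qed
    show ?thesis using *[of s t] *[of t s] that by (cases "s \<le> t") (auto simp: abs_minus_commute)
  qed
  have cont: "continuous_on {0..} growth"
    unfolding continuous_on_iff
  proof (intro ballI allI impI)
    fix x e :: real assume x: "x \<in> {0..}" and e: "0 < e"
    show "\<exists>d>0. \<forall>x'\<in>{0..}. dist x' x < d \<longrightarrow> dist (growth x') (growth x) < e"
    proof (intro exI[of _ "e / \<Lambda>"] conjI ballI impI)
      fix y assume "y \<in> {0..}" "dist y x < e / \<Lambda>"
      then show "dist (growth y) (growth x) < e"
        using lip[of y x] x L(1) by (simp add: dist_real_def pos_less_divide_eq mult.commute)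
    qed (use e L in auto)
  qed
  \<comment> \<open>Falling at least with slope \<open>ln 2\<close>, the rate has used up
    \<open>growth 0\<close> by this point.\<close>
  define b where "b = growth 0 / ln 2"
  have b: "0 \<le> b" using growth_zero_pos by (simp add: b_def)
  have "growth b \<le> 0" using L(2)[of 0 b] b by (simp add: b_def)
  then have "\<exists>x\<ge>0. x \<le> b \<and> growth x = 0"
    using growth_zero_pos b by (intro IVT2') (auto intro: continuous_on_subset[OF cont])
  then obtain x where x: "0 \<le> x" "growth x = 0" by blast
  have uniq: "y = x" if "0 \<le> y" "growth y = 0" for y
    using strict[of x y] strict[of y x] x that by linarith
  have dx: "d_one T p = x"
    unfolding d_one_def
  proof (rule the_equality)
    show "0 \<le> x \<and> pressure_one T p x = 0" using x pressure_one_eq[of x] by simp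
    fix y assume "0 \<le> y \<and> pressure_one T p y = 0"
    then show "y = x" using pressure_one_eq[of y] by (intro uniq) auto
  qed
  show "0 < d_one T p" using x growth_zero_pos unfolding dx by (cases "x = 0") auto
  show "0 < growth s" if "0 \<le> s" "s < d_one T p" for s
    using strict[of s x] that x dx by simp
  show "growth s < 0" if "d_one T p < s" for s
    using strict[of x s] that x dx by simp
qed

text \<open>The terms are \<open>exp (- log_ratio)\<close>. Below \<open>d\<^sub>1\<close> the rate
  \<gamma> is positive, and eventual growth at rate \<open>\<gamma> / 2\<close> allows comparison
  with a geometric series.\<close>

lemma AE_summable_weight_over_svf:
  assumes "0 \<le> s" "s < d_one T p"
  shows "AE u in \<mu>. summable (\<lambda>k. weight (map u [0..<k]) / singular_value_fun s (Tw (map u [0..<k])))"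
proof (rule log_process_facts[OF assms(1)])
  fix c M \<gamma> assume f: "0 \<le> c"
    "\<And>k l u. log_process s c (k + l) u \<le> log_process s c k u + log_process s c l (shift k u)"
    "\<And>u. log_process s c 1 u \<le> M"
    "\<And>k. \<exists>b. \<forall>u. \<bar>log_process s c k u\<bar> \<le> b"
    "\<And>k u. log_process s c k (shift 1 u) \<le> log_process s c (Suc k) u + M"
    "\<And>k. real k * \<gamma> \<le> expectation (log_process s c k)"
    "(\<lambda>k. mean_log_ratio s k / real k) \<longlonglongrightarrow> \<gamma>"
    "(\<lambda>k. expectation (log_process s c k) / real k) \<longlonglongrightarrow> \<gamma>"
  have "\<gamma> = growth s" using LIMSEQ_unique[OF f(7) growth_LIMSEQ[OF assms(1)]] .
  then have g: "0 < \<gamma>" using d_one_props(2)[OF assms] by simp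
  have "AE u in \<mu>. \<forall>\<^sub>F k in sequentially. log_process s c k u \<ge> real k * (\<gamma> / 2)"
    by (rule subadditive_liminf_ge[OF log_process_measurable f(2) _ f(3,4,5,6)])
       (use g in \<open>auto simp: log_process_def\<close>)
  then show ?thesis
  proof (rule AE_mp, intro AE_I2 impI)
    fix u assume ev: "\<forall>\<^sub>F k in sequentially. log_process s c k u \<ge> real k * (\<gamma> / 2)"
    have sm: "summable (\<lambda>k. exp c * exp (- \<gamma> / 2) ^ k)"
      using g by (intro summable_mult summable_geometric) simp
    show "summable (\<lambda>k. weight (map u [0..<k]) / singular_value_fun s (Tw (map u [0..<k])))"
    proof (rule summable_comparison_test_ev[OF _ sm])
      show "\<forall>\<^sub>F k in sequentially. norm (weight (map u [0..<k]) / singular_value_fun s (Tw (map u [0..<k])))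
          \<le> exp c * exp (- \<gamma> / 2) ^ k"
        using ev eventually_gt_at_top[of 0]
      proof eventually_elim
        case (elim k)
        let ?w = "map u [0..<k]"
        have "weight ?w / singular_value_fun s (Tw ?w) = exp (- log_ratio s ?w)"
          using weight_pos[of ?w] svf_pos[OF assms(1), of ?w] by (simp add: log_ratio_def exp_diff)
        also have "\<dots> \<le> exp (c - real k * (\<gamma> / 2))" using elim by (simp add: log_process_def)
        also have "c - real k * (\<gamma> / 2) = c + real k * (- \<gamma> / 2)" by simp
        also have "exp \<dots> = exp c * exp (- \<gamma> / 2) ^ k"
          by (simp only: exp_add exp_of_nat_mult)
        finally show ?case using weight_pos[of ?w] svf_pos[OF assms(1), of ?w] by simp
      qed
    qed
  qed
qed

text \<open>The exponential gain is half of the negative growth rate. It will pay for the summable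
  thresholds by which balls of small measure are discarded.\<close>

lemma AE_svf_le_weight:
  assumes "d_one T p < s"
  obtains e where "0 < e"
    "AE u in \<mu>. \<forall>\<^sub>F k in sequentially.
       singular_value_fun s (Tw (map u [0..<k])) \<le> exp (- real k * e) * weight (map u [0..<k])"
proof -
  have s: "0 \<le> s" using assms d_one_props(1) by simp
  show thesis
  proof (rule log_process_facts[OF s])
    fix c M \<gamma> assume f: "0 \<le> c"
      "\<And>k l u. log_process s c (k + l) u \<le> log_process s c k u + log_process s c l (shift k u)"
      "\<And>u. log_process s c 1 u \<le> M"
      "\<And>k. \<exists>b. \<forall>u. \<bar>log_process s c k u\<bar> \<le> b"
      "\<And>k u. log_process s c k (shift 1 u) \<le> log_process s c (Suc k) u + M"
      "\<And>k. real k * \<gamma> \<le> expectation (log_process s c k)"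
      "(\<lambda>k. mean_log_ratio s k / real k) \<longlonglongrightarrow> \<gamma>"
      "(\<lambda>k. expectation (log_process s c k) / real k) \<longlonglongrightarrow> \<gamma>"
    have "\<gamma> = growth s" using LIMSEQ_unique[OF f(7) growth_LIMSEQ[OF s]] .
    then have g: "\<gamma> < 0" using d_one_props(3)[OF assms] by simp
    then have "\<forall>\<^sub>F k in sequentially. expectation (log_process s c k) / real k < \<gamma> / 2"
      by (intro order_tendstoD(2)[OF f(8)]) simp
    from eventually_happens'[OF sequentially_bot eventually_conj[OF eventually_gt_at_top[of 0] this]]
    obtain n where n: "0 < n" "expectation (log_process s c n) / real n < \<gamma> / 2"
      by blast
    have "AE u in \<mu>. \<forall>\<^sub>F k in sequentially. log_process s c k u \<le> real k * (\<gamma> / 2)"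
      by (rule subadditive_limsup_le[OF log_process_measurable f(2,4) n(1)])
         (use n in \<open>simp add: divide_less_eq mult.commute\<close>)
    then have "AE u in \<mu>. \<forall>\<^sub>F k in sequentially.
         singular_value_fun s (Tw (map u [0..<k])) \<le> exp (- real k * (- \<gamma> / 2)) * weight (map u [0..<k])"
    proof (rule AE_mp, intro AE_I2 impI)
      fix u assume ev: "\<forall>\<^sub>F k in sequentially. log_process s c k u \<le> real k * (\<gamma> / 2)"
      show "\<forall>\<^sub>F k in sequentially.
         singular_value_fun s (Tw (map u [0..<k])) \<le> exp (- real k * (- \<gamma> / 2)) * weight (map u [0..<k])"
        using ev eventually_gt_at_top[of 0]
      proof eventually_elim
        case (elim k)
        let ?w = "map u [0..<k]"
        have "singular_value_fun s (Tw ?w) = exp (log_ratio s ?w) * weight ?w"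
          using weight_pos[of ?w] svf_pos[OF s, of ?w] by (simp add: log_ratio_def exp_diff)
        also have "\<dots> \<le> exp (real k * (\<gamma> / 2)) * weight ?w"
          using elim f(1) weight_pos[of ?w] by (intro mult_right_mono) (auto simp: log_process_def)
        finally show ?case by simp
      qed
    qed
    then show thesis using g that[of "- \<gamma> / 2"] by simp
  qed
qed

end

section \<open>Transversality\<close>

text \<open>Counting cells of side \<open>\<epsilon>\<close> in the coordinates \<open>h j\<close> replaces a linear change of variables.\<close>

lemma emeasure_le_prod_of_coordinates:
  fixes S :: "'x::euclidean_space set" and h :: "'j \<Rightarrow> 'x \<Rightarrow> real"
  assumes J: "finite J" "card J = DIM('x)"
    and v: "\<And>j. j \<in> J \<Longrightarrow> 0 < v j"
    and h: "\<And>j x. j \<in> J \<Longrightarrow> x \<in> S \<Longrightarrow> \<bar>h j x\<bar> \<le> v j"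
    and K: "0 < K" "\<And>x y. x \<in> S \<Longrightarrow> y \<in> S \<Longrightarrow> norm (x - y) \<le> K * (\<Sum>j\<in>J. \<bar>h j x - h j y\<bar>)"
  shows "emeasure lborel S \<le> ennreal ((10 * K * real DIM('x)) ^ DIM('x) * (\<Prod>j\<in>J. v j))"
proof -
  let ?d = "DIM('x)"
  have Jne: "J \<noteq> {}" using J by auto
  \<comment> \<open>With the smallest extent as side, every ratio \<open>v j / \<epsilon>\<close> is
    at least 1, so rounding costs only a factor: at most \<open>5 * v j / \<epsilon>\<close> cells
    per coordinate.\<close>
  define \<epsilon> where "\<epsilon> = Min (v ` J)"
  have eps: "0 < \<epsilon>" "\<And>j. j \<in> J \<Longrightarrow> \<epsilon> \<le> v j"
    using J Jne v by (auto simp: \<epsilon>_def)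
  define N where "N j = \<lceil>v j / \<epsilon>\<rceil>" for j
  have N1: "1 \<le> v j / \<epsilon>" if "j \<in> J" for j using eps that by simp
  define Q where "Q = PiE J (\<lambda>j. {- N j..N j})"
  define cell where "cell x = restrict (\<lambda>j. \<lfloor>h j x / \<epsilon>\<rfloor>) J" for x
  define A where "A q = {x \<in> S. cell x = q}" for q
  define \<rho> where "\<rho> = K * (real ?d * \<epsilon>)"
  have rho: "0 < \<rho>" using K(1) eps by (simp add: \<rho>_def)
  define c where "c q = (SOME x. x \<in> A q)" for q
  have finQ: "finite Q" unfolding Q_def using J by (intro finite_PiE) auto
  have card_Q: "real (card Q) \<le> (\<Prod>j\<in>J. 5 * (v j / \<epsilon>))"
  proof -
    have "card Q = (\<Prod>j\<in>J. card {- N j..N j})"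
      unfolding Q_def by (rule card_PiE[OF J(1)])
    then have "real (card Q) = (\<Prod>j\<in>J. real (card {- N j..N j}))" by simp
    also have "\<dots> \<le> (\<Prod>j\<in>J. 5 * (v j / \<epsilon>))"
    proof (intro prod_mono conjI)
      fix j assume j: "j \<in> J"
      have "0 \<le> N j" using N1[OF j] unfolding N_def by linarith
      then have "real (card {- N j..N j}) = 2 * of_int (N j) + 1" by simp
      also have "\<dots> \<le> 5 * (v j / \<epsilon>)"
        using N1[OF j] ceiling_correct[of "v j / \<epsilon>"] unfolding N_def by linarith
      finally show "real (card {- N j..N j}) \<le> 5 * (v j / \<epsilon>)" .
    qed simp
    finally show ?thesis .
  qed
  have cell_Q: "cell x \<in> Q" if x: "x \<in> S" for x
    unfolding Q_def cell_def
  proof (rule restrict_PiE_iff[THEN iffD2], rule ballI)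
    fix j assume j: "j \<in> J"
    have "\<bar>h j x / \<epsilon>\<bar> \<le> v j / \<epsilon>"
      using h[OF j x] eps by (simp add: abs_divide divide_right_mono)
    then show "\<lfloor>h j x / \<epsilon>\<rfloor> \<in> {- N j..N j}"
      unfolding N_def atLeastAtMost_iff by (intro conjI) linarith+
  qed
  have cover: "S \<subseteq> (\<Union>q\<in>Q. cbox (c q - \<rho> *\<^sub>R One) (c q + \<rho> *\<^sub>R One))"
  proof
    fix x assume x: "x \<in> S"
    define q where "q = cell x"
    have "x \<in> A q" using x by (simp add: A_def q_def)
    then have y: "c q \<in> A q" unfolding c_def by (rule someI)
    have "\<bar>h j x - h j (c q)\<bar> \<le> \<epsilon>" if j: "j \<in> J" for j
    proof -
      have "cell x j = cell (c q) j" using y by (simp add: A_def q_def)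
      then have "\<lfloor>h j x / \<epsilon>\<rfloor> = \<lfloor>h j (c q) / \<epsilon>\<rfloor>" using j by (simp add: cell_def)
      then have "\<bar>h j x / \<epsilon> - h j (c q) / \<epsilon>\<bar> \<le> 1" by linarith
      then have "\<bar>(h j x - h j (c q)) / \<epsilon>\<bar> \<le> 1" by (simp add: diff_divide_distrib)
      then show ?thesis using eps by (simp add: abs_divide)
    qed
    then have "(\<Sum>j\<in>J. \<bar>h j x - h j (c q)\<bar>) \<le> (\<Sum>j\<in>J. \<epsilon>)" by (rule sum_mono)
    then have "K * (\<Sum>j\<in>J. \<bar>h j x - h j (c q)\<bar>) \<le> \<rho>"
      unfolding \<rho>_def using K(1) J(2) by (intro mult_left_mono) auto
    moreover have "c q \<in> S" using y by (simp add: A_def)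
    ultimately have "norm (x - c q) \<le> \<rho>" using K(2)[OF x, of "c q"] by simp
    then have "\<bar>(x - c q) \<bullet> b\<bar> \<le> \<rho>" if "b \<in> Basis" for b
      using Basis_le_norm[OF that, of "x - c q"] by linarith
    then have "x \<in> cbox (c q - \<rho> *\<^sub>R One) (c q + \<rho> *\<^sub>R One)"
      by (auto simp: mem_box inner_diff_left inner_add_left abs_le_iff) (force simp: algebra_simps)+
    moreover have "q \<in> Q" unfolding q_def by (rule cell_Q[OF x])
    ultimately show "x \<in> (\<Union>q\<in>Q. cbox (c q - \<rho> *\<^sub>R One) (c q + \<rho> *\<^sub>R One))" by blast
  qed
  have box: "emeasure lborel (cbox (z - \<rho> *\<^sub>R One) (z + \<rho> *\<^sub>R One)) = ennreal ((2 * \<rho>) ^ ?d)" for z :: 'x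
    using rho by (subst emeasure_lborel_cbox) (auto simp: inner_diff_left inner_add_left prod_ennreal)
  have "emeasure lborel S \<le> emeasure lborel (\<Union>q\<in>Q. cbox (c q - \<rho> *\<^sub>R One) (c q + \<rho> *\<^sub>R One))"
    by (rule emeasure_mono[OF cover]) (use finQ in auto)
  also have "\<dots> \<le> (\<Sum>q\<in>Q. emeasure lborel (cbox (c q - \<rho> *\<^sub>R One) (c q + \<rho> *\<^sub>R One)))"
    by (rule emeasure_subadditive_finite[OF finQ]) auto
  also have "\<dots> = ennreal (real (card Q) * (2 * \<rho>) ^ ?d)"
    unfolding box using rho by (simp add: ennreal_mult ennreal_of_nat_eq_real_of_nat)
  also have "\<dots> \<le> ennreal ((\<Prod>j\<in>J. 5 * (v j / \<epsilon>)) * (2 * \<rho>) ^ ?d)"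
    using rho by (intro ennreal_leI mult_right_mono card_Q) simp
  \<comment> \<open>The side \<epsilon> cancels. The 10 is the 5 of the cell count times the 2 from
    the side \<open>2 * \<rho>\<close> of the boxes.\<close>
  also have "(\<Prod>j\<in>J. 5 * (v j / \<epsilon>)) * (2 * \<rho>) ^ ?d = (10 * K * real ?d) ^ ?d * (\<Prod>j\<in>J. v j)"
  proof -
    have 1: "(\<Prod>j\<in>J. 5 * (v j / \<epsilon>)) = 5 ^ ?d * ((\<Prod>j\<in>J. v j) / \<epsilon> ^ ?d)"
      by (simp add: prod.distrib prod_dividef J(2))
    have 2: "(2 * \<rho>) ^ ?d = (2 * K * real ?d) ^ ?d * \<epsilon> ^ ?d"
      by (simp add: \<rho>_def power_mult_distrib)
    have "5 ^ ?d * ((\<Prod>j\<in>J. v j) / \<epsilon> ^ ?d) * ((2 * K * real ?d) ^ ?d * \<epsilon> ^ ?d)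
        = (5 ^ ?d * (2 * K * real ?d) ^ ?d) * (\<Prod>j\<in>J. v j)"
      using eps(1) by simp
    also have "5 ^ ?d * (2 * K * real ?d) ^ ?d = (10 * K * real ?d) ^ ?d"
      by (subst power_mult_distrib[symmetric]) (simp add: mult.assoc)
    finally show ?thesis unfolding 1 2 .
  qed
  finally show ?thesis .
qed

section \<open>Dependence of the projection on the translations\<close>

context self_affine_system
begin

text \<open>The maximum over finitely many letters turns the separate strict bounds into one ratio
  below 1/2, which is what makes \<open>\<rho> / (1 - \<rho>)\<close> smaller than 1.\<close>

lemma contraction_ratio:
  obtains \<rho> where "0 \<le> \<rho>" "\<rho> < 1/2" "\<And>w x. norm (Tw w x) \<le> \<rho> ^ length w * norm x"
proof -
  define \<rho> where "\<rho> = Max (range (\<lambda>i. onorm (T i)))"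
  have bl: "bounded_linear (T i)" for i using lin linear_conv_bounded_linear by blast
  have "\<rho> \<in> range (\<lambda>i. onorm (T i))" unfolding \<rho>_def by (rule Max_in) auto
  then obtain i where "\<rho> = onorm (T i)" by blast
  then have "\<rho> < 1/2" using onorm_lt[of i] by simp
  moreover have "onorm (T i) \<le> \<rho>" for i unfolding \<rho>_def by (rule Max_ge) auto
  ultimately have r: "\<rho> < 1/2" "\<And>i. onorm (T i) \<le> \<rho>" by auto
  have r0: "0 \<le> \<rho>" using r(2) onorm_pos_le[OF bl] order_trans by blast
  have "norm (Tw w x) \<le> \<rho> ^ length w * norm x" for w x
  proof (induction w)
    case (Cons i w)
    have "norm (Tw (i # w) x) \<le> onorm (T i) * norm (Tw w x)" using onorm[OF bl] by simp
    also have "\<dots> \<le> \<rho> * (\<rho> ^ length w * norm x)" by (intro mult_mono r Cons r0) auto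
    finally show ?case by simp
  qed simp
  with r r0 show ?thesis using that by blast
qed

text \<open>By linearity the effect of moving one translation vector is the projection of an
  \<open>axis\<close> vector, whatever the other translations are.\<close>

lemma linear_code_proj: "linear (\<lambda>\<omega>. code_proj T \<omega> u)"
proof (rule linearI)
  fix \<omega> \<omega>' :: "'a ^ 'm" and r :: real
  show "code_proj T (\<omega> + \<omega>') u = code_proj T \<omega> u + code_proj T \<omega>' u"
    unfolding code_proj_def suminf_add[OF summable_code_proj summable_code_proj]
    by (simp add: linear_add[OF linear_word_map])
  show "code_proj T (r *\<^sub>R \<omega>) u = r *\<^sub>R code_proj T \<omega> u"
    unfolding code_proj_def
    by (simp add: linear_scale[OF linear_word_map] suminf_scaleR_right[OF summable_code_proj])
qed

lemma code_proj_append: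
  assumes "u \<in> cylinder w" "v \<in> cylinder w"
  shows "code_proj T \<omega> u - code_proj T \<omega> v =
    Tw w (code_proj T \<omega> (shift (length w) u) - code_proj T \<omega> (shift (length w) v))"
  using assms
proof (induction w arbitrary: u v)
  case (Cons i w)
  have 0: "u 0 = i" "v 0 = i" using Cons.prems by (auto simp: cylinder_altdef)
  have "shift 1 u \<in> cylinder w" "shift 1 v \<in> cylinder w"
    using Cons.prems by (auto simp: cylinder_altdef)
  from Cons.IH[OF this]
  have "Tw (i # w) (code_proj T \<omega> (shift (length (i # w)) u) - code_proj T \<omega> (shift (length (i # w)) v))
      = T i (code_proj T \<omega> (shift 1 u) - code_proj T \<omega> (shift 1 v))"
    by simp
  also have "\<dots> = code_proj T \<omega> u - code_proj T \<omega> v"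
    using code_proj_shift[of \<omega> u] code_proj_shift[of \<omega> v]
    by (simp add: affine_map_def 0 linear_diff[OF lin])
  finally show ?case ..
qed simp

text \<open>Moving the translation of the letter \<open>a\<close> by \<open>z\<close> contributes
  \<open>z\<close> itself if \<open>a\<close> is the first letter, and at most
  \<open>\<rho> ^ k * norm z\<close> for an occurrence of \<open>a\<close> at a later position
  \<open>k\<close>.\<close>

lemma norm_code_proj_axis_le:
  assumes \<rho>: "0 \<le> \<rho>" "\<rho> < 1/2" "\<And>w x. norm (Tw w x) \<le> \<rho> ^ length w * norm x"
  shows "norm (code_proj T (axis a z) u - (if u 0 = a then z else 0))
    \<le> (\<Sum>k. \<rho> ^ Suc k * of_bool (u (Suc k) = a)) * norm z"
proof -
  let ?f = "\<lambda>k. Tw (map u [0..<k]) (axis a z $ u k)"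
  have ax: "axis a z $ c = (if c = a then z else 0)" for c by (auto simp: axis_def)
  have sm: "summable (\<lambda>k. \<rho> ^ Suc k * of_bool (u (Suc k) = a) :: real)"
  proof (rule summable_comparison_test')
    show "summable (\<lambda>k. \<rho> * \<rho> ^ k)" using \<rho>(1,2) by (intro summable_mult summable_geometric) simp
  qed (use \<rho>(1) in auto)
  have "code_proj T (axis a z) u - (if u 0 = a then z else 0) = (\<Sum>k. ?f (Suc k))"
    unfolding code_proj_def using suminf_split_head[OF summable_code_proj[where \<omega> = "axis a z" and u = u]] by (simp add: ax)
  also have "norm \<dots> \<le> (\<Sum>k. \<rho> ^ Suc k * of_bool (u (Suc k) = a) * norm z)"
  proof (rule norm_suminf_le)
    show "norm (?f (Suc k)) \<le> \<rho> ^ Suc k * of_bool (u (Suc k) = a) * norm z" for k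
      using \<rho>(3)[of "map u [0..<Suc k]" z] linear_0[OF linear_word_map] by (auto simp: ax simp del: upt_Suc)
    show "summable (\<lambda>k. \<rho> ^ Suc k * of_bool (u (Suc k) = a) * norm z)"
      by (rule summable_mult2[OF sm])
  qed
  also have "\<dots> = (\<Sum>k. \<rho> ^ Suc k * of_bool (u (Suc k) = a)) * norm z"
    by (rule suminf_mult2[OF sm, symmetric])
  finally show ?thesis .
qed

text \<open>Each letter beyond the first contributes to the perturbation in at most one of the two
  directions \<open>u 0\<close> and \<open>v 0\<close>, so in one of them the total is at most \<open>\<rho> / (1 - \<rho>)\<close>.
  This is where the bound \<open>1/2\<close> is used.\<close>

lemma code_proj_diff_axis:
  assumes ne: "u 0 \<noteq> v 0"
    and \<rho>: "0 \<le> \<rho>" "\<rho> < 1/2" "\<And>w x. norm (Tw w x) \<le> \<rho> ^ length w * norm x"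
  shows "(\<forall>z. norm (code_proj T (axis (u 0) z) u - code_proj T (axis (u 0) z) v - z) \<le> \<rho> / (1 - \<rho>) * norm z) \<or>
    (\<forall>z. norm (code_proj T (axis (v 0) z) v - code_proj T (axis (v 0) z) u - z) \<le> \<rho> / (1 - \<rho>) * norm z)"
proof -
  define s where "s u a = (\<Sum>k. \<rho> ^ Suc k * of_bool (u (Suc k) = a) :: real)" for u and a :: 'm
  have geo: "(\<lambda>k. \<rho> ^ Suc k) sums (\<rho> / (1 - \<rho>))"
    using sums_mult[OF geometric_sums[of \<rho>], of \<rho>] \<rho>(1,2) by simp
  have sm: "summable (\<lambda>k. \<rho> ^ Suc k * of_bool (u (Suc k) = a) :: real)" for u and a :: 'm
    by (rule summable_comparison_test'[OF sums_summable[OF geo]]) (use \<rho>(1) in auto)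
  have two: "s u a + s u b \<le> \<rho> / (1 - \<rho>)" if "a \<noteq> b" for u a b
  proof -
    have "s u a + s u b = (\<Sum>k. \<rho> ^ Suc k * of_bool (u (Suc k) = a) + \<rho> ^ Suc k * of_bool (u (Suc k) = b))"
      unfolding s_def by (rule suminf_add[OF sm sm])
    also have "\<dots> \<le> (\<Sum>k. \<rho> ^ Suc k)"
      by (rule suminf_le[OF _ summable_add[OF sm sm] sums_summable[OF geo]]) (use \<rho>(1) that in auto)
    finally show ?thesis using sums_unique[OF geo] by simp
  qed
  have bound: "norm (code_proj T (axis (u 0) z) u - code_proj T (axis (u 0) z) v - z)
      \<le> (s u (u 0) + s v (u 0)) * norm z" if "u 0 \<noteq> v 0" for u v z
  proof -
    have "norm ((code_proj T (axis (u 0) z) u - z) - code_proj T (axis (u 0) z) v)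
        \<le> norm (code_proj T (axis (u 0) z) u - z) + norm (code_proj T (axis (u 0) z) v)"
      by (rule norm_triangle_ineq4)
    also have "\<dots> \<le> s u (u 0) * norm z + s v (u 0) * norm z"
      using norm_code_proj_axis_le[OF \<rho>, of "u 0" z u] norm_code_proj_axis_le[OF \<rho>, of "u 0" z v] that
      by (intro add_mono) (auto simp: s_def)
    finally show ?thesis by (simp add: algebra_simps)
  qed
  have "s u (u 0) + s v (u 0) \<le> \<rho> / (1 - \<rho>) \<or> s v (v 0) + s u (v 0) \<le> \<rho> / (1 - \<rho>)"
    using two[OF ne, of u] two[OF ne, of v] by linarith
  then show ?thesis
  proof
    assume "s u (u 0) + s v (u 0) \<le> \<rho> / (1 - \<rho>)"
    then show ?thesis
      by (intro disjI1 allI order_trans[OF bound[of u v, OF ne] mult_right_mono]) auto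
  next
    assume "s v (v 0) + s u (v 0) \<le> \<rho> / (1 - \<rho>)"
    then show ?thesis
      by (intro disjI2 allI order_trans[OF bound[of v u, OF ne[symmetric]] mult_right_mono]) auto
  qed
qed

text \<open>In the translation of the letter \<open>a\<close> after the common prefix, the
  difference \<open>L\<close> of the shifted projections is the identity up to an error of factor
  \<eta> < 1, so the coordinates of \<open>L \<omega>\<close> can replace those of this translation.
  In a singular basis of \<open>T\<^sub>w\<close> the condition confines each of them to
  \<open>r / norm (T\<^sub>w b)\<close>; the trivial bound serves for short axes. The product of
  these extents is the reciprocal of \<open>ellipsoid_count\<close>, up to constants.\<close>

lemma transversality_one_sided:
  fixes R \<eta> :: real
  assumes R: "0 < R" and \<eta>: "\<eta> < 1"
  obtains C where "0 \<le> C"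
    "\<And>w u v r. u \<in> cylinder w \<Longrightarrow> v \<in> cylinder w \<Longrightarrow> 0 < r \<Longrightarrow>
      (\<And>z. norm (code_proj T (axis (u (length w)) z) (shift (length w) u)
         - code_proj T (axis (u (length w)) z) (shift (length w) v) - z) \<le> \<eta> * norm z) \<Longrightarrow>
      emeasure lborel {\<omega> \<in> cball 0 R. dist (code_proj T \<omega> u) (code_proj T \<omega> v) \<le> r}
        \<le> ennreal (C / ellipsoid_count (Tw w) r)"
proof -
  let ?d = "DIM('a)" and ?m = "real CARD('m)"
  let ?A = "max 1 (4 * ?m * R)"
  \<comment> \<open>The 5 is 1 for \<open>L \<delta>\<close> plus 4 for the influence of the other
    translations on \<open>L\<close>; division by \<open>1 - \<eta>\<close> inverts the perturbed
    identity. The summand 1 accounts for the other translations themselves.\<close>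
  define K where "K = 1 + 5 / (1 - \<eta>)"
  have K: "0 < K" using \<eta> by (simp add: K_def add_pos_pos)
  define C0 where "C0 = (10 * K * real DIM('a ^ 'm)) ^ DIM('a ^ 'm)"
  define C where "C = C0 * (?A ^ ?d * (R ^ ?d) ^ (CARD('m) - 1))"
  have C0: "0 \<le> C0" using K by (simp add: C0_def)
  show ?thesis
  proof (rule that[of C])
    show "0 \<le> C" using C0 R by (simp add: C_def)
    fix w and u v :: "nat \<Rightarrow> 'm" and r :: real
    assume uv: "u \<in> cylinder w" "v \<in> cylinder w" and r: "0 < r"
      and ax: "\<And>z. norm (code_proj T (axis (u (length w)) z) (shift (length w) u)
         - code_proj T (axis (u (length w)) z) (shift (length w) v) - z) \<le> \<eta> * norm z"
    define a where "a = u (length w)"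
    define L where "L \<omega> = code_proj T \<omega> (shift (length w) u) - code_proj T \<omega> (shift (length w) v)" for \<omega>
    have linL: "linear L" unfolding L_def by (intro linear_compose_sub linear_code_proj)
    \<comment> \<open>Each of the two projections is bounded by twice the sum of the norms of the
      translations.\<close>
    have L_le: "norm (L \<omega>) \<le> 4 * (\<Sum>c\<in>UNIV. norm (\<omega> $ c))" for \<omega>
      unfolding L_def using norm_code_proj_le[of \<omega>] norm_triangle_ineq4
      unfolding W_def by (smt (verit, best))
    define S where "S = {\<omega> \<in> cball 0 R. dist (code_proj T \<omega> u) (code_proj T \<omega> v) \<le> r}"
    have S: "norm \<omega> \<le> R" "norm (Tw w (L \<omega>)) \<le> r" if "\<omega> \<in> S" for \<omega>
      using that code_proj_append[OF uv, of \<omega>] by (auto simp: S_def dist_norm L_def)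
    obtain B where B: "singular_basis (Tw w) B" using singular_basis_exists[OF linear_word_map] by blast
    note props = singular_basis_props[OF linear_word_map B]
    have pos: "0 < norm (Tw w b)" if "b \<in> B" for b
      using props(3)[OF that] inj_word_map linear_word_map linear_injective_0 by fastforce
    define J where "J = (SIGMA c:UNIV. if c = a then B else Basis)"
    \<comment> \<open>The block of \<open>a\<close> is described by \<open>L \<omega>\<close> in the
      singular basis, all other blocks by their standard coordinates.\<close>
    define h where "h = (\<lambda>(c, b) \<omega>. if c = a then L \<omega> \<bullet> b else \<omega> $ c \<bullet> b)"
    define V where "V = (\<lambda>(c, b). if c = a then min (r / norm (Tw w b)) (4 * ?m * R) else R)"
    have W_le: "(\<Sum>c\<in>UNIV. norm (\<omega> $ c)) \<le> ?m * R" if "norm \<omega> \<le> R" for \<omega> :: "'a ^ 'm"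
    proof -
      have "norm (\<omega> $ c) \<le> R" for c using order_trans[OF Finite_Cartesian_Product.norm_nth_le[where x = \<omega> and i = c] that] .
      then have "(\<Sum>c\<in>UNIV. norm (\<omega> $ c)) \<le> (\<Sum>c\<in>(UNIV :: 'm set). R)" by (intro sum_mono)
      then show ?thesis by simp
    qed
    have "emeasure lborel S \<le> ennreal ((10 * K * real DIM('a ^ 'm)) ^ DIM('a ^ 'm) * (\<Prod>j\<in>J. V j))"
    proof (rule emeasure_le_prod_of_coordinates[where h = h])
      show "finite J" unfolding J_def using props(1) by (intro finite_SigmaI) auto
      show "card J = DIM('a ^ 'm)"
        unfolding J_def using props(1)
        by (subst card_SigmaI) (auto simp: card_singular_basis[OF linear_word_map B] if_distrib[of card] cong: if_cong)
      show "0 < V j" if "j \<in> J" for j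
        using that pos R r by (auto simp: J_def V_def split: if_splits)
      show "\<bar>h j \<omega>\<bar> \<le> V j" if j: "j \<in> J" and \<omega>: "\<omega> \<in> S" for j \<omega>
      proof -
        obtain c b where cb: "j = (c, b)" by (cases j)
        show ?thesis
        proof (cases "c = a")
          case True
          then have b: "b \<in> B" using j cb by (simp add: J_def)
          have "(norm (Tw w b))\<^sup>2 * \<bar>L \<omega> \<bullet> b\<bar> = \<bar>Tw w (L \<omega>) \<bullet> Tw w b\<bar>"
            by (simp add: inner_image_singular_basis[OF linear_word_map B b] abs_mult)
          also have "\<dots> \<le> norm (Tw w (L \<omega>)) * norm (Tw w b)" by (rule Cauchy_Schwarz_ineq2)
          also have "\<dots> \<le> r * norm (Tw w b)" by (intro mult_right_mono S \<omega>) simp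
          finally have 1: "\<bar>L \<omega> \<bullet> b\<bar> \<le> r / norm (Tw w b)"
            using pos[OF b] by (simp add: power2_eq_square le_divide_eq mult.commute mult.left_commute)
          have "\<bar>L \<omega> \<bullet> b\<bar> \<le> norm (L \<omega>) * norm b" by (rule Cauchy_Schwarz_ineq2)
          also have "\<dots> \<le> 4 * (\<Sum>c\<in>UNIV. norm (\<omega> $ c))" using L_le props(3)[OF b] by simp
          also have "\<dots> \<le> 4 * ?m * R" using W_le[OF S(1)[OF \<omega>]] by simp
          finally show ?thesis using 1 True by (simp add: cb h_def V_def)
        next
          case False
          then have b: "b \<in> Basis" using j cb by (simp add: J_def)
          have "\<bar>\<omega> $ c \<bullet> b\<bar> \<le> norm (\<omega> $ c)" by (rule Basis_le_norm[OF b])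
          also have "\<dots> \<le> R" by (rule order_trans[OF Finite_Cartesian_Product.norm_nth_le S(1)[OF \<omega>]])
          finally show ?thesis using False by (simp add: cb h_def V_def)
        qed
      qed
      show "norm (x - y) \<le> K * (\<Sum>j\<in>J. \<bar>h j x - h j y\<bar>)" for x y
      proof -
        define \<delta> where "\<delta> = x - y"
        let ?H = "\<Sum>j\<in>J. \<bar>h j x - h j y\<bar>"
        let ?E = "\<Sum>c\<in>UNIV - {a}. norm (\<delta> $ c)"
        have "?H = (\<Sum>j\<in>J. \<bar>h j \<delta>\<bar>)"
          by (intro sum.cong) (auto simp: h_def \<delta>_def linear_diff[OF linL] inner_diff_left)
        also have "\<dots> = (\<Sum>c\<in>UNIV. \<Sum>b\<in>(if c = a then B else Basis). \<bar>h (c, b) \<delta>\<bar>)"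
          unfolding J_def using props(1) by (subst sum.Sigma) (auto simp: case_prod_unfold)
        also have "\<dots> = (\<Sum>b\<in>B. \<bar>L \<delta> \<bullet> b\<bar>) + (\<Sum>c\<in>UNIV - {a}. \<Sum>b\<in>Basis. \<bar>\<delta> $ c \<bullet> b\<bar>)"
          by (subst sum.remove[of _ a]) (auto simp: h_def intro!: sum.cong)
        finally have H: "?H = (\<Sum>b\<in>B. \<bar>L \<delta> \<bullet> b\<bar>) + (\<Sum>c\<in>UNIV - {a}. \<Sum>b\<in>Basis. \<bar>\<delta> $ c \<bullet> b\<bar>)" .
        have "norm (\<Sum>b\<in>B. (L \<delta> \<bullet> b) *\<^sub>R b) \<le> (\<Sum>b\<in>B. \<bar>L \<delta> \<bullet> b\<bar>)"
          by (rule sum_norm_le) (simp add: props(3))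
        then have "norm (L \<delta>) \<le> (\<Sum>b\<in>B. \<bar>L \<delta> \<bullet> b\<bar>)"
          unfolding singular_basis_expand[OF linear_word_map B] .
        moreover have "?E \<le> (\<Sum>c\<in>UNIV - {a}. \<Sum>b\<in>Basis. \<bar>\<delta> $ c \<bullet> b\<bar>)"
          by (intro sum_mono norm_le_l1)
        ultimately have EH: "norm (L \<delta>) + ?E \<le> ?H" unfolding H by linarith
        have E0: "0 \<le> ?E" by (intro sum_nonneg) simp
        \<comment> \<open>Splitting off the block of \<open>a\<close> leaves a vector whose image
          under \<open>L\<close> is controlled by the other blocks alone, so that the block of
          \<open>a\<close> can be recovered from \<open>L \<delta>\<close>.\<close>
        define \<delta>' where "\<delta>' = \<delta> - axis a (\<delta> $ a)"
        have \<delta>': "\<delta>' $ c = (if c = a then 0 else \<delta> $ c)" for c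
          by (simp add: \<delta>'_def axis_def)
        have "(\<Sum>c\<in>UNIV. norm (\<delta>' $ c)) = ?E"
          by (subst sum.remove[of _ a]) (auto simp: \<delta>' intro!: sum.cong)
        then have L': "norm (L \<delta>') \<le> 4 * ?E" using L_le[of \<delta>'] by simp
        have "L (axis a (\<delta> $ a)) = L \<delta> - L \<delta>'" by (simp add: \<delta>'_def linear_diff[OF linL])
        then have "norm (L (axis a (\<delta> $ a))) \<le> norm (L \<delta>) + norm (L \<delta>')"
          by (simp add: norm_triangle_ineq4)
        moreover have "norm (\<delta> $ a) \<le> norm (L (axis a (\<delta> $ a))) + \<eta> * norm (\<delta> $ a)"
          using ax[of "\<delta> $ a"] norm_triangle_sub[of "\<delta> $ a" "L (axis a (\<delta> $ a))"]
          by (simp add: L_def a_def norm_minus_commute)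
        ultimately have "(1 - \<eta>) * norm (\<delta> $ a) \<le> 5 * ?H"
          using L' EH E0 norm_ge_zero[of "L \<delta>"] unfolding left_diff_distrib by linarith
        then have da: "norm (\<delta> $ a) \<le> 5 / (1 - \<eta>) * ?H" using \<eta> by (simp add: field_simps)
        have "norm \<delta> \<le> (\<Sum>c\<in>UNIV. norm (\<delta> $ c))"
          unfolding norm_vec_def by (rule L2_set_le_sum) simp
        also have "\<dots> = norm (\<delta> $ a) + ?E" by (subst sum.remove[of _ a]) auto
        also have "\<dots> \<le> K * ?H"
          using da EH norm_ge_zero[of "L \<delta>"] unfolding K_def distrib_right by linarith
        finally show ?thesis by (simp add: \<delta>_def)
      qed
    qed (rule K)
    also have "(\<Prod>j\<in>J. V j) = (\<Prod>c\<in>UNIV. \<Prod>b\<in>(if c = a then B else Basis). V (c, b))"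
      unfolding J_def using props(1) by (subst prod.Sigma) (auto simp: case_prod_unfold)
    also have "\<dots> = (\<Prod>b\<in>B. min (r / norm (Tw w b)) (4 * ?m * R)) * (\<Prod>c\<in>UNIV - {a}. \<Prod>b\<in>(Basis :: 'a set). R)"
      by (subst prod.remove[of _ a]) (auto simp: V_def intro!: prod.cong)
    also have "(\<Prod>c\<in>UNIV - {a}. \<Prod>b\<in>(Basis :: 'a set). R) = (R ^ ?d) ^ (CARD('m) - 1)"
      by (simp add: card_Diff_singleton)
    finally have 1: "emeasure lborel S \<le> ennreal (C0 * ((\<Prod>b\<in>B. min (r / norm (Tw w b)) (4 * ?m * R)) * (R ^ ?d) ^ (CARD('m) - 1)))"
      unfolding C0_def .
    have "(\<Prod>b\<in>B. min (r / norm (Tw w b)) (4 * ?m * R)) \<le> (\<Prod>b\<in>B. ?A * (1 / max 1 (norm (Tw w b) / r)))"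
    proof (intro prod_mono conjI)
      fix b assume b: "b \<in> B"
      show "0 \<le> min (r / norm (Tw w b)) (4 * ?m * R)" using r R by simp
      show "min (r / norm (Tw w b)) (4 * ?m * R) \<le> ?A * (1 / max 1 (norm (Tw w b) / r))"
      proof (cases "1 \<le> norm (Tw w b) / r")
        case True
        have "min (r / norm (Tw w b)) (4 * ?m * R) \<le> 1 * (r / norm (Tw w b))" by simp
        also have "\<dots> \<le> ?A * (r / norm (Tw w b))" using r by (intro mult_right_mono) auto
        finally show ?thesis using True by (simp add: max_absorb2)
      qed (simp add: max_absorb1)
    qed
    also have "\<dots> = ?A ^ ?d / ellipsoid_count (Tw w) r"
      by (simp add: prod.distrib prod_dividef card_singular_basis[OF linear_word_map B]
          ellipsoid_count_singular_basis[OF linear_word_map B])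
    finally have "C0 * ((\<Prod>b\<in>B. min (r / norm (Tw w b)) (4 * ?m * R)) * (R ^ ?d) ^ (CARD('m) - 1))
        \<le> C0 * ((?A ^ ?d / ellipsoid_count (Tw w) r) * (R ^ ?d) ^ (CARD('m) - 1))"
      using C0 R by (intro mult_left_mono mult_right_mono) auto
    also have "\<dots> = C / ellipsoid_count (Tw w) r" by (simp add: C_def)
    finally show "emeasure lborel {\<omega> \<in> cball 0 R. dist (code_proj T \<omega> u) (code_proj T \<omega> v) \<le> r}
        \<le> ennreal (C / ellipsoid_count (Tw w) r)"
      using order_trans[OF 1 ennreal_leI] by (simp add: S_def)
  qed
qed

text \<open>The dichotomy in \<open>code_proj_diff_axis\<close> provides one good direction, and the
  estimate is symmetric in \<open>u\<close> and \<open>v\<close>, so the one-sided version applies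
  to one of the two orders. The constant depends on neither the word nor the sequences.\<close>

theorem transversality:
  fixes R :: real
  assumes R: "0 < R"
  obtains C where "0 \<le> C"
    "\<And>w u v r. u \<in> cylinder w \<Longrightarrow> v \<in> cylinder w \<Longrightarrow> u (length w) \<noteq> v (length w) \<Longrightarrow> 0 < r \<Longrightarrow>
      emeasure lborel {\<omega> \<in> cball 0 R. dist (code_proj T \<omega> u) (code_proj T \<omega> v) \<le> r}
        \<le> ennreal (C / ellipsoid_count (Tw w) r)"
proof -
  obtain \<rho> where \<rho>: "0 \<le> \<rho>" "\<rho> < 1/2" "\<And>w x. norm (Tw w x) \<le> \<rho> ^ length w * norm x"
    using contraction_ratio by metis
  have \<eta>: "\<rho> / (1 - \<rho>) < 1" using \<rho>(1,2) by (simp add: divide_less_eq)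
  show ?thesis
  proof (rule transversality_one_sided[OF R \<eta>])
    fix C assume C: "0 \<le> C" and one: "\<And>w u v r. u \<in> cylinder w \<Longrightarrow> v \<in> cylinder w \<Longrightarrow> 0 < r \<Longrightarrow>
      (\<And>z. norm (code_proj T (axis (u (length w)) z) (shift (length w) u)
         - code_proj T (axis (u (length w)) z) (shift (length w) v) - z) \<le> \<rho> / (1 - \<rho>) * norm z) \<Longrightarrow>
      emeasure lborel {\<omega> \<in> cball 0 R. dist (code_proj T \<omega> u) (code_proj T \<omega> v) \<le> r}
        \<le> ennreal (C / ellipsoid_count (Tw w) r)"
    show thesis
    proof (rule that[OF C])
      fix w and u v :: "nat \<Rightarrow> 'm" and r :: real
      assume uv: "u \<in> cylinder w" "v \<in> cylinder w" "u (length w) \<noteq> v (length w)" "0 < r"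
      have "shift (length w) u 0 \<noteq> shift (length w) v 0" using uv by simp
      from code_proj_diff_axis[of "shift (length w) u" "shift (length w) v", OF this \<rho>]
      show "emeasure lborel {\<omega> \<in> cball 0 R. dist (code_proj T \<omega> u) (code_proj T \<omega> v) \<le> r}
        \<le> ennreal (C / ellipsoid_count (Tw w) r)"
      proof
        assume "\<forall>z. norm (code_proj T (axis (shift (length w) u 0) z) (shift (length w) u)
          - code_proj T (axis (shift (length w) u 0) z) (shift (length w) v) - z) \<le> \<rho> / (1 - \<rho>) * norm z"
        then show ?thesis using uv by (intro one) auto
      next
        assume "\<forall>z. norm (code_proj T (axis (shift (length w) v 0) z) (shift (length w) v)
          - code_proj T (axis (shift (length w) v 0) z) (shift (length w) u) - z) \<le> \<rho> / (1 - \<rho>) * norm z"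
        then show ?thesis using uv by (subst dist_commute) (intro one, auto)
      qed
    qed
  qed
qed

end

section \<open>The lower local dimension\<close>

lemma ennreal_le_suminf: "f n \<le> (\<Sum>n. f n :: ennreal)"
  using sum_le_suminf[OF summableI, of "{n}" f] by simp

context self_affine_system
begin

lemma measurable_prefix [measurable]: "(\<lambda>u. map u [0..<k]) \<in> \<mu> \<rightarrow>\<^sub>M count_space UNIV"
unfolding measurable_count_space_eq2_countable
proof (intro conjI ballI)
  fix w :: "'m list"
  have "(\<lambda>u. map u [0..<k]) -` {w} \<inter> space \<mu> = (if length w = k then cylinder w else {})"
    by (auto simp: cylinder_def)
  then show "(\<lambda>u. map u [0..<k]) -` {w} \<inter> space \<mu> \<in> sets \<mu>" by simp
qed simp

text \<open>Fubini's theorem needs measurability in \<omega> and the sequence jointly. The partial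
  sums have it because each term depends on the sequence through a prefix, of which there are
  countably many.\<close>

lemma measurable_code_proj_pair [measurable (raw)]:
  assumes f [measurable]: "f \<in> M \<rightarrow>\<^sub>M (borel :: ('a ^ 'm) measure)" and g [measurable]: "g \<in> M \<rightarrow>\<^sub>M \<mu>"
  shows "(\<lambda>x. code_proj T (f x) (g x)) \<in> borel_measurable M"
proof -
  have comp: "(\<lambda>\<omega> :: 'a ^ 'm. Tw w (\<omega> $ c)) \<in> borel_measurable borel" for w c
    using bounded_linear_compose[OF linear_conv_bounded_linear[THEN iffD1, OF linear_word_map] bounded_linear_vec_nth]
    by (intro borel_measurable_continuous_onI linear_continuous_on)
  \<comment> \<open>The \<open>k\<close>-th term depends on the prefix of length
    \<open>k + 1\<close>: \<open>butlast\<close> gives the maps, \<open>last\<close> the letter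
    whose translation they act on.\<close>
  define t where "t k x = (\<lambda>w. Tw (butlast w) (f x $ last w)) (map (g x) [0..<Suc k])" for k x
  have t [measurable]: "t k \<in> borel_measurable M" for k
    unfolding t_def[abs_def]
  proof (rule measurable_compose_countable[where f = "\<lambda>w x. Tw (butlast w) (f x $ last w)" and g = "\<lambda>x. map (g x) [0..<Suc k]"])
    show "(\<lambda>x. Tw (butlast w) (f x $ last w)) \<in> borel_measurable M" for w
      by (rule measurable_compose[OF f comp])
    show "(\<lambda>x. map (g x) [0..<Suc k]) \<in> M \<rightarrow>\<^sub>M count_space UNIV"
      by (rule measurable_compose[OF g measurable_prefix])
  qed
  have "(\<lambda>x. \<Sum>k<n. t k x) \<in> borel_measurable M" for n by measurable
  then show ?thesis
  proof (rule borel_measurable_LIMSEQ_metric)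
    fix x
    have "t k x = Tw (map (g x) [0..<k]) (f x $ g x k)" for k
      by (simp add: t_def)
    then show "(\<lambda>n. \<Sum>k<n. t k x) \<longlonglongrightarrow> code_proj T (f x) (g x)"
      unfolding code_proj_def using summable_LIMSEQ[OF summable_code_proj[of "g x" "f x"]] by simp
  qed
qed

lemma emeasure_self_affine_measure:
  "A \<in> sets borel \<Longrightarrow> emeasure (self_affine_measure T p \<omega>) A = emeasure \<mu> {u. code_proj T \<omega> u \<in> A}"
  unfolding self_affine_measure_def
  by (subst emeasure_distr[OF measurable_code_proj]) (auto simp: vimage_def)

lemma measure_self_affine_measure:
  "A \<in> sets borel \<Longrightarrow> measure (self_affine_measure T p \<omega>) A = measure \<mu> {u. code_proj T \<omega> u \<in> A}"
  by (simp add: measure_def emeasure_self_affine_measure)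

text \<open>Weights of prefixes decay geometrically. Discarding \<open>v = u\<close> ensures that
  two sequences have a longest common prefix.\<close>

lemma singleton_null: "{u} \<in> null_sets \<mu>"
proof -
  obtain q q' where q: "0 < q" "q \<le> q'" "q' < 1" "\<And>w. weight w \<le> q' ^ length w"
    using weight_bounds by metis
  have "{u} = (\<Inter>k. cylinder (map u [0..<k]))"
    by (auto simp: cylinder_altdef)
  also have "\<dots> \<in> sets \<mu>" by (intro sets.countable_INT) auto
  finally have m: "{u} \<in> sets \<mu>" .
  have "measure \<mu> {u} \<le> q' ^ k" for k
  proof -
    have "measure \<mu> {u} \<le> measure \<mu> (cylinder (map u [0..<k]))"
      by (rule finite_measure_mono[OF _ sets_cylinder]) (auto simp: cylinder_def)
    also have "\<dots> \<le> q' ^ k" using q(4)[of "map u [0..<k]"] by (simp add: measure_cylinder)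
    finally show ?thesis .
  qed
  moreover have "(\<lambda>k. q' ^ k) \<longlonglongrightarrow> 0" using q by (intro LIMSEQ_realpow_zero) auto
  ultimately have "measure \<mu> {u} \<le> 0" by (intro LIMSEQ_le_const) auto
  then have "measure \<mu> {u} = 0" by (simp add: measure_le_0_iff)
  with m show ?thesis by (simp add: null_sets_def emeasure_eq_measure)
qed

text \<open>After exchanging the integrals, \<open>v\<close> is grouped by its longest common prefix
  \<open>w\<close> with the fixed sequence \<open>u\<close>. Transversality bounds the set of
  \<omega> by \<open>C / ellipsoid_count (T\<^sub>w) r\<close>, the minimum formula turns this into
  \<open>C * r\<^sup>s / \<phi>\<^sup>s(T\<^sub>w)\<close>, and integration over the cylinder
  contributes its weight.\<close>

lemma nn_integral_ball_le:
  fixes R s r :: real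
  assumes C: "0 \<le> C" "\<And>w u v r. u \<in> cylinder w \<Longrightarrow> v \<in> cylinder w \<Longrightarrow> u (length w) \<noteq> v (length w) \<Longrightarrow> 0 < r \<Longrightarrow>
      emeasure lborel {\<omega> \<in> cball 0 R. dist (code_proj T \<omega> u) (code_proj T \<omega> v) \<le> r}
        \<le> ennreal (C / ellipsoid_count (Tw w) r)"
    and s: "0 \<le> s" "s \<le> real DIM('a)" and r: "0 < r"
    and sum: "summable (\<lambda>k. weight (map u [0..<k]) / singular_value_fun s (Tw (map u [0..<k])))"
  shows "(\<integral>\<^sup>+\<omega>. indicator (cball 0 R) \<omega> * emeasure \<mu> {v. dist (code_proj T \<omega> u) (code_proj T \<omega> v) \<le> r} \<partial>lborel)
    \<le> ennreal (C * (\<Sum>k. weight (map u [0..<k]) / singular_value_fun s (Tw (map u [0..<k]))) * r powr s)"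
proof -
  interpret P: pair_sigma_finite \<mu> "lborel :: ('a ^ 'm) measure" by unfold_locales
  let ?w = "\<lambda>k. map u [0..<k]"
  let ?I = "\<lambda>\<omega> v. indicator (cball 0 R) \<omega> * indicator {v. dist (code_proj T \<omega> u) (code_proj T \<omega> v) \<le> r} v :: ennreal"
  have u [measurable]: "(\<lambda>_. u) \<in> N \<rightarrow>\<^sub>M \<mu>" for N :: "('a ^ 'm) measure"
    by (rule measurable_const) simp
  have cp [measurable]: "(\<lambda>\<omega>. code_proj T \<omega> v) \<in> borel_measurable borel" for v
    by (intro borel_measurable_continuous_onI linear_continuous_on)
       (use linear_code_proj in \<open>simp add: linear_conv_bounded_linear\<close>)
  have vset [measurable]: "{v. dist (code_proj T \<omega> u) (code_proj T \<omega> v) \<le> r} \<in> sets \<mu>" for \<omega>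
  proof -
    have "{v \<in> space \<mu>. dist (code_proj T \<omega> u) (code_proj T \<omega> v) \<le> r} \<in> sets \<mu>"
      using measurable_code_proj[of \<omega> p] by measurable
    then show ?thesis by simp
  qed
  have "(\<integral>\<^sup>+\<omega>. indicator (cball 0 R) \<omega> * emeasure \<mu> {v. dist (code_proj T \<omega> u) (code_proj T \<omega> v) \<le> r} \<partial>lborel)
      = (\<integral>\<^sup>+\<omega>. \<integral>\<^sup>+v. ?I \<omega> v \<partial>\<mu> \<partial>lborel)"
    by (simp add: nn_integral_cmult)
  also have "\<dots> = (\<integral>\<^sup>+v. \<integral>\<^sup>+\<omega>. ?I \<omega> v \<partial>lborel \<partial>\<mu>)"
  proof (rule P.Fubini'[where f = "\<lambda>v \<omega>. ?I \<omega> v"])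
    have "(\<lambda>x. code_proj T (snd x) u) \<in> borel_measurable (\<mu> \<Otimes>\<^sub>M lborel)"
      by (rule measurable_compose[OF _ cp]) simp
    then have "(\<lambda>x. dist (code_proj T (snd x) u) (code_proj T (snd x) (fst x))) \<in> borel_measurable (\<mu> \<Otimes>\<^sub>M (lborel :: ('a ^ 'm) measure))"
      by (intro borel_measurable_dist measurable_code_proj_pair) auto
    then have set: "{x \<in> space (\<mu> \<Otimes>\<^sub>M (lborel :: ('a ^ 'm) measure)). dist (code_proj T (snd x) u) (code_proj T (snd x) (fst x)) \<le> r}
        \<in> sets (\<mu> \<Otimes>\<^sub>M lborel)"
      by measurable
    have "(\<lambda>x. indicator (cball 0 R) (snd x) * indicator {x \<in> space (\<mu> \<Otimes>\<^sub>M (lborel :: ('a ^ 'm) measure)). dist (code_proj T (snd x) u) (code_proj T (snd x) (fst x)) \<le> r} x :: ennreal)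
        \<in> borel_measurable (\<mu> \<Otimes>\<^sub>M lborel)"
      by (rule borel_measurable_times_ennreal[OF
          measurable_compose[OF measurable_snd borel_measurable_indicator] borel_measurable_indicator[OF set]])
         simp
    then show "(\<lambda>(v, \<omega>). ?I \<omega> v) \<in> borel_measurable (\<mu> \<Otimes>\<^sub>M lborel)"
      by (rule measurable_cong[THEN iffD1, rotated]) (auto simp: space_pair_measure indicator_def)
  qed
  also have "\<dots> \<le> (\<integral>\<^sup>+v. (\<Sum>k. ennreal (C / ellipsoid_count (Tw (?w k)) r) * indicator (cylinder (?w k)) v) \<partial>\<mu>)"
  proof (rule nn_integral_mono_AE)
    have "AE v in \<mu>. v \<noteq> u"
      using AE_not_in[OF singleton_null[of u]] by simp
    then show "AE v in \<mu>. (\<integral>\<^sup>+\<omega>. ?I \<omega> v \<partial>lborel)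
      \<le> (\<Sum>k. ennreal (C / ellipsoid_count (Tw (?w k)) r) * indicator (cylinder (?w k)) v)"
    proof (rule AE_mp, intro AE_I2 impI)
      fix v assume "v \<noteq> u"
      then have ex: "\<exists>k. v k \<noteq> u k" by auto
      define k where "k = (LEAST k. v k \<noteq> u k)"
      have k: "v k \<noteq> u k" "\<And>j. j < k \<Longrightarrow> v j = u j"
        unfolding k_def using LeastI_ex[OF ex] not_less_Least by blast+
      then have cyl: "v \<in> cylinder (?w k)" "u \<in> cylinder (?w k)" by (auto simp: cylinder_altdef)
      have set: "{\<omega> \<in> cball 0 R. dist (code_proj T \<omega> u) (code_proj T \<omega> v) \<le> r} \<in> sets lborel"
        by measurable
      have "(\<integral>\<^sup>+\<omega>. ?I \<omega> v \<partial>lborel) = (\<integral>\<^sup>+\<omega>. indicator {\<omega> \<in> cball 0 R. dist (code_proj T \<omega> u) (code_proj T \<omega> v) \<le> r} \<omega> \<partial>lborel)"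
        by (intro nn_integral_cong) (auto simp: indicator_def)
      also have "\<dots> = emeasure lborel {\<omega> \<in> cball 0 R. dist (code_proj T \<omega> u) (code_proj T \<omega> v) \<le> r}"
        using set by (rule nn_integral_indicator)
      also have "\<dots> \<le> ennreal (C / ellipsoid_count (Tw (?w k)) r)"
        using cyl k(1) by (intro C(2) r) auto
      also have "\<dots> = ennreal (C / ellipsoid_count (Tw (?w k)) r) * indicator (cylinder (?w k)) v"
        using cyl by simp
      \<comment> \<open>Passing to the sum over all prefixes bounds the term for the actual
        branching point by an expression that is explicitly measurable in \<open>v\<close>.\<close>
      also have "\<dots> \<le> (\<Sum>k. ennreal (C / ellipsoid_count (Tw (?w k)) r) * indicator (cylinder (?w k)) v)"
        by (rule ennreal_le_suminf)
      finally show "(\<integral>\<^sup>+\<omega>. ?I \<omega> v \<partial>lborel)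
        \<le> (\<Sum>k. ennreal (C / ellipsoid_count (Tw (?w k)) r) * indicator (cylinder (?w k)) v)" .
    qed
  qed
  also have "\<dots> = (\<Sum>k. ennreal (C / ellipsoid_count (Tw (?w k)) r) * ennreal (weight (?w k)))"
    by (subst nn_integral_suminf) (auto simp: nn_integral_cmult emeasure_eq_measure measure_cylinder)
  also have "\<dots> \<le> (\<Sum>k. ennreal (C * (weight (?w k) / singular_value_fun s (Tw (?w k))) * r powr s))"
  proof (rule suminf_le)
    fix k
    let ?F = "ellipsoid_count (Tw (?w k)) r" and ?\<phi> = "singular_value_fun s (Tw (?w k))"
    have F: "0 < ?F" using ellipsoid_count_ge_1[of "Tw (?w k)" r] by linarith
    have \<phi>: "0 < ?\<phi>" by (rule svf_pos[OF s(1)])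
    have "?\<phi> \<le> r powr s * ?F" by (rule singular_value_fun_le[OF linear_word_map inj_word_map s r])
    then have "1 / ?F \<le> r powr s / ?\<phi>" using F \<phi> by (simp add: field_simps)
    then have "(C * weight (?w k)) * (1 / ?F) \<le> (C * weight (?w k)) * (r powr s / ?\<phi>)"
      using C(1) less_imp_le[OF weight_pos] by (intro mult_left_mono) auto
    then have "ennreal (C / ?F * weight (?w k)) \<le> ennreal (C * (weight (?w k) / ?\<phi>) * r powr s)"
      by (intro ennreal_leI) (simp add: field_simps)
    then show "ennreal (C / ?F) * ennreal (weight (?w k)) \<le> ennreal (C * (weight (?w k) / ?\<phi>) * r powr s)"
      using C(1) F less_imp_le[OF weight_pos] by (subst ennreal_mult[symmetric]) auto
  qed auto
  also have "\<dots> = ennreal (\<Sum>k. C * (weight (?w k) / singular_value_fun s (Tw (?w k))) * r powr s)"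
    using C(1) less_imp_le[OF weight_pos] less_imp_le[OF svf_pos[OF s(1)]]
    by (intro suminf_ennreal2 summable_mult2 summable_mult sum) auto
  also have "(\<Sum>k. C * (weight (?w k) / singular_value_fun s (Tw (?w k))) * r powr s)
      = C * (\<Sum>k. weight (?w k) / singular_value_fun s (Tw (?w k))) * r powr s"
    by (simp only: suminf_mult2[OF summable_mult[OF sum], symmetric] suminf_mult[OF sum])
  finally show ?thesis .
qed

text \<open>For fixed \<open>u\<close> the ball measures, multiplied by
  \<open>r powr (\<delta> - s)\<close>, have integrals over bounded \<omega> that decay
  geometrically along dyadic radii. Their sum is thus finite for almost every \<omega>, so the terms
  tend to 0. The order of the two almost-everywhere quantifiers is exchanged only at the
  end.\<close>

lemma AE_ball_measure_le:
  fixes s \<delta> :: real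
  assumes s: "0 \<le> s" "s < d_one T p" "s \<le> real DIM('a)" and \<delta>: "0 < \<delta>"
  shows "AE \<omega> in lborel. AE u in \<mu>. \<forall>\<^sub>F n in sequentially.
    measure (self_affine_measure T p \<omega>) (cball (code_proj T \<omega> u) ((1/2) ^ n)) \<le> ((1/2) ^ n) powr (s - \<delta>)"
proof -
  interpret P: pair_sigma_finite "lborel :: ('a ^ 'm) measure" \<mu> by unfold_locales
  let ?r = "\<lambda>n. (1/2 :: real) ^ n"
  define X where "X n \<omega> u = emeasure \<mu> {v. dist (code_proj T \<omega> u) (code_proj T \<omega> v) \<le> ?r n}" for n \<omega> u
  have X_meas: "(\<lambda>x. X n (fst x) (snd x)) \<in> borel_measurable (lborel \<Otimes>\<^sub>M \<mu>)" for n
  proof -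
    have "{x \<in> space ((lborel \<Otimes>\<^sub>M \<mu>) \<Otimes>\<^sub>M \<mu>). dist (code_proj T (fst (fst x)) (snd (fst x))) (code_proj T (fst (fst x)) (snd x)) \<le> ?r n}
        \<in> sets (((lborel :: ('a ^ 'm) measure) \<Otimes>\<^sub>M \<mu>) \<Otimes>\<^sub>M \<mu>)"
      by measurable
    from measurable_emeasure_Pair[OF this]
    show ?thesis unfolding X_def by (simp add: space_pair_measure vimage_def case_prod_unfold)
  qed
  define Q where "Q \<omega> u \<longleftrightarrow> (\<forall>\<^sub>F n in sequentially. X n \<omega> u \<le> ennreal (?r n powr (s - \<delta>)))" for \<omega> u
  have Q_meas: "{x \<in> space (lborel \<Otimes>\<^sub>M \<mu>). Q (fst x) (snd x)} \<in> sets (lborel \<Otimes>\<^sub>M \<mu>)"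
    unfolding Q_def eventually_sequentially using X_meas by measurable
  have "AE u in \<mu>. AE \<omega> in lborel. Q \<omega> u"
    using AE_summable_weight_over_svf[OF s(1,2)]
  proof (rule eventually_mono)
    fix u assume sum: "summable (\<lambda>k. weight (map u [0..<k]) / singular_value_fun s (Tw (map u [0..<k])))"
    define c where "c = (\<Sum>k. weight (map u [0..<k]) / singular_value_fun s (Tw (map u [0..<k])))"
    have Xu [measurable]: "(\<lambda>\<omega>. X n \<omega> u) \<in> borel_measurable lborel" for n
      using measurable_compose[OF measurable_Pair[OF measurable_ident_sets[OF refl] measurable_const[of u \<mu>]] X_meas[of n]]
      by simp
    have "AE \<omega> in lborel. \<omega> \<in> cball 0 (real (Suc R)) \<longrightarrow> Q \<omega> u" for R :: nat
    proof -
      have R: "0 < real (Suc R)" by simp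
      show ?thesis
      proof (rule transversality[OF R])
        fix C assume C: "0 \<le> C" "\<And>w u v r. u \<in> cylinder w \<Longrightarrow> v \<in> cylinder w \<Longrightarrow> u (length w) \<noteq> v (length w) \<Longrightarrow> 0 < r \<Longrightarrow>
          emeasure lborel {\<omega> \<in> cball 0 (real (Suc R)). dist (code_proj T \<omega> u) (code_proj T \<omega> v) \<le> r}
            \<le> ennreal (C / ellipsoid_count (Tw w) r)"
        \<comment> \<open>The normalisation leaves \<open>r powr \<delta>\<close> after integration,
          a geometric sequence along \<open>r = (1/2) ^ n\<close>.\<close>
        define Y where "Y n \<omega> = ennreal (?r n powr (\<delta> - s)) * (indicator (cball 0 (real (Suc R))) \<omega> * X n \<omega> u)" for n \<omega>
        have indX: "(\<lambda>\<omega>. indicator (cball 0 (real (Suc R))) \<omega> * X n \<omega> u) \<in> borel_measurable lborel" for n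
          by (intro borel_measurable_times_ennreal borel_measurable_indicator Xu) simp
        have Y_meas: "Y n \<in> borel_measurable lborel" for n
          unfolding Y_def by (intro borel_measurable_times_ennreal borel_measurable_const indX)
        have "(\<integral>\<^sup>+\<omega>. Y n \<omega> \<partial>lborel) \<le> ennreal (C * c * (1/2 powr \<delta>) ^ n)" for n
        proof -
          have "(\<integral>\<^sup>+\<omega>. Y n \<omega> \<partial>lborel) = ennreal (?r n powr (\<delta> - s)) * (\<integral>\<^sup>+\<omega>. indicator (cball 0 (real (Suc R))) \<omega> * X n \<omega> u \<partial>lborel)"
            unfolding Y_def by (rule nn_integral_cmult[OF indX])
          also have "\<dots> \<le> ennreal (?r n powr (\<delta> - s)) * ennreal (C * c * ?r n powr s)"
            unfolding X_def c_def by (intro mult_left_mono nn_integral_ball_le[OF C s(1,3) _ sum]) auto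
          also have "\<dots> = ennreal (?r n powr (\<delta> - s) * (C * c * ?r n powr s))"
            by (subst ennreal_mult'[symmetric]) auto
          also have "?r n powr (\<delta> - s) * (C * c * ?r n powr s) = C * c * ?r n powr \<delta>"
            by (simp add: powr_diff)
          also have "?r n powr \<delta> = (1/2 powr \<delta>) ^ n"
            by (simp add: powr_realpow[symmetric] powr_powr powr_divide mult.commute power_divide)
          finally show ?thesis .
        qed
        then have "(\<Sum>n. \<integral>\<^sup>+\<omega>. Y n \<omega> \<partial>lborel) \<le> (\<Sum>n. ennreal (C * c * (1/2 powr \<delta>) ^ n))"
          by (intro suminf_le) auto
        also have "\<dots> < \<infinity>"
        proof -
          have "0 \<le> c" unfolding c_def using less_imp_le[OF weight_pos] less_imp_le[OF svf_pos[OF s(1)]]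
            by (intro suminf_nonneg sum) auto
          moreover have "summable (\<lambda>n. C * c * (1/2 powr \<delta>) ^ n)"
            using \<delta> by (intro summable_mult summable_geometric) (simp add: gr_one_powr)
          ultimately show ?thesis
            using C(1) by (subst suminf_ennreal2) auto
        qed
        finally have "(\<integral>\<^sup>+\<omega>. (\<Sum>n. Y n \<omega>) \<partial>lborel) \<noteq> \<infinity>"
          by (subst nn_integral_suminf[OF Y_meas]) auto
        then have "AE \<omega> in lborel. (\<Sum>n. Y n \<omega>) \<noteq> \<infinity>"
          by (intro nn_integral_PInf_AE borel_measurable_suminf_order Y_meas) auto
        then show ?thesis
        proof (rule AE_mp, intro AE_I2 impI)
          fix \<omega> assume fin: "(\<Sum>n. Y n \<omega>) \<noteq> \<infinity>" and \<omega>: "\<omega> \<in> cball 0 (real (Suc R))"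
          have "(\<lambda>n. Y n \<omega>) \<longlonglongrightarrow> 0"
          proof -
            have "Y n \<omega> \<noteq> \<infinity>" for n
            proof -
              have "Y n \<omega> \<le> (\<Sum>n. Y n \<omega>)"
                by (rule ennreal_le_suminf)
              with fin show ?thesis by (metis infinity_ennreal_def neq_top_trans)
            qed
            then have e: "Y n \<omega> = ennreal (enn2real (Y n \<omega>))" for n by (simp add: less_top)
            have "summable (\<lambda>n. enn2real (Y n \<omega>))"
              using fin by (intro summable_suminf_not_top) (auto simp flip: e)
            from summable_LIMSEQ_zero[OF this] show ?thesis
              by (subst e) (simp add: tendsto_ennreal_iff[of _ _ 0, simplified])
          qed
          then have "\<forall>\<^sub>F n in sequentially. Y n \<omega> < 1"
            by (rule order_tendstoD) simp
          then show "Q \<omega> u" unfolding Q_def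
          proof (rule eventually_mono)
            fix n assume "Y n \<omega> < 1"
            then have "ennreal (?r n powr (\<delta> - s)) * X n \<omega> u \<le> 1" using \<omega> by (simp add: Y_def)
            then have "ennreal (?r n powr (s - \<delta>)) * (ennreal (?r n powr (\<delta> - s)) * X n \<omega> u) \<le> ennreal (?r n powr (s - \<delta>)) * 1"
              by (rule mult_left_mono) simp
            also have "ennreal (?r n powr (s - \<delta>)) * (ennreal (?r n powr (\<delta> - s)) * X n \<omega> u)
                = ennreal (?r n powr (s - \<delta>) * ?r n powr (\<delta> - s)) * X n \<omega> u"
              by (simp add: ennreal_mult mult.assoc)
            also have "?r n powr (s - \<delta>) * ?r n powr (\<delta> - s) = 1"
              by (simp flip: powr_add)
            finally show "X n \<omega> u \<le> ennreal (?r n powr (s - \<delta>))" by simp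
          qed
        qed
      qed
    qed
    then have "AE \<omega> in lborel. \<forall>R::nat. \<omega> \<in> cball 0 (real (Suc R)) \<longrightarrow> Q \<omega> u"
      unfolding AE_all_countable by blast
    then show "AE \<omega> in lborel. Q \<omega> u"
    proof eventually_elim
      case (elim \<omega>)
      obtain R :: nat where "norm \<omega> \<le> real R" using real_arch_simple by blast
      then show ?case using elim[rule_format, of R] by simp
    qed
  qed
  \<comment> \<open>Joint measurability of \<open>Q\<close> permits the exchange: summability was
    known for almost every \<open>u\<close>, while the theorem fixes \<omega> first.\<close>
  then have "AE \<omega> in lborel. AE u in \<mu>. Q \<omega> u"
    using P.AE_commute[of Q] Q_meas by simp
  then show ?thesis
  proof (rule eventually_mono)
    fix \<omega> :: "'a ^ 'm" assume "AE u in \<mu>. Q \<omega> u"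
    then show "AE u in \<mu>. \<forall>\<^sub>F n in sequentially.
      measure (self_affine_measure T p \<omega>) (cball (code_proj T \<omega> u) (?r n)) \<le> ?r n powr (s - \<delta>)"
    proof (rule AE_mp, intro AE_I2 impI)
      fix u assume "Q \<omega> u"
      then show "\<forall>\<^sub>F n in sequentially.
        measure (self_affine_measure T p \<omega>) (cball (code_proj T \<omega> u) (?r n)) \<le> ?r n powr (s - \<delta>)"
        unfolding Q_def X_def
        by (rule eventually_mono)
           (simp add: measure_self_affine_measure emeasure_eq_measure cball_def)
    qed
  qed
qed

end

section \<open>From local dimension to information dimension\<close>

lemma measurable_measure_cball:
  fixes \<nu> :: "'a::euclidean_space measure"
  assumes "prob_space \<nu>" "sets \<nu> = sets borel"
  shows "(\<lambda>x. measure \<nu> (cball x r)) \<in> borel_measurable \<nu>"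
proof -
  interpret prob_space \<nu> by fact
  note [measurable_cong] = assms(2)
  have sp: "space \<nu> = UNIV" using sets_eq_imp_space_eq[OF assms(2)] by simp
  have "{x \<in> space (\<nu> \<Otimes>\<^sub>M \<nu>). dist (fst x) (snd x) \<le> r} \<in> sets (\<nu> \<Otimes>\<^sub>M \<nu>)"
    by measurable
  from measurable_emeasure_Pair[OF this]
  have "(\<lambda>x. emeasure \<nu> (cball x r)) \<in> borel_measurable \<nu>"
    by (simp add: space_pair_measure sp vimage_def cball_def)
  then show ?thesis unfolding measure_def by measurable
qed

text \<open>By dominated convergence of the indicators, pointwise information without any rate
  becomes information on the mass of the good set at each scale. This is all that the entropy
  estimate uses.\<close>

lemma AE_eventually_imp_measure_LIMSEQ:
  assumes "prob_space M" and A: "\<And>n. A n \<in> sets M"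
    and ev: "AE x in M. \<forall>\<^sub>F n in sequentially. x \<in> A n"
  shows "(\<lambda>n. measure M (A n)) \<longlonglongrightarrow> 1"
proof -
  interpret prob_space M by fact
  have "(\<lambda>n. expectation (indicator (A n) :: _ \<Rightarrow> real)) \<longlonglongrightarrow> expectation (\<lambda>_. 1)"
  proof (rule integral_dominated_convergence[where w = "\<lambda>_. 1"])
    show "AE x in M. (\<lambda>n. indicator (A n) x :: real) \<longlonglongrightarrow> 1"
      using ev
    proof (rule eventually_mono)
      fix x assume "\<forall>\<^sub>F n in sequentially. x \<in> A n"
      then show "(\<lambda>n. indicator (A n) x :: real) \<longlonglongrightarrow> 1"
        by (intro tendsto_eventually) (auto elim: eventually_mono)
    qed
  qed (use A in auto)
  then show ?thesis using A by (simp add: prob_space)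
qed

text \<open>For \<open>0 < r \<le> 1\<close> this is the least \<open>n\<close> with
  \<open>(1/2) ^ n \<le> r\<close>.\<close>

definition dyadic_index :: "real \<Rightarrow> nat" where
  "dyadic_index r = nat \<lceil>- log 2 r\<rceil>"

lemma dyadic_index_bounds:
  assumes "0 < r" "r \<le> 1"
  shows "(1/2) ^ dyadic_index r \<le> r" "r < 2 * (1/2) ^ dyadic_index r"
proof -
  let ?n = "dyadic_index r"
  have "log 2 r \<le> 0" using assms by simp
  then have n: "- log 2 r \<le> real ?n" "real ?n < - log 2 r + 1"
    unfolding dyadic_index_def by linarith+
  have p: "(1/2 :: real) ^ ?n = 2 powr (- real ?n)"
    by (simp add: powr_minus powr_realpow field_simps)
  have r: "r = 2 powr (log 2 r)" using assms by simp
  show "(1/2) ^ ?n \<le> r" unfolding p by (subst (2) r) (use n in simp)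
  have "r < 2 powr (1 + - real ?n)" by (subst r) (use n in simp)
  also have "\<dots> = 2 * (1/2) ^ ?n" unfolding powr_add p by simp
  finally show "r < 2 * (1/2) ^ ?n" .
qed

lemma filterlim_dyadic_index: "filterlim dyadic_index sequentially (at_right 0)"
  unfolding filterlim_at_top
proof
  fix Z :: nat
  have "\<forall>\<^sub>F r in at_right (0::real). r < (1/2) ^ Z \<and> 0 < r"
    unfolding eventually_at_right_field by (intro exI[of _ "(1/2) ^ Z"]) auto
  then show "\<forall>\<^sub>F r in at_right 0. Z \<le> dyadic_index r"
  proof eventually_elim
    case (elim r)
    have "r \<le> 1" using elim power_le_one[of "1/2 :: real" Z] by simp
    have "(1/2 :: real) ^ dyadic_index r < (1/2) ^ Z"
      using elim dyadic_index_bounds(1)[of r] \<open>r \<le> 1\<close> by linarith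
    then show ?case by simp
  qed
qed

section \<open>Mesh cubes and their neighbours\<close>

definition mesh_cube :: "real \<Rightarrow> int ^ 'n \<Rightarrow> (real ^ 'n) set" where
  "mesh_cube r j = {x. \<forall>k. of_int (j $ k) * r \<le> x $ k \<and> x $ k < (of_int (j $ k) + 1) * r}"

lemma mesh_cubes_eq: "mesh_cubes r = range (mesh_cube r)"
  by (simp add: mesh_cubes_def mesh_cube_def)

lemma mem_mesh_cube_iff:
  assumes "0 < r"
  shows "x \<in> mesh_cube r j \<longleftrightarrow> j = (\<chi> k. \<lfloor>x $ k / r\<rfloor>)"
proof -
  have "of_int (j $ k) * r \<le> x $ k \<and> x $ k < (of_int (j $ k) + 1) * r \<longleftrightarrow> j $ k = \<lfloor>x $ k / r\<rfloor>" for k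
    using assms by (simp add: eq_commute[of "j $ k"] floor_eq_iff le_divide_eq divide_less_eq)
  then show ?thesis by (simp add: mesh_cube_def vec_eq_iff)
qed

lemma sets_mesh_cube [measurable, simp]: "mesh_cube r j \<in> sets borel"
proof -
  have "mesh_cube r j = (\<Inter>k. {x. of_int (j $ k) * r \<le> x $ k} \<inter> {x. x $ k < (of_int (j $ k) + 1) * r})"
    by (auto simp: mesh_cube_def)
  also have "\<dots> \<in> sets borel"
    by (intro sets.finite_INT sets.Int borel_closed borel_open closed_Collect_le open_Collect_less
        continuous_intros) auto
  finally show ?thesis .
qed

lemma disjoint_mesh_cubes: "0 < r \<Longrightarrow> i \<noteq> j \<Longrightarrow> mesh_cube r i \<inter> mesh_cube r j = {}"
  by (auto simp: mem_mesh_cube_iff)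

lemma mesh_cube_nonempty: "0 < r \<Longrightarrow> (\<chi> k. of_int (j $ k) * r) \<in> mesh_cube r j"
  by (simp add: mesh_cube_def)

lemma inj_mesh_cube:
  assumes "0 < r"
  shows "inj (mesh_cube r)"
proof (rule injI)
  fix i j :: "int ^ 'n" assume "mesh_cube r i = mesh_cube r j"
  with mesh_cube_nonempty[OF assms, of i] have "(\<chi> k. of_int (i $ k) * r) \<in> mesh_cube r i \<inter> mesh_cube r j" by simp
  then show "i = j" using disjoint_mesh_cubes[OF assms, of i j] by blast
qed

lemma mesh_cube_subset_cball:
  fixes x :: "real ^ 'n"
  assumes "0 < r" "x \<in> mesh_cube r j"
  shows "mesh_cube r j \<subseteq> cball x (real CARD('n) * r)"
proof
  fix y assume y: "y \<in> mesh_cube r j"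
  have "norm (x - y) \<le> (\<Sum>k\<in>UNIV. \<bar>(x - y) $ k\<bar>)" by (rule norm_le_l1_cart)
  also have "\<dots> \<le> (\<Sum>k\<in>(UNIV :: 'n set). r)"
  proof (rule sum_mono)
    fix k
    show "\<bar>(x - y) $ k\<bar> \<le> r"
      using y assms(2) by (auto simp: mesh_cube_def abs_le_iff algebra_simps dest!: spec[of _ k])
  qed
  finally show "y \<in> cball x (real CARD('n) * r)" by (simp add: dist_norm)
qed

definition unit_offsets :: "(int ^ 'n) set" where
  "unit_offsets = {d. \<forall>k. d $ k \<in> {-1, 0, 1}}"

lemma finite_int_vec_box: "finite {j :: int ^ 'n. \<forall>k. j $ k \<in> A}"
  and card_int_vec_box: "card {j :: int ^ 'n. \<forall>k. j $ k \<in> A} = card A ^ CARD('n)"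
  if "finite A"
proof -
  have eq: "{j :: int ^ 'n. \<forall>k. j $ k \<in> A} = vec_lambda ` (PiE UNIV (\<lambda>_. A))"
  proof (intro equalityI subsetI)
    fix j :: "int ^ 'n" assume "j \<in> {j. \<forall>k. j $ k \<in> A}"
    then show "j \<in> vec_lambda ` (PiE UNIV (\<lambda>_. A))"
      by (intro image_eqI[of _ _ "vec_nth j"]) auto
  qed auto
  have inj: "inj_on (vec_lambda :: _ \<Rightarrow> int ^ 'n) (PiE UNIV (\<lambda>_. A))"
    by (rule inj_on_subset[of _ UNIV]) (auto intro!: injI simp: vec_lambda_inject)
  show "finite {j :: int ^ 'n. \<forall>k. j $ k \<in> A}"
    unfolding eq using that by (intro finite_imageI finite_PiE) auto
  show "card {j :: int ^ 'n. \<forall>k. j $ k \<in> A} = card A ^ CARD('n)"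
    unfolding eq card_image[OF inj] by (simp add: card_PiE)
qed

lemma card_unit_offsets: "card (unit_offsets :: (int ^ 'n) set) = 3 ^ CARD('n)"
  and finite_unit_offsets: "finite (unit_offsets :: (int ^ 'n) set)"
  unfolding unit_offsets_def by (subst card_int_vec_box, simp, simp add: numeral_3_eq_3) (rule finite_int_vec_box, simp)

lemma cball_subset_neighbour_cubes:
  assumes "0 < r" "x \<in> mesh_cube r j" "t \<le> r"
  shows "cball x t \<subseteq> (\<Union>d\<in>unit_offsets. mesh_cube r (j + d))"
proof
  fix y assume y: "y \<in> cball x t"
  define i where "i = (\<chi> k. \<lfloor>y $ k / r\<rfloor>)"
  have yi: "y \<in> mesh_cube r i" by (simp add: i_def mem_mesh_cube_iff[OF assms(1)])
  have "(i - j) $ k \<in> {-1, 0, 1}" for k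
  proof -
    have j: "j $ k = \<lfloor>x $ k / r\<rfloor>" using assms(1,2) by (simp add: mem_mesh_cube_iff)
    have "\<bar>(x - y) $ k\<bar> \<le> norm (x - y)" by (rule component_le_norm_cart)
    also have "\<dots> \<le> r" using y assms(3) by (simp add: dist_norm)
    finally have "\<bar>x $ k / r - y $ k / r\<bar> \<le> 1" using assms(1) by (simp flip: diff_divide_distrib)
    moreover have "i $ k = \<lfloor>y $ k / r\<rfloor>" by (simp add: i_def)
    ultimately have "i $ k - j $ k \<le> 1" "-1 \<le> i $ k - j $ k" unfolding j by linarith+
    then show ?thesis by auto
  qed
  then have "i - j \<in> unit_offsets" by (simp add: unit_offsets_def)
  then show "y \<in> (\<Union>d\<in>unit_offsets. mesh_cube r (j + d))"
    using yi by (intro UN_I[of "i - j"]) auto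
qed

text \<open>This is \<open>ln x \<le> x - 1\<close> at \<open>x = 1 / (q * n)\<close>. Summed over
  at most \<open>n\<close> cubes it bounds their entropy by their total mass times
  \<open>ln n\<close>, plus 1, without an appeal to Jensen's inequality.\<close>

lemma neg_mult_ln_le:
  fixes q n :: real
  assumes "0 < q" "0 < n"
  shows "- (q * ln q) \<le> q * ln n + 1 / n"
proof -
  have "ln (1 / (q * n)) \<le> 1 / (q * n) - 1" using assms by (intro ln_le_minus_one) simp
  then have "q * ln (1 / (q * n)) \<le> q * (1 / (q * n) - 1)" using assms by (intro mult_left_mono) auto
  also have "\<dots> \<le> 1 / n" using assms by (simp add: field_simps)
  finally show ?thesis using assms by (simp add: ln_div ln_mult algebra_simps)
qed

section \<open>Entropy of the mesh\<close>

context
  fixes \<nu> :: "(real ^ 'n) measure" and B :: real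
  assumes prob: "prob_space \<nu>" and sets_nu: "sets \<nu> = sets borel"
    and bdd: "AE x in \<nu>. norm x \<le> B" and B: "0 \<le> B"
begin

interpretation prob_space \<nu> by (rule prob)

lemma space_nu: "space \<nu> = UNIV"
  using sets_eq_imp_space_eq[OF sets_nu] by simp

lemma mesh_cube_in_sets [simp]: "mesh_cube r j \<in> sets \<nu>"
  by (simp add: sets_nu)

definition charged :: "real \<Rightarrow> (int ^ 'n) set" where
  "charged r = {j. 0 < measure \<nu> (mesh_cube r j)}"

lemma charged_subset:
  assumes "0 < r"
  shows "charged r \<subseteq> {j. \<forall>k. j $ k \<in> {\<lfloor>- B / r\<rfloor>..\<lfloor>B / r\<rfloor>}}"
proof
  fix j assume "j \<in> charged r"
  have "\<exists>x\<in>mesh_cube r j. norm x \<le> B"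
  proof (rule ccontr)
    assume "\<not> (\<exists>x\<in>mesh_cube r j. norm x \<le> B)"
    then have "AE x in \<nu>. x \<notin> mesh_cube r j" using bdd by (auto elim: eventually_mono)
    then have "measure \<nu> (mesh_cube r j) = 0" by (subst prob_eq_0) auto
    with \<open>j \<in> charged r\<close> show False by (simp add: charged_def)
  qed
  then obtain x where x: "x \<in> mesh_cube r j" "norm x \<le> B" by blast
  have "j $ k \<in> {\<lfloor>- B / r\<rfloor>..\<lfloor>B / r\<rfloor>}" for k
  proof -
    have "\<bar>x $ k\<bar> \<le> B" using component_le_norm_cart[of x k] x(2) by linarith
    then have "- B / r \<le> x $ k / r" "x $ k / r \<le> B / r"
      using assms by (intro divide_right_mono; simp)+
    then show ?thesis using x(1) assms by (simp add: mem_mesh_cube_iff floor_mono)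
  qed
  then show "j \<in> {j. \<forall>k. j $ k \<in> {\<lfloor>- B / r\<rfloor>..\<lfloor>B / r\<rfloor>}}" by simp
qed

lemma finite_charged: "0 < r \<Longrightarrow> finite (charged r)"
  by (rule finite_subset[OF charged_subset finite_int_vec_box]) auto

lemma card_charged_le:
  assumes "0 < r" "r \<le> 1"
  shows "real (card (charged r)) \<le> ((2 * B + 2) / r) ^ CARD('n)"
proof -
  have "card (charged r) \<le> card {j :: int ^ 'n. \<forall>k. j $ k \<in> {\<lfloor>- B / r\<rfloor>..\<lfloor>B / r\<rfloor>}}"
    by (intro card_mono charged_subset finite_int_vec_box assms) auto
  also have "\<dots> = card {\<lfloor>- B / r\<rfloor>..\<lfloor>B / r\<rfloor>} ^ CARD('n)" by (rule card_int_vec_box) simp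
  finally have "real (card (charged r)) \<le> real (card {\<lfloor>- B / r\<rfloor>..\<lfloor>B / r\<rfloor>}) ^ CARD('n)"
    by (simp flip: of_nat_power)
  also have "\<dots> \<le> ((2 * B + 2) / r) ^ CARD('n)"
  proof (rule power_mono)
    have "- B / r \<le> B / r" using B assms by (intro divide_right_mono) auto
    then have le: "\<lfloor>- B / r\<rfloor> \<le> \<lfloor>B / r\<rfloor>" by (rule floor_mono)
    then have "real (card {\<lfloor>- B / r\<rfloor>..\<lfloor>B / r\<rfloor>}) = real_of_int (\<lfloor>B / r\<rfloor> - \<lfloor>- B / r\<rfloor> + 1)" by simp
    also have "\<dots> \<le> B / r + B / r + 2" by (simp; linarith)
    also have "\<dots> \<le> (2 * B + 2) / r" using assms by (simp add: field_simps)
    finally show "real (card {\<lfloor>- B / r\<rfloor>..\<lfloor>B / r\<rfloor>}) \<le> (2 * B + 2) / r" .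
  qed simp
  finally show ?thesis .
qed

definition mesh_entropy :: "real \<Rightarrow> real" where
  "mesh_entropy r = (\<Sum>j\<in>charged r. - (measure \<nu> (mesh_cube r j) * ln (measure \<nu> (mesh_cube r j))))"

lemma mesh_entropy_eq:
  assumes "0 < r"
  shows "(\<Sum>\<^sub>\<infinity>C\<in>{C \<in> mesh_cubes r. measure \<nu> C > 0}. measure \<nu> C * ln (measure \<nu> C)) = - mesh_entropy r"
proof -
  have "{C \<in> mesh_cubes r. measure \<nu> C > 0} = mesh_cube r ` charged r"
    by (auto simp: mesh_cubes_eq charged_def)
  then show ?thesis
    using finite_charged[OF assms] inj_on_subset[OF inj_mesh_cube[OF assms] subset_UNIV, of "charged r"]
    by (simp add: mesh_entropy_def sum.reindex sum_negf o_def)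
qed

lemma sum_mesh_cubes_le:
  assumes "0 < r" "finite J"
  shows "(\<Sum>j\<in>J. measure \<nu> (mesh_cube r j)) = measure \<nu> (\<Union>j\<in>J. mesh_cube r j)"
  using assms disjoint_mesh_cubes[OF assms(1)]
  by (intro finite_measure_finite_Union[symmetric]) (auto simp: disjoint_family_on_def)

lemma measure_le_sum_charged:
  assumes "0 < r" and G: "G \<in> sets \<nu>"
  shows "measure \<nu> G \<le> (\<Sum>j\<in>{j \<in> charged r. mesh_cube r j \<inter> G \<noteq> {}}. measure \<nu> (mesh_cube r j))"
proof -
  let ?J = "{j \<in> charged r. mesh_cube r j \<inter> G \<noteq> {}}"
  have fin: "finite ?J" using finite_charged[OF assms(1)] by simp
  have "AE x in \<nu>. \<forall>j. x \<in> mesh_cube r j \<longrightarrow> j \<in> charged r"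
  proof (rule AE_all_countable[THEN iffD2], rule allI)
    fix j :: "int ^ 'n"
    show "AE x in \<nu>. x \<in> mesh_cube r j \<longrightarrow> j \<in> charged r"
    proof (cases "j \<in> charged r")
      case False
      then have "measure \<nu> (mesh_cube r j) = 0"
        unfolding charged_def using measure_nonneg[of \<nu> "mesh_cube r j"] by (auto simp: not_less intro: antisym)
      then have "AE x in \<nu>. x \<notin> mesh_cube r j" by (subst (asm) prob_eq_0) auto
      then show ?thesis by (rule eventually_mono) auto
    qed auto
  qed
  then have "AE x in \<nu>. x \<in> G \<longrightarrow> x \<in> (\<Union>j\<in>?J. mesh_cube r j)"
  proof (rule eventually_mono, intro impI)
    fix x assume x: "\<forall>j. x \<in> mesh_cube r j \<longrightarrow> j \<in> charged r" "x \<in> G"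
    have "x \<in> mesh_cube r (\<chi> k. \<lfloor>x $ k / r\<rfloor>)" by (simp add: mem_mesh_cube_iff[OF assms(1)])
    with x show "x \<in> (\<Union>j\<in>?J. mesh_cube r j)" by blast
  qed
  then have "measure \<nu> G \<le> measure \<nu> (\<Union>j\<in>?J. mesh_cube r j)"
    using fin by (intro finite_measure_mono_AE) auto
  then show ?thesis using sum_mesh_cubes_le[OF assms(1) fin] by simp
qed

text \<open>A cube that meets \<open>G\<close> lies in a ball of radius \<open>t\<close> about a
  point of \<open>G\<close>, so its mass is at most \<open>t powr q\<close>. The other cubes
  contribute nonnegative terms and may be dropped.\<close>

lemma mesh_entropy_ge:
  assumes r: "0 < r" and G: "G \<in> sets \<nu>" and t: "real CARD('n) * r \<le> t" "0 < t" "t \<le> 1" and q: "0 \<le> q"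
    and le: "\<And>x. x \<in> G \<Longrightarrow> measure \<nu> (cball x t) \<le> t powr q"
  shows "measure \<nu> G * (q * (- ln t)) \<le> mesh_entropy r"
proof -
  let ?J = "{j \<in> charged r. mesh_cube r j \<inter> G \<noteq> {}}"
  let ?m = "\<lambda>j. measure \<nu> (mesh_cube r j)"
  have fin: "finite (charged r)" by (rule finite_charged[OF r])
  have "measure \<nu> G * (q * (- ln t)) \<le> (\<Sum>j\<in>?J. ?m j) * (q * (- ln t))"
    using t q by (intro mult_right_mono measure_le_sum_charged r G mult_nonneg_nonneg) auto
  also have "\<dots> = (\<Sum>j\<in>?J. ?m j * (q * (- ln t)))" by (rule sum_distrib_right)
  also have "\<dots> \<le> (\<Sum>j\<in>?J. - (?m j * ln (?m j)))"
  proof (rule sum_mono)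
    fix j assume j: "j \<in> ?J"
    then obtain x where x: "x \<in> mesh_cube r j" "x \<in> G" by blast
    have "?m j \<le> measure \<nu> (cball x t)"
      using mesh_cube_subset_cball[OF r x(1)] t
      by (intro finite_measure_mono) (auto simp: sets_nu)
    also have "\<dots> \<le> t powr q" by (rule le[OF x(2)])
    finally have "?m j \<le> t powr q" .
    moreover have "0 < ?m j" using j by (simp add: charged_def)
    ultimately have "ln (?m j) \<le> q * ln t" using t by (metis ln_mono ln_powr less_numeral_extra(3) order_less_le_trans)
    then have "?m j * ln (?m j) \<le> ?m j * (q * ln t)" by (rule mult_left_mono) simp
    then show "?m j * (q * (- ln t)) \<le> - (?m j * ln (?m j))" by simp
  qed
  also have "\<dots> \<le> mesh_entropy r"
    unfolding mesh_entropy_def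
  proof (rule sum_mono2[OF fin])
    fix j assume "j \<in> charged r - ?J"
    then have "0 < ?m j" by (simp add: charged_def)
    then have "ln (?m j) \<le> 0" by (simp add: prob_le_1)
    then show "0 \<le> - (?m j * ln (?m j))" by (simp add: mult_nonneg_nonpos)
  qed auto
  finally show ?thesis .
qed

text \<open>The ball belonging to a cube is contained in its \<open>3 ^ n\<close> neighbours. For
  one fixed offset the neighbours of distinct cubes are disjoint, so each offset contributes total
  mass at most 1.\<close>

lemma card_cubes_meeting_le:
  assumes r: "0 < r" and t: "t \<le> r" "0 < c" and J: "finite J"
    and ge: "\<And>j. j \<in> J \<Longrightarrow> \<exists>x\<in>mesh_cube r j. c \<le> measure \<nu> (cball x t)"
  shows "real (card J) * c \<le> 3 ^ CARD('n)"
proof -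
  let ?m = "\<lambda>j. measure \<nu> (mesh_cube r j)"
  have "real (card J) * c = (\<Sum>j\<in>J. c)" by simp
  also have "\<dots> \<le> (\<Sum>j\<in>J. \<Sum>d\<in>unit_offsets. ?m (j + d))"
  proof (rule sum_mono)
    fix j assume "j \<in> J"
    then obtain x where x: "x \<in> mesh_cube r j" "c \<le> measure \<nu> (cball x t)" using ge by blast
    have "measure \<nu> (cball x t) \<le> measure \<nu> (\<Union>d\<in>unit_offsets. mesh_cube r (j + d))"
      using finite_unit_offsets by (intro finite_measure_mono cball_subset_neighbour_cubes r x t) auto
    also have "\<dots> \<le> (\<Sum>d\<in>unit_offsets. ?m (j + d))"
      using finite_unit_offsets by (intro finite_measure_subadditive_finite) auto
    finally show "c \<le> (\<Sum>d\<in>unit_offsets. ?m (j + d))" using x(2) by linarith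
  qed
  also have "\<dots> = (\<Sum>d\<in>unit_offsets. \<Sum>j\<in>J. ?m (j + d))" by (rule sum.swap)
  also have "\<dots> \<le> (\<Sum>d\<in>(unit_offsets :: (int ^ 'n) set). 1)"
  proof (rule sum_mono)
    fix d :: "int ^ 'n"
    have "(\<Sum>j\<in>J. ?m (j + d)) = (\<Sum>j\<in>(\<lambda>j. j + d) ` J. ?m j)"
      by (subst sum.reindex) auto
    also have "\<dots> \<le> 1" using J by (subst sum_mesh_cubes_le[OF r]) auto
    finally show "(\<Sum>j\<in>J. ?m (j + d)) \<le> 1" .
  qed
  finally show ?thesis by (simp add: card_unit_offsets)
qed

text \<open>Cubes meeting \<open>G\<close> are few, about \<open>t powr - q\<close>. The remaining
  ones are counted trivially, with a power of \<open>1 / r\<close>, but carry mass at most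
  \<open>1 - measure \<nu> G\<close>. Each of the two groups contributes 1 to the final
  summand.\<close>

lemma mesh_entropy_le:
  assumes r: "0 < r" "r \<le> 1" and G: "G \<in> sets \<nu>" and t: "0 < t" "t \<le> r" and q: "0 \<le> q"
    and ge: "\<And>x. x \<in> G \<Longrightarrow> t powr q \<le> measure \<nu> (cball x t)"
  shows "mesh_entropy r \<le> real CARD('n) * ln 3 + q * (- ln t)
    + (1 - measure \<nu> G) * (real CARD('n) * (ln (2 * B + 2) - ln r)) + 2"
proof -
  let ?J = "{j \<in> charged r. mesh_cube r j \<inter> G \<noteq> {}}"
  let ?K = "{j \<in> charged r. mesh_cube r j \<inter> G = {}}"
  let ?m = "\<lambda>j. measure \<nu> (mesh_cube r j)"
  have fin: "finite (charged r)" by (rule finite_charged[OF r(1)])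
  have finJ: "finite ?J" and finK: "finite ?K" using fin by auto
  have bound: "(\<Sum>j\<in>J. - (?m j * ln (?m j))) \<le> (\<Sum>j\<in>J. ?m j) * ln n + 1"
    if "J \<subseteq> charged r" "real (card J) \<le> n" "0 < n" for J n
  proof -
    have "(\<Sum>j\<in>J. - (?m j * ln (?m j))) \<le> (\<Sum>j\<in>J. ?m j * ln n + 1 / n)"
      using that by (intro sum_mono neg_mult_ln_le) (auto simp: charged_def)
    also have "\<dots> = (\<Sum>j\<in>J. ?m j) * ln n + real (card J) / n" by (simp add: sum.distrib sum_distrib_right)
    also have "real (card J) / n \<le> 1" using that by simp
    finally show ?thesis by simp
  qed
  define n where "n = 3 ^ CARD('n) / t powr q"
  define n' where "n' = ((2 * B + 2) / r) ^ CARD('n)"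
  have tq: "0 < t powr q" "t powr q \<le> 1" using t r q powr_mono2[of q t 1] by auto
  have n: "0 < n" "1 \<le> n" using tq by (auto simp: n_def le_divide_eq intro: order_trans[OF tq(2)])
  have n': "0 < n'" "1 \<le> n'"
  proof -
    have "1 \<le> (2 * B + 2) / r" using B r by (simp add: le_divide_eq)
    then show "1 \<le> n'" unfolding n'_def by (rule one_le_power)
    then show "0 < n'" by simp
  qed
  have ln_n: "ln n = real CARD('n) * ln 3 + q * (- ln t)"
    using t tq by (simp add: n_def ln_div ln_realpow ln_powr)
  have ln_n': "ln n' = real CARD('n) * (ln (2 * B + 2) - ln r)"
    using B r by (simp add: n'_def ln_realpow ln_div)
  have sumJ: "(\<Sum>j\<in>?J. ?m j) \<le> 1" by (subst sum_mesh_cubes_le[OF r(1) finJ]) simp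
  have "(\<Sum>j\<in>?K. ?m j) = measure \<nu> (\<Union>j\<in>?K. mesh_cube r j)" by (rule sum_mesh_cubes_le[OF r(1) finK])
  also have "\<dots> \<le> measure \<nu> (space \<nu> - G)"
    by (intro finite_measure_mono) (use sets.compl_sets[OF G] in \<open>auto simp: space_nu\<close>)
  also have "\<dots> = 1 - measure \<nu> G" by (rule prob_compl[OF G])
  finally have sumK: "(\<Sum>j\<in>?K. ?m j) \<le> 1 - measure \<nu> G" .
  have "real (card ?J) * t powr q \<le> 3 ^ CARD('n)"
    using ge by (intro card_cubes_meeting_le[OF r(1) t(2) tq(1) finJ]) blast
  then have cJ: "real (card ?J) \<le> n" using tq by (simp add: n_def le_divide_eq)
  have "card ?K \<le> card (charged r)" using fin by (intro card_mono) auto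
  then have cK: "real (card ?K) \<le> n'" using card_charged_le[OF r] unfolding n'_def by linarith
  have "mesh_entropy r = (\<Sum>j\<in>?J. - (?m j * ln (?m j))) + (\<Sum>j\<in>?K. - (?m j * ln (?m j)))"
    unfolding mesh_entropy_def using fin by (subst sum.union_disjoint[symmetric]) (auto intro!: sum.cong)
  also have "\<dots> \<le> ((\<Sum>j\<in>?J. ?m j) * ln n + 1) + ((\<Sum>j\<in>?K. ?m j) * ln n' + 1)"
    by (intro add_mono bound cJ cK n n') auto
  also have "\<dots> \<le> (1 * ln n + 1) + ((1 - measure \<nu> G) * ln n' + 1)"
    using n n' by (intro add_mono mult_right_mono sumJ sumK) auto
  finally show ?thesis unfolding ln_n ln_n' by simp
qed

text \<open>The good sets tend to full mass, so after division by \<open>- ln r\<close> the lower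
  estimate keeps the factor \<open>D - e\<close>, and in the upper one the contribution of the bad
  cubes is at most a constant times their mass. Additive constants disappear in the limit.\<close>

theorem information_dimension_of_local_dimension:
  fixes D :: real
  assumes D: "0 < D"
    and loc: "\<And>e. 0 < e \<Longrightarrow> AE x in \<nu>. \<forall>\<^sub>F n in sequentially.
      ((1/2) ^ n) powr (D + e) \<le> measure \<nu> (cball x ((1/2) ^ n)) \<and>
      measure \<nu> (cball x ((1/2) ^ n)) \<le> ((1/2) ^ n) powr (D - e)"
  shows "has_information_dimension \<nu> D"
proof -
  let ?r = "\<lambda>n. (1/2 :: real) ^ n"
  define G where "G e n = {x \<in> space \<nu>. ?r n powr (D + e) \<le> measure \<nu> (cball x (?r n)) \<and>
      measure \<nu> (cball x (?r n)) \<le> ?r n powr (D - e)}" for e n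
  have G [measurable]: "G e n \<in> sets \<nu>" for e n
    unfolding G_def using measurable_measure_cball[OF prob sets_nu, of "?r n"] by measurable
  have G_lim: "(\<lambda>n. measure \<nu> (G e n)) \<longlonglongrightarrow> 1" if "0 < e" for e
    by (rule AE_eventually_imp_measure_LIMSEQ[OF prob G])
       (use loc[OF that] in \<open>simp add: G_def space_nu\<close>)
  have inv_ln: "((\<lambda>r::real. c / (- ln r)) \<longlongrightarrow> 0) (at_right 0)" for c
    by (rule tendsto_divide_0[OF tendsto_const])
       (rule filterlim_at_top_imp_at_infinity, rule filterlim_uminus_at_bot[THEN iffD1, OF ln_at_0])
  have quotient_low: "M * (q * (L - c)) / L = M * (q * (1 - c / L))" if "L \<noteq> 0" for L M q c :: real
    using that by (simp add: field_simps)
  have quotient_up: "(A + d * L + g * (N * (b + L))) / L = A / L + d + g * (N * b / L + N)"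
    if "L \<noteq> 0" for L A d g N b :: real
    using that by (simp add: field_simps)
  have small: "\<forall>\<^sub>F r::real in at_right 0. 0 < r \<and> r < 1"
    unfolding eventually_at_right_field by (intro exI[of _ 1]) auto
  have "((\<lambda>r. mesh_entropy r / (- ln r)) \<longlongrightarrow> D) (at_right 0)"
  proof (rule order_tendstoI)
    fix a assume a: "a < D"
    define e where "e = min D (D - a) / 2"
    have e: "0 < e" "a < D - e" "0 \<le> D - e"
      using D a by (auto simp: e_def min_def field_simps)
    \<comment> \<open>The ball around a cube has radius up to \<open>CARD('n) * r\<close>. Enlarging
      the dyadic radius by \<open>2 ^ (P + 1)\<close> covers this; the additional 1 compensates for
      \<open>r\<close> being as large as almost twice its dyadic approximation.\<close>
    define P where "P = (SOME P. real CARD('n) \<le> 2 ^ P)"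
    have P: "real CARD('n) \<le> 2 ^ P"
      unfolding P_def by (rule someI_ex) (metis of_nat_less_two_power less_imp_le)
    define k where "k r = dyadic_index r - (P + 1)" for r
    have k_lim: "filterlim k sequentially (at_right 0)"
      unfolding k_def by (rule filterlim_compose[OF filterlim_minus_const_nat_at_top filterlim_dyadic_index])
    let ?low = "\<lambda>r. measure \<nu> (G e (k r)) * ((D - e) * (1 - (real P + 1) * ln 2 / (- ln r)))"
    have "(?low \<longlongrightarrow> 1 * ((D - e) * (1 - 0))) (at_right 0)"
      by (intro tendsto_intros inv_ln filterlim_compose[OF G_lim[OF e(1)] k_lim])
    then have "\<forall>\<^sub>F r in at_right 0. a < ?low r"
      using e by (intro order_tendstoD) auto
    moreover have "\<forall>\<^sub>F r in at_right 0. P + 1 \<le> dyadic_index r"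
      using filterlim_dyadic_index unfolding filterlim_at_top by blast
    ultimately show "\<forall>\<^sub>F r in at_right 0. a < mesh_entropy r / (- ln r)"
      using small
    proof eventually_elim
      case (elim r)
      let ?t = "?r (k r)"
      have ln: "0 < - ln r" using elim by simp
      have t: "?t = 2 ^ (P + 1) * ?r (dyadic_index r)"
      proof -
        have "dyadic_index r = k r + (P + 1)" using elim by (simp add: k_def)
        then have "?r (dyadic_index r) = ?r (k r) * ?r (P + 1)" by (simp only: power_add)
        then have "2 ^ (P + 1) * ?r (dyadic_index r) = ?r (k r) * (2 ^ (P + 1) * ?r (P + 1))"
          by (simp only: mult.left_commute)
        also have "2 ^ (P + 1) * ?r (P + 1) = 1" by (simp only: power_mult_distrib[symmetric]) simp
        finally show ?thesis by simp
      qed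
      note db = dyadic_index_bounds[of r]
      have "real CARD('n) * r \<le> 2 ^ P * r" using P elim by (intro mult_right_mono) auto
      also have "\<dots> \<le> 2 ^ P * (2 * ?r (dyadic_index r))" using db elim by (intro mult_left_mono) auto
      finally have t1: "real CARD('n) * r \<le> ?t" by (simp add: t)
      have "measure \<nu> (G e (k r)) * ((D - e) * (- ln ?t)) \<le> mesh_entropy r"
        using elim e t1 by (intro mesh_entropy_ge G) (auto simp: G_def power_le_one)
      moreover have "?t \<le> 2 ^ (P + 1) * r" using db elim unfolding t by (intro mult_left_mono) auto
      then have "ln ?t \<le> ln (2 ^ (P + 1) * r)" using elim by (subst ln_le_cancel_iff) auto
      then have "- ln r - (real P + 1) * ln 2 \<le> - ln ?t"
        using elim by (simp add: ln_mult ln_realpow algebra_simps)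
      then have "measure \<nu> (G e (k r)) * ((D - e) * (- ln r - (real P + 1) * ln 2)) \<le> measure \<nu> (G e (k r)) * ((D - e) * (- ln ?t))"
        using e by (intro mult_left_mono) auto
      ultimately have "measure \<nu> (G e (k r)) * ((D - e) * (- ln r - (real P + 1) * ln 2)) / (- ln r) \<le> mesh_entropy r / (- ln r)"
        using ln by (intro divide_right_mono) auto
      moreover have "measure \<nu> (G e (k r)) * ((D - e) * (- ln r - (real P + 1) * ln 2)) / (- ln r) = ?low r"
        using ln by (intro quotient_low) simp
      ultimately show ?case using elim by linarith
    qed
  next
    fix b assume b: "D < b"
    define e where "e = (b - D) / 2"
    have e: "0 < e" "D + e < b" using b by (auto simp: e_def field_simps)
    let ?N = "real CARD('n)"
    let ?up = "\<lambda>r. (?N * ln 3 + (D + e) * ln 2 + 2) / (- ln r) + (D + e)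
      + (1 - measure \<nu> (G e (dyadic_index r))) * (?N * ln (2 * B + 2) / (- ln r) + ?N)"
    have "(?up \<longlongrightarrow> 0 + (D + e) + (1 - 1) * (0 + ?N)) (at_right 0)"
      by (intro tendsto_intros inv_ln filterlim_compose[OF G_lim[OF e(1)] filterlim_dyadic_index])
    then have "\<forall>\<^sub>F r in at_right 0. ?up r < b"
      using e by (intro order_tendstoD) auto
    then show "\<forall>\<^sub>F r in at_right 0. mesh_entropy r / (- ln r) < b"
      using small
    proof eventually_elim
      case (elim r)
      let ?t = "?r (dyadic_index r)"
      have ln: "0 < - ln r" using elim by simp
      note db = dyadic_index_bounds[of r]
      have "mesh_entropy r \<le> ?N * ln 3 + (D + e) * (- ln ?t)
          + (1 - measure \<nu> (G e (dyadic_index r))) * (?N * (ln (2 * B + 2) - ln r)) + 2"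
        using elim db e D by (intro mesh_entropy_le G) (auto simp: G_def)
      moreover have "(D + e) * (- ln ?t) \<le> (D + e) * (- ln r + ln 2)"
      proof (rule mult_left_mono)
        have "ln r \<le> ln (2 * ?t)" using db elim by (subst ln_le_cancel_iff) auto
        then show "- ln ?t \<le> - ln r + ln 2" by (simp add: ln_mult)
      qed (use D e in simp)
      ultimately have "mesh_entropy r \<le> (?N * ln 3 + (D + e) * ln 2 + 2) + (D + e) * (- ln r)
          + (1 - measure \<nu> (G e (dyadic_index r))) * (?N * (ln (2 * B + 2) - ln r))"
        by (simp add: algebra_simps)
      then have "mesh_entropy r / (- ln r) \<le> ((?N * ln 3 + (D + e) * ln 2 + 2) + (D + e) * (- ln r)
          + (1 - measure \<nu> (G e (dyadic_index r))) * (?N * (ln (2 * B + 2) - ln r))) / (- ln r)"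
        using ln by (intro divide_right_mono) auto
      also have "\<dots> = ?up r"
        using quotient_up[of "- ln r" _ _ _ _ "ln (2 * B + 2)"] ln by simp
      finally show ?case using elim by linarith
    qed
  qed
  then show ?thesis
    unfolding has_information_dimension_def
  proof (rule Lim_transform_eventually)
    show "\<forall>\<^sub>F r in at_right 0. mesh_entropy r / - ln r =
        (\<Sum>\<^sub>\<infinity>C\<in>{C \<in> mesh_cubes r. measure \<nu> C > 0}. measure \<nu> C * ln (measure \<nu> C)) / ln r"
      using small by eventually_elim (simp add: mesh_entropy_eq)
  qed
qed

end

section \<open>The upper local dimension\<close>

lemma ellipsoid_count_id:
  assumes "0 < r" "r \<le> 1"
  shows "ellipsoid_count (id :: 'a::euclidean_space \<Rightarrow> 'a) r = (1 / r) ^ DIM('a)"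
proof -
  have "singular_value (id :: 'a \<Rightarrow> 'a) j = 1" if "j \<in> {1..DIM('a)}" for j
    using singular_value_attained[of "id :: 'a \<Rightarrow> 'a" j] that by (auto simp: id_def linear_ident)
  then have "ellipsoid_count (id :: 'a \<Rightarrow> 'a) r = (\<Prod>j\<in>{1..DIM('a)}. 1 / r)"
    unfolding ellipsoid_count_def using assms by (intro prod.cong) auto
  then show ?thesis by simp
qed

text \<open>A given \<open>r\<close> is compared with the first \<open>2 * \<rho> k\<close> below
  it; the preceding one exceeds \<open>r\<close>, and bounded ratios give
  \<open>\<rho> k \<ge> \<kappa> * r / 2\<close>. The radii need not be monotone, as critical radii
  along a sequence are not known to be.\<close>

lemma eventually_ge_powr_of_sequence:
  fixes f \<rho> :: "_ \<Rightarrow> real"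
  assumes mono: "\<And>r r'. r \<le> r' \<Longrightarrow> f r \<le> f r'"
    and \<rho>: "\<And>k. 0 < \<rho> k" "\<rho> \<longlonglongrightarrow> 0" "\<And>k. \<kappa> * \<rho> k \<le> \<rho> (Suc k)" "0 < \<kappa>"
    and t: "0 \<le> t" and c: "0 < c"
    and ev: "\<forall>\<^sub>F k in sequentially. c * \<rho> k powr t \<le> f (2 * \<rho> k)"
  shows "\<forall>\<^sub>F r in at_right 0. c * (\<kappa> / 2) powr t * r powr t \<le> f r"
proof -
  obtain K where K: "\<And>k. k \<ge> K \<Longrightarrow> c * \<rho> k powr t \<le> f (2 * \<rho> k)"
    using ev by (auto simp: eventually_sequentially)
  have "\<forall>\<^sub>F r in at_right 0. 0 < r \<and> r < 2 * \<rho> K"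
    unfolding eventually_at_right_field using \<rho>(1)[of K] by (intro exI[of _ "2 * \<rho> K"]) auto
  then show ?thesis
  proof eventually_elim
    case (elim r)
    have "\<forall>\<^sub>F k in sequentially. \<rho> k < r / 2" using elim by (intro order_tendstoD(2)[OF \<rho>(2)]) simp
    then have "\<forall>\<^sub>F k in sequentially. K \<le> k \<and> 2 * \<rho> k \<le> r"
      using eventually_ge_at_top[of K] by eventually_elim simp
    then have ex: "\<exists>k. K \<le> k \<and> 2 * \<rho> k \<le> r" by (auto simp: eventually_sequentially)
    \<comment> \<open>Minimality yields \<open>2 * \<rho> (k - 1) > r\<close>, since the choice of
      \<open>r\<close> rules out \<open>k = K\<close>.\<close>
    define k where "k = (LEAST k. K \<le> k \<and> 2 * \<rho> k \<le> r)"
    have k: "K \<le> k" "2 * \<rho> k \<le> r" unfolding k_def using LeastI_ex[OF ex] by blast+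
    have "k \<noteq> K" using k elim by auto
    then obtain j where j: "k = Suc j" "K \<le> j" using k(1) by (cases k) auto
    have "\<not> (K \<le> j \<and> 2 * \<rho> j \<le> r)" using not_less_Least[of j "\<lambda>k. K \<le> k \<and> 2 * \<rho> k \<le> r"] j by (simp add: k_def[symmetric])
    then have "r < 2 * \<rho> j" using j by simp
    then have "\<kappa> * (r / 2) \<le> \<kappa> * \<rho> j" using \<rho>(4) by (intro mult_left_mono) auto
    also have "\<dots> \<le> \<rho> k" using \<rho>(3) j by simp
    finally have "(\<kappa> / 2 * r) powr t \<le> \<rho> k powr t"
      using elim \<rho>(4) t by (intro powr_mono2) auto
    then have "c * (\<kappa> / 2 * r) powr t \<le> c * \<rho> k powr t"
      by (rule mult_left_mono) (use c in simp)
    then have "c * (\<kappa> / 2) powr t * r powr t \<le> c * \<rho> k powr t"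
      using elim \<rho>(4) by (simp only: powr_mult mult.assoc)
    also have "\<dots> \<le> f (2 * \<rho> k)" by (rule K[OF k(1)])
    also have "\<dots> \<le> f r" by (rule mono[OF k(2)])
    finally show ?case .
  qed
qed

section \<open>Covers of projected cylinders and lower bounds on ball measures\<close>

context self_affine_system
begin

text \<open>The projection of a cylinder is a translate of the image under \<open>T\<^sub>w\<close>
  of a set inside one fixed ball, so the covers of ellipsoids apply after scaling. The constant
  depends on \<omega> but on neither the word nor the radius.\<close>

lemma image_cylinder_cover:
  fixes \<omega> :: "'a ^ 'm"
  obtains C where "0 < C" "\<And>w r. 0 < r \<Longrightarrow>
    \<exists>Y. finite Y \<and> real (card Y) \<le> C * ellipsoid_count (Tw w) r \<and> code_proj T \<omega> ` cylinder w \<subseteq> (\<Union>y\<in>Y. cball y r)"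
proof -
  \<comment> \<open>The ball of radius \<open>2 * W \<omega>\<close> contains all projections;
    \<open>R \<ge> 1\<close> is what \<open>ellipsoid_count_scale_le\<close> asks for.\<close>
  define R where "R = max 1 (2 * W \<omega>)"
  have R: "1 \<le> R" "2 * W \<omega> \<le> R" and R0: "0 < R" by (auto simp: R_def)
  define C where "C = real (2 * DIM('a) + 3) ^ DIM('a) * R ^ DIM('a)"
  show ?thesis
  proof (rule that[of C])
    show "0 < C" using R by (simp add: C_def)
    fix w :: "'m list" and r :: real assume r: "0 < r"
    obtain X where X: "finite X" "real (card X) \<le> real (2 * DIM('a) + 3) ^ DIM('a) * ellipsoid_count (Tw w) (r / R)"
      "Tw w ` cball 0 1 \<subseteq> (\<Union>x\<in>X. cball x (r / R))"
      using ellipsoid_cover_exists[OF linear_word_map inj_word_map divide_pos_pos[OF r R0], of w] by blast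
    obtain v where v: "v \<in> cylinder w"
    proof
      show "(\<lambda>k. if k < length w then w ! k else undefined) \<in> cylinder w" by (simp add: cylinder_altdef)
    qed
    define b where "b = code_proj T \<omega> v - Tw w (code_proj T \<omega> (shift (length w) v))"
    define Y where "Y = (\<lambda>x. b + R *\<^sub>R x) ` X"
    show "\<exists>Y. finite Y \<and> real (card Y) \<le> C * ellipsoid_count (Tw w) r \<and> code_proj T \<omega> ` cylinder w \<subseteq> (\<Union>y\<in>Y. cball y r)"
    proof (intro exI conjI)
      show "finite Y" using X by (simp add: Y_def)
      have "card Y \<le> card X" unfolding Y_def by (rule card_image_le[OF X(1)])
      then have "real (card Y) \<le> real (2 * DIM('a) + 3) ^ DIM('a) * ellipsoid_count (Tw w) (r / R)"
        using X(2) by linarith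
      also have "\<dots> \<le> real (2 * DIM('a) + 3) ^ DIM('a) * (R ^ DIM('a) * ellipsoid_count (Tw w) r)"
        by (intro mult_left_mono ellipsoid_count_scale_le linear_word_map r R) simp
      finally show "real (card Y) \<le> C * ellipsoid_count (Tw w) r" by (simp add: C_def mult.assoc)
      show "code_proj T \<omega> ` cylinder w \<subseteq> (\<Union>y\<in>Y. cball y r)"
      proof
        fix z assume "z \<in> code_proj T \<omega> ` cylinder w"
        then obtain u where u: "u \<in> cylinder w" "z = code_proj T \<omega> u" by blast
        let ?x = "code_proj T \<omega> (shift (length w) u)"
        have z: "z = b + Tw w ?x"
          using code_proj_append[OF u(1) v, of \<omega>] by (simp add: b_def u(2) linear_diff[OF linear_word_map] algebra_simps)
        have "?x \<in> cball 0 R" using norm_code_proj_le[of \<omega> "shift (length w) u"] R by simp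
        then have "Tw w ?x \<in> Tw w ` cball 0 R" by blast
        then obtain x where x: "x \<in> X" "Tw w ?x \<in> cball (Tw w 0 + R *\<^sub>R x) (R * (r / R))"
          using ellipsoid_cover_ball[OF linear_word_map R0 X(3), of 0] by blast
        then have "dist (R *\<^sub>R x) (Tw w ?x) \<le> r" using R by (simp add: linear_0[OF linear_word_map])
        then have "z \<in> cball (b + R *\<^sub>R x) r" by (simp add: z dist_norm)
        with x(1) show "z \<in> (\<Union>y\<in>Y. cball y r)" by (auto simp: Y_def)
      qed
    qed
  qed
qed

lemma prob_self_affine: "prob_space (self_affine_measure T p \<omega>)"
  by (rule prob_space_self_affine_measure[OF p_pos p_sum])

text \<open>\<open>E\<close> collects the sequences projected into a covering ball of too small
  measure. Outside \<open>E\<close> the covering ball that contains the projected point has large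
  measure and lies in the concentric ball of twice the radius about that point. The radius may vary
  with the word, as the critical radius does.\<close>

lemma exceptional_set:
  fixes \<omega> :: "'a ^ 'm"
  obtains C where "0 < C" "\<And>k r \<eta>. (\<And>w. 0 < r w) \<Longrightarrow> 0 \<le> \<eta> \<Longrightarrow>
    \<exists>E\<in>sets \<mu>. measure \<mu> E \<le> \<eta> \<and> (\<forall>u. u \<notin> E \<longrightarrow>
      \<eta> * weight (map u [0..<k]) / (C * ellipsoid_count (Tw (map u [0..<k])) (r (map u [0..<k])))
        \<le> measure (self_affine_measure T p \<omega>) (cball (code_proj T \<omega> u) (2 * r (map u [0..<k]))))"
proof (rule image_cylinder_cover[of \<omega>])
  fix C assume C: "0 < C" "\<And>w r. 0 < r \<Longrightarrow>
    \<exists>Y. finite Y \<and> real (card Y) \<le> C * ellipsoid_count (Tw w) r \<and> code_proj T \<omega> ` cylinder w \<subseteq> (\<Union>y\<in>Y. cball y r)"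
  let ?\<nu> = "self_affine_measure T p \<omega>"
  interpret nu: prob_space ?\<nu> by (rule prob_self_affine)
  show thesis
  proof (rule that[OF C(1)])
    fix k :: nat and r :: "'m list \<Rightarrow> real" and \<eta> :: real assume r: "\<And>w. 0 < r w" and \<eta>: "0 \<le> \<eta>"
    \<comment> \<open>The threshold is chosen so that, times the number of balls for
      \<open>w\<close>, it gives \<open>\<eta> * weight w\<close>; the sum over words of length
      \<open>k\<close> is then \<eta>.\<close>
    define h where "h w = \<eta> * weight w / (C * ellipsoid_count (Tw w) (r w))" for w
    have F: "0 < ellipsoid_count (Tw w) (r w)" for w using ellipsoid_count_ge_1[of "Tw w" "r w"] by linarith
    have h0: "0 \<le> h w" for w using \<eta> C(1) F[of w] less_imp_le[OF weight_pos] by (simp add: h_def)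
    have "\<exists>Y. \<forall>w. finite (Y w) \<and> real (card (Y w)) \<le> C * ellipsoid_count (Tw w) (r w) \<and>
      code_proj T \<omega> ` cylinder w \<subseteq> (\<Union>y\<in>Y w. cball y (r w))"
      by (intro choice allI C(2) r)
    then obtain Y where Y: "\<And>w. finite (Y w)" "\<And>w. real (card (Y w)) \<le> C * ellipsoid_count (Tw w) (r w)"
      "\<And>w. code_proj T \<omega> ` cylinder w \<subseteq> (\<Union>y\<in>Y w. cball y (r w))"
      by blast
    define Y' where "Y' w = {y \<in> Y w. measure ?\<nu> (cball y (r w)) \<le> h w}" for w
    define E where "E = (\<Union>w\<in>{w. length w = k}. \<Union>y\<in>Y' w. {u. code_proj T \<omega> u \<in> cball y (r w)})"
    have pre: "{u. code_proj T \<omega> u \<in> A} \<in> sets \<mu>" if "A \<in> sets borel" for A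
      using measurable_sets[OF measurable_code_proj that, of \<omega> p] by (simp add: vimage_def)
    have finY': "finite (Y' w)" for w using Y(1) by (simp add: Y'_def)
    have preY: "(\<Union>y\<in>Y' w. {u. code_proj T \<omega> u \<in> cball y (r w)}) \<in> sets \<mu>" for w
      by (intro sets.finite_UN finY' pre borel_closed closed_cball)
    have E: "E \<in> sets \<mu>"
      unfolding E_def by (intro sets.finite_UN preY finite_words)
    moreover have "measure \<mu> E \<le> \<eta>"
    proof -
      have "measure \<mu> E \<le> (\<Sum>w | length w = k. measure \<mu> (\<Union>y\<in>Y' w. {u. code_proj T \<omega> u \<in> cball y (r w)}))"
        unfolding E_def using preY by (intro finite_measure_subadditive_finite finite_words) blast
      also have "\<dots> \<le> (\<Sum>w | length w = k. \<eta> * weight w)"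
      proof (rule sum_mono)
        fix w
        have "measure \<mu> (\<Union>y\<in>Y' w. {u. code_proj T \<omega> u \<in> cball y (r w)}) \<le> (\<Sum>y\<in>Y' w. measure \<mu> {u. code_proj T \<omega> u \<in> cball y (r w)})"
          using pre[OF borel_closed[OF closed_cball]] by (intro finite_measure_subadditive_finite finY') blast
        also have "\<dots> \<le> (\<Sum>y\<in>Y' w. h w)"
          by (intro sum_mono) (simp add: Y'_def measure_self_affine_measure)
        also have "\<dots> = real (card (Y' w)) * h w" by simp
        also have "\<dots> \<le> real (card (Y w)) * h w"
          using Y(1) h0 by (intro mult_right_mono of_nat_mono card_mono) (auto simp: Y'_def)
        also have "\<dots> \<le> (C * ellipsoid_count (Tw w) (r w)) * h w" by (intro mult_right_mono Y h0)
        also have "\<dots> = \<eta> * weight w" using C(1) F[of w] by (simp add: h_def)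
        finally show "measure \<mu> (\<Union>y\<in>Y' w. {u. code_proj T \<omega> u \<in> cball y (r w)}) \<le> \<eta> * weight w" .
      qed
      also have "\<dots> = \<eta>" by (simp add: sum_weight flip: sum_distrib_left)
      finally show ?thesis .
    qed
    moreover have "h (map u [0..<k]) \<le> measure ?\<nu> (cball (code_proj T \<omega> u) (2 * r (map u [0..<k])))" if "u \<notin> E" for u
    proof -
      let ?w = "map u [0..<k]"
      have "u \<in> cylinder ?w" by (simp add: cylinder_def)
      then obtain y where y: "y \<in> Y ?w" "code_proj T \<omega> u \<in> cball y (r ?w)" using Y(3)[of ?w] by blast
      have "y \<notin> Y' ?w" using that y by (auto simp: E_def)
      then have "h ?w < measure ?\<nu> (cball y (r ?w))" using y by (simp add: Y'_def not_le)
      also have "\<dots> \<le> measure ?\<nu> (cball (code_proj T \<omega> u) (2 * r ?w))"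
      proof (rule nu.finite_measure_mono)
        show "cball y (r ?w) \<subseteq> cball (code_proj T \<omega> u) (2 * r ?w)"
        proof
          fix z assume "z \<in> cball y (r ?w)"
          with y(2) show "z \<in> cball (code_proj T \<omega> u) (2 * r ?w)"
            using dist_triangle3[of "code_proj T \<omega> u" z y] by simp
        qed
      qed simp
      finally show ?thesis by simp
    qed
    ultimately show "\<exists>E\<in>sets \<mu>. measure \<mu> E \<le> \<eta> \<and> (\<forall>u. u \<notin> E \<longrightarrow>
      \<eta> * weight (map u [0..<k]) / (C * ellipsoid_count (Tw (map u [0..<k])) (r (map u [0..<k])))
        \<le> measure ?\<nu> (cball (code_proj T \<omega> u) (2 * r (map u [0..<k]))))"
      unfolding h_def by blast
  qed
qed

lemma AE_eventually_ball_ge: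
  fixes \<omega> :: "'a ^ 'm" and k :: "nat \<Rightarrow> nat" and r :: "nat \<Rightarrow> 'm list \<Rightarrow> real" and \<eta> :: "nat \<Rightarrow> real"
  assumes r: "\<And>n w. 0 < r n w" and \<eta>: "\<And>n. 0 \<le> \<eta> n" "summable \<eta>"
  shows "\<exists>C>0. AE u in \<mu>. \<forall>\<^sub>F n in sequentially.
    \<eta> n * weight (map u [0..<k n]) / (C * ellipsoid_count (Tw (map u [0..<k n])) (r n (map u [0..<k n])))
      \<le> measure (self_affine_measure T p \<omega>) (cball (code_proj T \<omega> u) (2 * r n (map u [0..<k n])))"
proof (rule exceptional_set[of \<omega>])
  fix C assume C: "0 < C" "\<And>k r \<eta>. (\<And>w. 0 < r w) \<Longrightarrow> 0 \<le> \<eta> \<Longrightarrow>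
    \<exists>E\<in>sets \<mu>. measure \<mu> E \<le> \<eta> \<and> (\<forall>u. u \<notin> E \<longrightarrow>
      \<eta> * weight (map u [0..<k]) / (C * ellipsoid_count (Tw (map u [0..<k])) (r (map u [0..<k])))
        \<le> measure (self_affine_measure T p \<omega>) (cball (code_proj T \<omega> u) (2 * r (map u [0..<k]))))"
  have "\<exists>E. E \<in> sets \<mu> \<and> measure \<mu> E \<le> \<eta> n \<and> (\<forall>u. u \<notin> E \<longrightarrow>
      \<eta> n * weight (map u [0..<k n]) / (C * ellipsoid_count (Tw (map u [0..<k n])) (r n (map u [0..<k n])))
        \<le> measure (self_affine_measure T p \<omega>) (cball (code_proj T \<omega> u) (2 * r n (map u [0..<k n]))))" for n
    using C(2)[of "r n" "\<eta> n" "k n", OF r \<eta>(1)] by blast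
  then obtain E where E: "\<And>n. E n \<in> sets \<mu>" "\<And>n. measure \<mu> (E n) \<le> \<eta> n"
    "\<And>n u. u \<notin> E n \<Longrightarrow>
      \<eta> n * weight (map u [0..<k n]) / (C * ellipsoid_count (Tw (map u [0..<k n])) (r n (map u [0..<k n])))
        \<le> measure (self_affine_measure T p \<omega>) (cball (code_proj T \<omega> u) (2 * r n (map u [0..<k n])))"
    by metis
  have "summable (\<lambda>n. measure \<mu> (E n))"
    by (rule summable_comparison_test'[OF \<eta>(2)]) (simp add: E)
  then have "AE u in \<mu>. \<forall>\<^sub>F n in sequentially. u \<in> space \<mu> - E n"
    by (intro borel_cantelli_AE1 E) (auto simp: emeasure_eq_measure)
  then have "AE u in \<mu>. \<forall>\<^sub>F n in sequentially.
    \<eta> n * weight (map u [0..<k n]) / (C * ellipsoid_count (Tw (map u [0..<k n])) (r n (map u [0..<k n])))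
      \<le> measure (self_affine_measure T p \<omega>) (cball (code_proj T \<omega> u) (2 * r n (map u [0..<k n])))"
    by (rule eventually_mono) (auto elim!: eventually_mono intro: E(3))
  with C(1) show ?thesis by blast
qed

lemma measure_cball_mono:
  "r \<le> r' \<Longrightarrow> measure (self_affine_measure T p \<omega>) (cball x r) \<le> measure (self_affine_measure T p \<omega>) (cball x r')"
proof -
  interpret nu: prob_space "self_affine_measure T p \<omega>" by (rule prob_self_affine)
  show "r \<le> r' \<Longrightarrow> ?thesis" by (intro nu.finite_measure_mono) auto
qed

text \<open>The empty word is used at every step, so the whole support is covered at radius
  \<open>(1/2) ^ n\<close>. The thresholds \<open>((1/2) ^ n) powr \<delta>\<close> are summable and
  cause the loss \<delta> in the exponent.\<close>

lemma AE_ball_ge_dimension: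
  fixes \<omega> :: "'a ^ 'm"
  assumes \<delta>: "0 < \<delta>"
  shows "AE u in \<mu>. \<exists>c>0. \<forall>\<^sub>F r in at_right 0.
    c * r powr (real DIM('a) + \<delta>) \<le> measure (self_affine_measure T p \<omega>) (cball (code_proj T \<omega> u) r)"
proof -
  let ?r = "\<lambda>n. (1/2 :: real) ^ n"
  have "summable (\<lambda>n. (1/2 powr \<delta> :: real) ^ n)"
    using \<delta> by (intro summable_geometric) (simp add: gr_one_powr)
  moreover have pw: "(1/2 powr \<delta> :: real) ^ n = ?r n powr \<delta>" for n
    by (simp add: powr_realpow[symmetric] powr_powr powr_divide mult.commute power_divide)
  ultimately have sm: "summable (\<lambda>n. ?r n powr \<delta>)" by simp
  obtain C where C: "0 < C" "AE u in \<mu>. \<forall>\<^sub>F n in sequentially.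
    ?r n powr \<delta> * weight (map u [0..<0]) / (C * ellipsoid_count (Tw (map u [0..<0])) (?r n))
      \<le> measure (self_affine_measure T p \<omega>) (cball (code_proj T \<omega> u) (2 * ?r n))"
    using AE_eventually_ball_ge[of "\<lambda>n _. ?r n" "\<lambda>n. ?r n powr \<delta>" "\<lambda>_. 0" \<omega>] sm by auto
  show ?thesis
    using C(2)
  proof (rule eventually_mono)
    fix u assume ev: "\<forall>\<^sub>F n in sequentially.
      ?r n powr \<delta> * weight (map u [0..<0]) / (C * ellipsoid_count (Tw (map u [0..<0])) (?r n))
      \<le> measure (self_affine_measure T p \<omega>) (cball (code_proj T \<omega> u) (2 * ?r n))"
    have "\<forall>\<^sub>F r in at_right 0. (1 / C) * ((1/2) / 2) powr (real DIM('a) + \<delta>) * r powr (real DIM('a) + \<delta>)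
        \<le> measure (self_affine_measure T p \<omega>) (cball (code_proj T \<omega> u) r)"
    proof (rule eventually_ge_powr_of_sequence[where \<rho> = ?r])
      show "\<forall>\<^sub>F n in sequentially. (1 / C) * ?r n powr (real DIM('a) + \<delta>)
          \<le> measure (self_affine_measure T p \<omega>) (cball (code_proj T \<omega> u) (2 * ?r n))"
        using ev
      proof (rule eventually_mono)
        fix n assume le: "?r n powr \<delta> * weight (map u [0..<0]) / (C * ellipsoid_count (Tw (map u [0..<0])) (?r n))
          \<le> measure (self_affine_measure T p \<omega>) (cball (code_proj T \<omega> u) (2 * ?r n))"
        have "ellipsoid_count (id :: 'a \<Rightarrow> 'a) (?r n) = (1 / ?r n) ^ DIM('a)"
          by (rule ellipsoid_count_id) (auto simp: power_le_one)
        also have "\<dots> = 1 / ?r n powr real DIM('a)"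
          by (subst powr_realpow) (auto simp: power_one_over)
        finally show "(1 / C) * ?r n powr (real DIM('a) + \<delta>)
          \<le> measure (self_affine_measure T p \<omega>) (cball (code_proj T \<omega> u) (2 * ?r n))"
          using le by (simp add: powr_add mult.commute)
      qed
    qed (use C \<delta> in \<open>auto intro: measure_cball_mono LIMSEQ_realpow_zero\<close>)
    then show "\<exists>c>0. \<forall>\<^sub>F r in at_right 0.
      c * r powr (real DIM('a) + \<delta>) \<le> measure (self_affine_measure T p \<omega>) (cball (code_proj T \<omega> u) r)"
      using C(1) by (intro exI[of _ "1 / C * ((1/2) / 2) powr (real DIM('a) + \<delta>)"]) simp
  qed
qed

text \<open>As a quotient of two values of the singular value function, the critical radius is
  bounded below by a lower bound for the numerator and an upper one for the denominator. The latter
  is submultiplicativity; the former is submultiplicativity for \<open>T\<^sub>w\<close> written as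
  the longer product times the inverse of the last map.\<close>

lemma critical_radius_snoc:
  assumes s: "0 \<le> s" "s \<le> real DIM('a)"
  obtains \<kappa> where "0 < \<kappa>" "\<And>w i. \<kappa> * critical_radius s (Tw w) \<le> critical_radius s (Tw (w @ [i]))"
proof -
  let ?l = "real (critical_index s)" and ?l' = "real (critical_index s - 1)"
  let ?C = "cover_const DIM('a)"
  have bnd: "0 \<le> ?l" "?l \<le> real DIM('a)" "0 \<le> ?l'" "?l' \<le> real DIM('a)"
    using critical_index_bounds[OF s] by auto
  have C: "0 < ?C" by (rule cover_const_pos) simp
  obtain G where G: "\<And>i. linear (G i)" "\<And>i. inj (G i)" "\<And>i. G i \<circ> T i = id" "\<And>i. T i \<circ> G i = id"
    using inverse_maps by metis
  define K where "K i = ?C * singular_value_fun ?l (G i) * (?C * singular_value_fun ?l' (T i))" for i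
  have Kpos: "0 < K i" for i
    unfolding K_def using C G bnd lin bij[THEN bij_is_inj]
    by (intro mult_pos_pos singular_value_fun_pos) auto
  define \<kappa> where "\<kappa> = Min (range (\<lambda>i. 1 / K i))"
  show ?thesis
  proof (rule that[of \<kappa>])
    show "0 < \<kappa>" using Kpos by (auto simp: \<kappa>_def)
    have quotient_le: "1 / k * (a / b) \<le> c / d" if "0 < k" "0 < b" "0 < d" "a * d \<le> k * (c * b)" for k a b c d :: real
      using that by (simp add: field_simps)
    fix w i
    have snoc: "Tw (w @ [i]) = Tw w \<circ> T i" by (simp add: word_map_append)
    have pos: "0 < singular_value_fun ?l' (Tw v)" "0 < singular_value_fun ?l (Tw v)" for v
      using bnd by (auto intro: svf_pos)
    have q: "critical_radius s (Tw v) = singular_value_fun ?l (Tw v) / singular_value_fun ?l' (Tw v)" for v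
      using critical_radius_eq_quotient[OF linear_word_map inj_word_map s, of v] pos[of v]
      by (simp add: eq_divide_eq)
    have "Tw w = Tw (w @ [i]) \<circ> G i" unfolding snoc by (simp add: o_assoc[symmetric] G(4))
    then have "singular_value_fun ?l (Tw w) \<le> ?C * (singular_value_fun ?l (Tw (w @ [i])) * singular_value_fun ?l (G i))"
      using singular_value_fun_comp_le_small[OF linear_word_map[of "w @ [i]"] inj_word_map[of "w @ [i]"] G(1,2)[of i] bnd(1,2)]
      by simp
    moreover have "singular_value_fun ?l' (Tw (w @ [i])) \<le> ?C * (singular_value_fun ?l' (Tw w) * singular_value_fun ?l' (T i))"
      unfolding snoc by (intro singular_value_fun_comp_le_small linear_word_map inj_word_map lin bij bij_is_inj bnd)
    ultimately have "singular_value_fun ?l (Tw w) * singular_value_fun ?l' (Tw (w @ [i]))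
      \<le> (?C * (singular_value_fun ?l (Tw (w @ [i])) * singular_value_fun ?l (G i))) * (?C * (singular_value_fun ?l' (Tw w) * singular_value_fun ?l' (T i)))"
      using less_imp_le[OF pos(1)] less_imp_le[OF order_less_le_trans[OF pos(2)]]
      by (intro mult_mono) assumption+
    also have "\<dots> = K i * (singular_value_fun ?l (Tw (w @ [i])) * singular_value_fun ?l' (Tw w))"
      by (simp add: K_def mult_ac)
    finally have "1 / K i * critical_radius s (Tw w) \<le> critical_radius s (Tw (w @ [i]))"
      unfolding q using pos[of w] pos[of "w @ [i]"] Kpos[of i]
      by (intro quotient_le)
    moreover have "\<kappa> * critical_radius s (Tw w) \<le> 1 / K i * critical_radius s (Tw w)"
      using critical_radius_pos[OF linear_word_map inj_word_map s, of w]
      by (intro mult_right_mono) (auto simp: \<kappa>_def)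
    ultimately show "\<kappa> * critical_radius s (Tw w) \<le> critical_radius s (Tw (w @ [i]))" by linarith
  qed
qed

lemma critical_radius_le:
  assumes s: "0 \<le> s" "s \<le> real DIM('a)"
  shows "critical_radius s (Tw w) \<le> (1/2) ^ length w"
proof -
  have "1 \<le> critical_index s" "critical_index s \<le> DIM('a)"
    using critical_index_bounds[OF s] by auto
  from singular_value_attained[OF linear_word_map[of w] this]
  obtain b where "norm b = 1" "critical_radius s (Tw w) = norm (Tw w b)"
    unfolding critical_radius_def by blast
  then show ?thesis using norm_word_map_le[of w b] by simp
qed

text \<open>Each prefix is covered at its own critical radius, where \<open>\<rho> powr s\<close>
  times the number of balls is \<open>\<phi>\<^sup>s\<close>, up to a constant. Above
  \<open>d\<^sub>1\<close> this is at most \<open>exp (- k e)\<close> times the weight, and these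
  exponentials serve as the summable thresholds.\<close>

lemma AE_ball_ge_d_one:
  fixes \<omega> :: "'a ^ 'm"
  assumes s: "d_one T p < s" "s \<le> real DIM('a)"
  shows "AE u in \<mu>. \<exists>c>0. \<forall>\<^sub>F r in at_right 0.
    c * r powr s \<le> measure (self_affine_measure T p \<omega>) (cball (code_proj T \<omega> u) r)"
proof -
  have s0: "0 \<le> s" using s d_one_props(1) by simp
  let ?\<rho> = "\<lambda>w. critical_radius s (Tw w)"
  obtain e where e: "0 < e" "AE u in \<mu>. \<forall>\<^sub>F k in sequentially.
       singular_value_fun s (Tw (map u [0..<k])) \<le> exp (- real k * e) * weight (map u [0..<k])"
    by (rule AE_svf_le_weight[OF s(1)]) (rule that)
  obtain \<kappa> where \<kappa>: "0 < \<kappa>" "\<And>w i. \<kappa> * ?\<rho> w \<le> ?\<rho> (w @ [i])"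
    by (rule critical_radius_snoc[OF s0 s(2)]) (rule that)
  have rho: "0 < ?\<rho> w" for w by (rule critical_radius_pos[OF linear_word_map inj_word_map s0 s(2)])
  have "summable (\<lambda>k. exp (- e) ^ k)" using e by (intro summable_geometric) simp
  moreover have "exp (- e) ^ k = exp (- real k * e)" for k by (simp flip: exp_of_nat_mult)
  ultimately have sm: "summable (\<lambda>k. exp (- real k * e))" by simp
  obtain C where C: "0 < C" "AE u in \<mu>. \<forall>\<^sub>F k in sequentially.
    exp (- real k * e) * weight (map u [0..<k]) / (C * ellipsoid_count (Tw (map u [0..<k])) (?\<rho> (map u [0..<k])))
      \<le> measure (self_affine_measure T p \<omega>) (cball (code_proj T \<omega> u) (2 * ?\<rho> (map u [0..<k])))"
    using AE_eventually_ball_ge[of "\<lambda>k. ?\<rho>" "\<lambda>k. exp (- real k * e)" "\<lambda>k. k" \<omega>] sm rho by auto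
  show ?thesis
    using e(2) C(2)
  proof eventually_elim
    case (elim u)
    let ?w = "\<lambda>k. map u [0..<k]"
    have "\<forall>\<^sub>F r in at_right 0. (1 / C) * (\<kappa> / 2) powr s * r powr s
        \<le> measure (self_affine_measure T p \<omega>) (cball (code_proj T \<omega> u) r)"
    proof (rule eventually_ge_powr_of_sequence[where \<rho> = "\<lambda>k. ?\<rho> (?w k)"])
      show "(\<lambda>k. ?\<rho> (?w k)) \<longlonglongrightarrow> 0"
      proof (rule tendsto_sandwich[OF _ _ tendsto_const])
        show "(\<lambda>k. (1/2 :: real) ^ k) \<longlonglongrightarrow> 0" by (intro LIMSEQ_realpow_zero) auto
        show "\<forall>\<^sub>F k in sequentially. ?\<rho> (?w k) \<le> (1/2) ^ k"
          using critical_radius_le[OF s0 s(2), of "?w k" for k] by (intro always_eventually) (auto simp: length_map)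
      qed (use rho in \<open>auto intro: always_eventually less_imp_le\<close>)
      show "\<kappa> * ?\<rho> (?w k) \<le> ?\<rho> (?w (Suc k))" for k using \<kappa>(2)[of "?w k" "u k"] by simp
      show "\<forall>\<^sub>F k in sequentially. (1 / C) * ?\<rho> (?w k) powr s
          \<le> measure (self_affine_measure T p \<omega>) (cball (code_proj T \<omega> u) (2 * ?\<rho> (?w k)))"
        using elim
      proof eventually_elim
        case (elim k)
        let ?F = "ellipsoid_count (Tw (?w k)) (?\<rho> (?w k))"
        have F: "0 < ?F" using ellipsoid_count_ge_1[of "Tw (?w k)" "?\<rho> (?w k)"] by linarith
        have "?\<rho> (?w k) powr s * ?F = singular_value_fun s (Tw (?w k))"
          by (rule singular_value_fun_eq_critical[OF linear_word_map inj_word_map s0 s(2), symmetric])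
        also have "\<dots> \<le> exp (- real k * e) * weight (?w k)" by (rule elim(1))
        finally have "?\<rho> (?w k) powr s \<le> exp (- real k * e) * weight (?w k) / ?F"
          using F by (simp add: le_divide_eq)
        then have "(1 / C) * ?\<rho> (?w k) powr s \<le> (1 / C) * (exp (- real k * e) * weight (?w k) / ?F)"
          using C(1) by (intro mult_left_mono) auto
        also have "\<dots> = exp (- real k * e) * weight (?w k) / (C * ?F)" by simp
        finally show ?case using elim(2) by linarith
      qed
    qed (use C(1) s0 \<kappa>(1) rho in \<open>auto intro: measure_cball_mono\<close>)
    then show ?case
      using C(1) \<kappa>(1) by (intro exI[of _ "1 / C * (\<kappa> / 2) powr s"]) simp
  qed
qed

end

section \<open>Exact dimensionality\<close>

text \<open>By monotonicity \<open>f r\<close> lies between its values at the two neighbouring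
  dyadic radii. Passing to them shifts \<open>ln r\<close> by at most \<open>ln 2\<close>, which is
  negligible against \<open>- ln r\<close>.\<close>

lemma tendsto_ln_ratio_of_dyadic:
  fixes f :: "real \<Rightarrow> real"
  assumes mono: "\<And>r r'. r \<le> r' \<Longrightarrow> f r \<le> f r'" and D: "0 < D"
    and loc: "\<And>j. \<forall>\<^sub>F n in sequentially. ((1/2) ^ n) powr (D + 1 / real (Suc j)) \<le> f ((1/2) ^ n) \<and>
      f ((1/2) ^ n) \<le> ((1/2) ^ n) powr (D - 1 / real (Suc j))"
  shows "((\<lambda>r. ln (f r) / ln r) \<longlongrightarrow> D) (at_right 0)"
proof -
  let ?r = "\<lambda>n. (1/2 :: real) ^ n"
  have inv_ln: "((\<lambda>r::real. ln 2 / (- ln r)) \<longlongrightarrow> 0) (at_right 0)"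
    by (rule tendsto_divide_0[OF tendsto_const])
       (rule filterlim_at_top_imp_at_infinity, rule filterlim_uminus_at_bot[THEN iffD1, OF ln_at_0])
  have small: "\<forall>\<^sub>F r::real in at_right 0. 0 < r \<and> r < 1"
    unfolding eventually_at_right_field by (intro exI[of _ 1]) auto
  have lower: "\<forall>\<^sub>F r in at_right 0. ?r (dyadic_index r) powr (D + 1 / real (Suc j)) \<le> f (?r (dyadic_index r))" for j
    using filterlim_dyadic_index loc[of j] unfolding filterlim_iff by (fastforce elim: eventually_mono)
  have upper: "\<forall>\<^sub>F r in at_right 0. 1 \<le> dyadic_index r \<and>
      f (?r (dyadic_index r - 1)) \<le> ?r (dyadic_index r - 1) powr (D - 1 / real (Suc j))" for j
  proof (rule eventually_conj)
    show "\<forall>\<^sub>F r in at_right 0. 1 \<le> dyadic_index r"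
      using filterlim_dyadic_index unfolding filterlim_at_top by blast
    have "filterlim (\<lambda>r. dyadic_index r - 1) sequentially (at_right 0)"
      by (rule filterlim_compose[OF filterlim_minus_const_nat_at_top filterlim_dyadic_index])
    then show "\<forall>\<^sub>F r in at_right 0. f (?r (dyadic_index r - 1)) \<le> ?r (dyadic_index r - 1) powr (D - 1 / real (Suc j))"
      using loc[of j] unfolding filterlim_iff by (fastforce elim: eventually_mono)
  qed
  show ?thesis
  proof (rule order_tendstoI)
    fix a assume "a < D"
    then have "0 < min D (D - a)" using D by simp
    then obtain j where "inverse (real (Suc j)) < min D (D - a)" using reals_Archimedean by blast
    then have j: "a < D - 1 / real (Suc j)" "0 \<le> D - 1 / real (Suc j)" by (auto simp: inverse_eq_divide)
    let ?q = "D - 1 / real (Suc j)"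
    have "((\<lambda>r. ?q * (1 - ln 2 / (- ln r))) \<longlongrightarrow> ?q * (1 - 0)) (at_right 0)"
      by (intro tendsto_intros inv_ln)
    then have "\<forall>\<^sub>F r in at_right 0. a < ?q * (1 - ln 2 / (- ln r))"
      using j by (intro order_tendstoD(1)[where y = "?q * (1 - 0)"]) auto
    then show "\<forall>\<^sub>F r in at_right 0. a < ln (f r) / ln r"
      using small upper[of j] lower[of 0]
    proof eventually_elim
      case (elim r)
      let ?n = "dyadic_index r"
      have ln: "0 < - ln r" using elim by simp
      note db = dyadic_index_bounds[of r]
      have two: "?r (?n - 1) = 2 * ?r ?n" using elim by (cases ?n) auto
      \<comment> \<open>The tolerance is arbitrary here: some lower bound is needed only to know
        that \<open>f r\<close> is positive before its logarithm is compared.\<close>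
      have "0 < ?r ?n powr (D + 1 / real (Suc 0))" by simp
      also have "\<dots> \<le> f (?r ?n)" by (rule elim(4))
      also have "\<dots> \<le> f r" using db elim by (intro mono) auto
      finally have pos: "0 < f r" .
      have "f r \<le> f (?r (?n - 1))" using db elim two by (intro mono) auto
      also have "\<dots> \<le> ?r (?n - 1) powr ?q" using elim by blast
      finally have "f r \<le> ?r (?n - 1) powr ?q" .
      then have "ln (f r) \<le> ln (?r (?n - 1) powr ?q)" using pos by (subst ln_le_cancel_iff) auto
      also have "\<dots> = ?q * ln (?r (?n - 1))" by (simp only: ln_powr)
      also have "\<dots> \<le> ?q * (ln r + ln 2)"
      proof (rule mult_left_mono)
        have "ln (?r (?n - 1)) \<le> ln (2 * r)" using db elim two by (subst ln_le_cancel_iff) auto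
        then show "ln (?r (?n - 1)) \<le> ln r + ln 2" using elim by (simp add: ln_mult)
      qed (rule j)
      finally have "- (?q * (ln r + ln 2)) / (- ln r) \<le> - ln (f r) / (- ln r)"
        using ln by (intro divide_right_mono) auto
      moreover have "- (?q * (ln r + ln 2)) / (- ln r) = ?q * (1 - ln 2 / (- ln r))"
        using ln by (simp add: add_divide_distrib distrib_left diff_divide_distrib)
      ultimately show ?case using elim(1) by simp
    qed
  next
    fix b assume "D < b"
    then obtain j where "inverse (real (Suc j)) < b - D" using reals_Archimedean[of "b - D"] by auto
    then have j: "D + 1 / real (Suc j) < b" by (simp add: inverse_eq_divide)
    let ?q = "D + 1 / real (Suc j)"
    have q: "0 \<le> ?q" using D by simp
    have "((\<lambda>r. ?q * (1 + ln 2 / (- ln r))) \<longlongrightarrow> ?q * (1 + 0)) (at_right 0)"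
      by (intro tendsto_intros inv_ln)
    then have "\<forall>\<^sub>F r in at_right 0. ?q * (1 + ln 2 / (- ln r)) < b"
      using j by (intro order_tendstoD(2)[where y = "?q * (1 + 0)"]) auto
    then show "\<forall>\<^sub>F r in at_right 0. ln (f r) / ln r < b"
      using small lower[of j]
    proof eventually_elim
      case (elim r)
      let ?n = "dyadic_index r"
      have ln: "0 < - ln r" using elim by simp
      note db = dyadic_index_bounds[of r]
      have "?r ?n powr ?q \<le> f (?r ?n)" by (rule elim(3))
      also have "\<dots> \<le> f r" using db elim by (intro mono) auto
      finally have le: "?r ?n powr ?q \<le> f r" .
      have pos: "0 < ?r ?n powr ?q" by simp
      have "?q * (ln r - ln 2) \<le> ?q * ln (?r ?n)"
      proof (rule mult_left_mono)
        have "ln r \<le> ln (2 * ?r ?n)" using db elim by (subst ln_le_cancel_iff) auto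
        then show "ln r - ln 2 \<le> ln (?r ?n)" by (simp add: ln_mult)
      qed (rule q)
      also have "\<dots> = ln (?r ?n powr ?q)" by (simp only: ln_powr)
      also have "\<dots> \<le> ln (f r)"
        by (rule iffD2[OF ln_le_cancel_iff[OF pos less_le_trans[OF pos le]] le])
      finally have "- ln (f r) / (- ln r) \<le> - (?q * (ln r - ln 2)) / (- ln r)"
        using ln by (intro divide_right_mono) auto
      moreover have "- (?q * (ln r - ln 2)) / (- ln r) = ?q * (1 + ln 2 / (- ln r))"
        using ln by (simp add: right_diff_distrib diff_divide_distrib distrib_left)
      ultimately show ?case using elim(1) by simp
    qed
  qed
qed

section \<open>Local dimension for almost all translations\<close>

context self_affine_system
begin

lemma AE_self_affine_iff:
  assumes "{x. P x} \<in> sets borel"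
  shows "(AE x in self_affine_measure T p \<omega>. P x) \<longleftrightarrow> (AE u in \<mu>. P (code_proj T \<omega> u))"
  unfolding self_affine_measure_def using assms by (intro AE_distr_iff measurable_code_proj) simp

lemma AE_local_dimension_bounds:
  assumes e: "0 < e"
  defines "D \<equiv> min (d_one T p) (real DIM('a))"
  shows "AE \<omega> in lborel. AE x in self_affine_measure T p \<omega>. \<forall>\<^sub>F n in sequentially.
    ((1/2) ^ n) powr (D + e) \<le> measure (self_affine_measure T p \<omega>) (cball x ((1/2) ^ n)) \<and>
    measure (self_affine_measure T p \<omega>) (cball x ((1/2) ^ n)) \<le> ((1/2) ^ n) powr (D - e)"
proof -
  let ?r = "\<lambda>n. (1/2 :: real) ^ n"
  let ?\<nu> = "self_affine_measure T p"
  have D: "0 < D" using d_one_props(1) by (simp add: D_def)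
  \<comment> \<open>Half of the tolerance moves \<open>s\<close> strictly below
    \<open>d\<^sub>1\<close>, the other half is the loss in \<open>AE_ball_measure_le\<close>; the
    maximum keeps the exponent nonnegative.\<close>
  define s where "s = max 0 (D - e / 2)"
  have s: "0 \<le> s" "s < d_one T p" "s \<le> real DIM('a)" "D - e \<le> s - e / 2"
    using D e by (auto simp: s_def D_def)
  \<comment> \<open>If \<open>d\<^sub>1\<close> is below the dimension, \<open>t\<close> has to
    exceed \<open>d\<^sub>1\<close> without exceeding the dimension. Otherwise the trivial cover is
    used, with any exponent above the dimension.\<close>
  define t where "t = (if d_one T p < real DIM('a) then min (real DIM('a)) (D + e / 2) else real DIM('a) + e / 2)"
  have t: "t \<le> D + e / 2" by (auto simp: t_def D_def)
  have up: "AE u in \<mu>. \<exists>c>0. \<forall>\<^sub>F r in at_right 0. c * r powr t \<le> measure (?\<nu> \<omega>) (cball (code_proj T \<omega> u) r)" for \<omega>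
  proof (cases "d_one T p < real DIM('a)")
    case True
    then have "d_one T p < t" "t \<le> real DIM('a)" using e by (auto simp: t_def D_def)
    then show ?thesis by (rule AE_ball_ge_d_one)
  next
    case False
    then have "t = real DIM('a) + e / 2" by (simp add: t_def)
    then show ?thesis using AE_ball_ge_dimension[of "e / 2" \<omega>] e by simp
  qed
  have lim: "filterlim ?r (at_right 0) sequentially"
    unfolding filterlim_at by (auto intro!: LIMSEQ_realpow_zero)
  have "AE \<omega> in lborel. AE u in \<mu>. \<forall>\<^sub>F n in sequentially.
      measure (?\<nu> \<omega>) (cball (code_proj T \<omega> u) (?r n)) \<le> ?r n powr (s - e / 2)"
    using e by (intro AE_ball_measure_le s) simp
  then show ?thesis
  proof (rule eventually_mono)
    fix \<omega> :: "'a ^ 'm"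
    assume low: "AE u in \<mu>. \<forall>\<^sub>F n in sequentially.
      measure (?\<nu> \<omega>) (cball (code_proj T \<omega> u) (?r n)) \<le> ?r n powr (s - e / 2)"
    have ball: "(\<lambda>x. measure (?\<nu> \<omega>) (cball x (?r n))) \<in> borel_measurable borel" for n
      using measurable_measure_cball[OF prob_self_affine sets_self_affine_measure, of \<omega> "?r n"]
      by (simp cong: measurable_cong_sets add: self_affine_measure_def)
    let ?P = "\<lambda>x. \<forall>\<^sub>F n in sequentially. ?r n powr (D + e) \<le> measure (?\<nu> \<omega>) (cball x (?r n)) \<and>
        measure (?\<nu> \<omega>) (cball x (?r n)) \<le> ?r n powr (D - e)"
    define A where "A n = (\<lambda>x. measure (?\<nu> \<omega>) (cball x (?r n))) -` {?r n powr (D + e)..?r n powr (D - e)}" for n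
    have "A n \<in> sets borel" for n
      using measurable_sets[OF ball, of "{?r n powr (D + e)..?r n powr (D - e)}"] by (simp add: A_def)
    then have "(\<Inter>n\<in>{N..}. A n) \<in> sets borel" for N :: nat
      by (intro sets.countable_INT') auto
    then have "(\<Union>N. \<Inter>n\<in>{N..}. A n) \<in> sets borel"
      by (intro sets.countable_UN) auto
    also have "(\<Union>N. \<Inter>n\<in>{N..}. A n) = {x. \<exists>N. \<forall>n\<ge>N. x \<in> A n}" by auto
    also have "\<dots> = {x. ?P x}"
      unfolding eventually_sequentially A_def vimage_def mem_Collect_eq atLeastAtMost_iff ..
    finally have P: "{x. ?P x} \<in> sets borel" .
    have "AE u in \<mu>. ?P (code_proj T \<omega> u)"
      using low up[of \<omega>]
    proof eventually_elim
      case (elim u)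
      then obtain c where c: "0 < c" "\<forall>\<^sub>F r in at_right 0. c * r powr t \<le> measure (?\<nu> \<omega>) (cball (code_proj T \<omega> u) r)"
        by blast
      have "\<forall>\<^sub>F n in sequentially. c * ?r n powr t \<le> measure (?\<nu> \<omega>) (cball (code_proj T \<omega> u) (?r n))"
        using lim c(2) unfolding filterlim_iff by blast
      \<comment> \<open>The remaining half of the tolerance absorbs the constant \<open>c\<close>,
        which depends on the sequence \<open>u\<close>.\<close>
      moreover have "\<forall>\<^sub>F n in sequentially. ?r n powr (e / 2) < c"
      proof -
        have "(\<lambda>n. ?r n powr (e / 2)) \<longlonglongrightarrow> 0"
          using e by (intro tendsto_zero_powrI[where b = "e / 2"] LIMSEQ_realpow_zero tendsto_const) auto
        then show ?thesis by (rule order_tendstoD) (rule c(1))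
      qed
      ultimately show ?case
        using elim(1)
      proof eventually_elim
        case (elim n)
        have r: "0 \<le> ?r n" "?r n \<le> 1" by (auto simp: power_le_one)
        have "?r n powr (D + e) \<le> ?r n powr (e / 2 + t)" using r t by (intro powr_mono') auto
        also have "\<dots> = ?r n powr (e / 2) * ?r n powr t" by (rule powr_add)
        also have "\<dots> \<le> c * ?r n powr t" using elim by (intro mult_right_mono) auto
        finally have "?r n powr (D + e) \<le> measure (?\<nu> \<omega>) (cball (code_proj T \<omega> u) (?r n))"
          using elim by linarith
        moreover have "?r n powr (s - e / 2) \<le> ?r n powr (D - e)" using r s by (intro powr_mono') auto
        ultimately show ?case using elim by linarith
      qed
    qed
    then show "AE x in ?\<nu> \<omega>. ?P x" by (subst AE_self_affine_iff[OF P])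
  qed
qed

lemma AE_norm_le: "AE x in self_affine_measure T p \<omega>. norm x \<le> 2 * W \<omega>"
proof (subst AE_self_affine_iff)
  show "{x :: 'a. norm x \<le> 2 * W \<omega>} \<in> sets borel" by measurable
qed (use norm_code_proj_le in auto)

text \<open>The null set of \<omega> must not depend on the tolerance. Countably many tolerances
  \<open>1 / (j + 1)\<close> suffice, because for radii below 1 the bounds weaken as the tolerance
  grows.\<close>

lemma AE_local_dimension:
  defines "D \<equiv> min (d_one T p) (real DIM('a))"
  shows "AE \<omega> in lborel. \<forall>e>0. AE x in self_affine_measure T p \<omega>. \<forall>\<^sub>F n in sequentially.
    ((1/2) ^ n) powr (D + e) \<le> measure (self_affine_measure T p \<omega>) (cball x ((1/2) ^ n)) \<and>
    measure (self_affine_measure T p \<omega>) (cball x ((1/2) ^ n)) \<le> ((1/2) ^ n) powr (D - e)"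
proof -
  let ?r = "\<lambda>n. (1/2 :: real) ^ n"
  let ?\<nu> = "self_affine_measure T p"
  have "AE \<omega> in lborel. \<forall>j. AE x in ?\<nu> \<omega>. \<forall>\<^sub>F n in sequentially.
    ?r n powr (D + 1 / real (Suc j)) \<le> measure (?\<nu> \<omega>) (cball x (?r n)) \<and>
    measure (?\<nu> \<omega>) (cball x (?r n)) \<le> ?r n powr (D - 1 / real (Suc j))"
    unfolding AE_all_countable D_def by (intro allI AE_local_dimension_bounds) simp
  then show ?thesis
  proof (rule eventually_mono, intro allI impI)
    fix \<omega> :: "'a ^ 'm" and e :: real
    assume *: "\<forall>j. AE x in ?\<nu> \<omega>. \<forall>\<^sub>F n in sequentially.
      ?r n powr (D + 1 / real (Suc j)) \<le> measure (?\<nu> \<omega>) (cball x (?r n)) \<and>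
      measure (?\<nu> \<omega>) (cball x (?r n)) \<le> ?r n powr (D - 1 / real (Suc j))" and "0 < e"
    then obtain j where j: "1 / real (Suc j) < e" using reals_Archimedean[of e] by (auto simp: inverse_eq_divide)
    show "AE x in ?\<nu> \<omega>. \<forall>\<^sub>F n in sequentially.
      ?r n powr (D + e) \<le> measure (?\<nu> \<omega>) (cball x (?r n)) \<and> measure (?\<nu> \<omega>) (cball x (?r n)) \<le> ?r n powr (D - e)"
      using *[rule_format, of j]
    proof (rule eventually_mono, elim eventually_mono conjE)
      fix x n assume "?r n powr (D + 1 / real (Suc j)) \<le> measure (?\<nu> \<omega>) (cball x (?r n))"
        "measure (?\<nu> \<omega>) (cball x (?r n)) \<le> ?r n powr (D - 1 / real (Suc j))"
      moreover have "?r n powr (D + e) \<le> ?r n powr (D + 1 / real (Suc j))"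
        "?r n powr (D - 1 / real (Suc j)) \<le> ?r n powr (D - e)"
        using j by (intro powr_mono'; simp add: power_le_one)+
      ultimately show "?r n powr (D + e) \<le> measure (?\<nu> \<omega>) (cball x (?r n)) \<and>
        measure (?\<nu> \<omega>) (cball x (?r n)) \<le> ?r n powr (D - e)" by linarith
    qed
  qed
qed

end

theorem theorem6p1:
  fixes T :: "'m::finite \<Rightarrow> real ^ 'n \<Rightarrow> real ^ 'n" and p :: "'m \<Rightarrow> real"
  assumes "2 \<le> CARD('m)"
    and "\<And>i. linear (T i)" and "\<And>i. bij (T i)" and "\<And>i. onorm (T i) < 1/2"
    and "\<And>i. 0 < p i" and "(\<Sum>i\<in>UNIV. p i) = 1"
  shows "AE \<omega> in (lebesgue :: ((real ^ 'n) ^ 'm) measure).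
    exact_dimensional (self_affine_measure T p \<omega>) (min (d_one T p) (real CARD('n))) \<and>
    has_information_dimension (self_affine_measure T p \<omega>) (min (d_one T p) (real CARD('n)))"
proof (rule AE_completion)
  interpret self_affine_system p T
    by (intro self_affine_system.intro bernoulli.intro self_affine_system_axioms.intro assms)
  let ?D = "min (d_one T p) (real CARD('n))"
  let ?\<nu> = "self_affine_measure T p"
  have D: "0 < ?D" using d_one_props(1) by simp
  show "AE \<omega> in lborel. exact_dimensional (?\<nu> \<omega>) ?D \<and> has_information_dimension (?\<nu> \<omega>) ?D"
    using AE_local_dimension
  proof (rule eventually_mono)
    fix \<omega> :: "(real ^ 'n) ^ 'm"
    assume "\<forall>e>0. AE x in ?\<nu> \<omega>. \<forall>\<^sub>F n in sequentially.
      ((1/2) ^ n) powr (min (d_one T p) (real DIM(real ^ 'n)) + e) \<le> measure (?\<nu> \<omega>) (cball x ((1/2) ^ n)) \<and>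
      measure (?\<nu> \<omega>) (cball x ((1/2) ^ n)) \<le> ((1/2) ^ n) powr (min (d_one T p) (real DIM(real ^ 'n)) - e)"
    then have loc: "AE x in ?\<nu> \<omega>. \<forall>\<^sub>F n in sequentially.
      ((1/2) ^ n) powr (?D + e) \<le> measure (?\<nu> \<omega>) (cball x ((1/2) ^ n)) \<and>
      measure (?\<nu> \<omega>) (cball x ((1/2) ^ n)) \<le> ((1/2) ^ n) powr (?D - e)" if "0 < e" for e
      using that by simp
    have "AE x in ?\<nu> \<omega>. \<forall>j. \<forall>\<^sub>F n in sequentially.
      ((1/2) ^ n) powr (?D + 1 / real (Suc j)) \<le> measure (?\<nu> \<omega>) (cball x ((1/2) ^ n)) \<and>
      measure (?\<nu> \<omega>) (cball x ((1/2) ^ n)) \<le> ((1/2) ^ n) powr (?D - 1 / real (Suc j))"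
      unfolding AE_all_countable by (intro allI loc) simp
    then have "exact_dimensional (?\<nu> \<omega>) ?D"
      unfolding exact_dimensional_def
      by (rule eventually_mono) (intro tendsto_ln_ratio_of_dyadic measure_cball_mono D, auto)
    moreover have "has_information_dimension (?\<nu> \<omega>) ?D"
      by (rule information_dimension_of_local_dimension[OF prob_self_affine sets_self_affine_measure AE_norm_le _ D loc])
         (use order_trans[OF norm_ge_zero norm_code_proj_le] in auto)
    ultimately show "exact_dimensional (?\<nu> \<omega>) ?D \<and> has_information_dimension (?\<nu> \<omega>) ?D" ..
  qed
qed

end
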